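(* Let $(\mathcal{A},\eta)$ be a contact Lie algebroid over $M$ with anchor $\rho$ and Reeb section $\xi$. If $\rho(\xi)=0$, then the bracket $$\{\,,\}:C^\infty(M)\times C^\infty(M)\to C^\infty(M),\qquad \{f,g\}=d\eta(a_f,a_g),$$ where $a_f$ denotes the Hamiltonian section of $f$, is a Poisson structure on $M$.
   Context: A Lie algebroid over $M$ is a vector bundle $\mathcal{A}\to M$ with a Lie bracket $[\,,]$ on $\Gamma(\mathcal{A})$ and a bundle map $\rho:\mathcal{A}\to TM$ (anchor) which is a Lie algebra homomorphism on sections and satisfies $[S_1,fS_2]=f[S_1,S_2]+(\rho(S_1)\cdot f)S_2$. Here $d$ is the Lie algebroid exterior derivative on $\Gamma(\wedge^k\mathcal{A}^* )$: $df(S)=\rho(S)\cdot f$, $d\eta(S,T)=\rho(S)\cdot\eta(T)-\rho(T)\cdot\eta(S)-\eta([S,T])$, etc. A contact Lie algebroid $(\mathcal{A},\eta)$ is a Lie algebroid of rank $2n+1$ with a section $\eta\in\Gamma(\mathcal{A}^* )$ such that $\eta\wedge(d\eta)^n\neq0$ everywhere. The Reeb section $\xi\in\Gamma(\mathcal{A})$ is the unique section with $\eta(\xi)=1$ and $i_\xi d\eta=0$. For $f\in C^\infty(M)$ the Hamiltonian section $a_f$ is the unique section of $\mathcal{A}$ with $\eta(a_f)=0$ and $df=i_{a_f}d\eta+(\rho(\xi)\cdot f)\,\eta$. *)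

theory Defs
  imports
    "HOL-Analysis.Analysis"
    "HOL-Combinatorics.Permutations"
    "HOL-Library.Function_Algebras"
begin

section \<open>Real-vector-valued functions form a real vector space\<close>

text \<open>Tangent vectors will be operators on functions, so the fibres of the tangent bundle live
  in a function space.  The additive structure is that of \<^theory>\<open>HOL-Library.Function_Algebras\<close>.\<close>

instantiation "fun" :: (type, real_vector) real_vector
begin

definition scaleR_fun :: "real \<Rightarrow> ('a \<Rightarrow> 'b) \<Rightarrow> 'a \<Rightarrow> 'b" where
  "scaleR_fun r f = (\<lambda>x. r *\<^sub>R f x)"

instance
  by standard
    (auto simp: scaleR_fun_def plus_fun_def scaleR_add_right scaleR_add_left fun_eq_iff)

end

section \<open>Smooth manifolds\<close>

text \<open>\<open>smooth_on\<close> is only used on open sets, and the domain is always finite-dimensional; there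
  \<open>C_k_on k\<close> is the usual \<open>C\<^sup>k\<close>.\<close>

primrec C_k_on ::
  "nat \<Rightarrow> 'e::real_normed_vector set \<Rightarrow> ('e \<Rightarrow> 'w::real_normed_vector) \<Rightarrow> bool" where
  "C_k_on 0 X f \<longleftrightarrow> continuous_on X f"
| "C_k_on (Suc k) X f \<longleftrightarrow>
     (\<forall>x\<in>X. f differentiable (at x)) \<and> (\<forall>v. C_k_on k X (\<lambda>x. frechet_derivative f (at x) v))"

definition smooth_on :: "'e::real_normed_vector set \<Rightarrow> ('e \<Rightarrow> 'w::real_normed_vector) \<Rightarrow> bool" where
  "smooth_on X f \<longleftrightarrow> (\<forall>k. C_k_on k X f)"

type_synonym ('m, 'e) chart = "'m set \<times> ('m \<Rightarrow> 'e)"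

text \<open>A smooth manifold is a Hausdorff second countable space, the type \<open>'m\<close>, with a smooth atlas
  (not necessarily maximal).  The model space \<open>'e\<close> is a finite-dimensional inner product space
  rather than a \<open>euclidean_space\<close>, because the latter class excludes dimension \<open>0\<close>.\<close>

definition smooth_manifold ::
  "('m::{t2_space,second_countable_topology}, 'e::real_inner) chart set \<Rightarrow> bool" where
  "smooth_manifold M \<longleftrightarrow>
     (\<exists>B::'e set. finite B \<and> span B = UNIV) \<and>
     (\<Union>(U, c)\<in>M. U) = UNIV \<and>
     (\<forall>(U, c)\<in>M. open U \<and> open (c ` U) \<and> homeomorphism U (c ` U) c (inv_into U c)) \<and>
     (\<forall>(U, c)\<in>M. \<forall>(V, d)\<in>M. smooth_on (c ` (U \<inter> V)) (d \<circ> inv_into U c))"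

definition smooth_fun_on ::
  "('m, 'e::real_inner) chart set \<Rightarrow> 'm set \<Rightarrow> ('m \<Rightarrow> 'w::real_normed_vector) \<Rightarrow> bool" where
  "smooth_fun_on M X f \<longleftrightarrow> (\<forall>(U, c)\<in>M. smooth_on (c ` (X \<inter> U)) (f \<circ> inv_into U c))"

definition C_infinity :: "('m, 'e::real_inner) chart set \<Rightarrow> ('m \<Rightarrow> real) set" where
  "C_infinity M = {f. smooth_fun_on M UNIV f}"

section \<open>Vector bundles\<close>

text \<open>The fibres are abstract vector spaces of the same dimension; they are realised as
  subspaces of an ambient real vector space \<open>'v\<close> that carries no topology and only serves to make
  the fibrewise operations available.  The topology and smooth structure of the total space are
  those determined by the local trivialisations \<open>(U, \<phi>)\<close>, where \<open>\<phi> p\<close> is a linear isomorphism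
  from the fibre over \<open>p \<in> U\<close> to the model fibre \<open>'f\<close>.\<close>

record ('m, 'v, 'f) vbundle =
  fibre :: "'m \<Rightarrow> 'v set"
  trivs :: "('m set \<times> ('m \<Rightarrow> 'v \<Rightarrow> 'f)) set"

definition fibrewise_linear ::
  "'v::real_vector set \<Rightarrow> ('v \<Rightarrow> 'w::real_vector) \<Rightarrow> bool" where
  "fibrewise_linear E h \<longleftrightarrow>
     (\<forall>v\<in>E. \<forall>w\<in>E. h (v + w) = h v + h w) \<and> (\<forall>r. \<forall>v\<in>E. h (r *\<^sub>R v) = r *\<^sub>R h v)"

definition vector_bundle ::
  "('m::{t2_space,second_countable_topology}, 'e::real_inner) chart set \<Rightarrow>
   ('m, 'v::real_vector, 'f::euclidean_space) vbundle \<Rightarrow> bool" where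
  "vector_bundle M A \<longleftrightarrow>
     (\<forall>p. subspace (fibre A p)) \<and>
     (\<Union>(U, \<phi>)\<in>trivs A. U) = UNIV \<and>
     (\<forall>(U, \<phi>)\<in>trivs A. open U \<and>
        (\<forall>p\<in>U. bij_betw (\<phi> p) (fibre A p) UNIV \<and> fibrewise_linear (fibre A p) (\<phi> p))) \<and>
     (\<forall>(U, \<phi>)\<in>trivs A. \<forall>(V, \<psi>)\<in>trivs A. \<forall>w.
        smooth_fun_on M (U \<inter> V) (\<lambda>p. \<psi> p (inv_into (fibre A p) (\<phi> p) w)))"

definition sections ::
  "('m, 'e::real_inner) chart set \<Rightarrow> ('m, 'v, 'f::real_normed_vector) vbundle \<Rightarrow> ('m \<Rightarrow> 'v) set"
  where
  "sections M A = {S. (\<forall>p. S p \<in> fibre A p) \<and>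
     (\<forall>(U, \<phi>)\<in>trivs A. smooth_fun_on M U (\<lambda>p. \<phi> p (S p)))}"

definition dual_sections ::
  "('m, 'e::real_inner) chart set \<Rightarrow> ('m, 'v::real_vector, 'f::real_normed_vector) vbundle \<Rightarrow>
   ('m \<Rightarrow> 'v \<Rightarrow> real) set" where
  "dual_sections M A = {\<eta>. (\<forall>p. fibrewise_linear (fibre A p) (\<eta> p)) \<and>
     (\<forall>(U, \<phi>)\<in>trivs A. \<forall>w. smooth_fun_on M U (\<lambda>p. \<eta> p (inv_into (fibre A p) (\<phi> p) w)))}"

text \<open>Bundle maps cover the identity of the base.\<close>

definition bundle_map ::
  "('m, 'e::real_inner) chart set \<Rightarrow> ('m, 'v::real_vector, 'f::real_normed_vector) vbundle \<Rightarrow>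
   ('m, 'w::real_vector, 'g::real_normed_vector) vbundle \<Rightarrow> ('m \<Rightarrow> 'v \<Rightarrow> 'w) \<Rightarrow> bool" where
  "bundle_map M A B \<rho> \<longleftrightarrow>
     (\<forall>p. \<forall>v\<in>fibre A p. \<rho> p v \<in> fibre B p) \<and>
     (\<forall>p. fibrewise_linear (fibre A p) (\<rho> p)) \<and>
     (\<forall>(U, \<phi>)\<in>trivs A. \<forall>(V, \<psi>)\<in>trivs B. \<forall>w.
        smooth_fun_on M (U \<inter> V) (\<lambda>p. \<psi> p (\<rho> p (inv_into (fibre A p) (\<phi> p) w))))"

section \<open>The tangent bundle\<close>

text \<open>A tangent vector at \<open>p\<close> is a directional derivative operator on smooth functions: in the
  chart \<open>(U, c)\<close>, the vector \<open>a\<close> gives \<open>f \<mapsto> D(f \<circ> c\<^sup>-\<^sup>1)(c p) a\<close>.  Outside \<open>C_infinity M\<close> the operator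
  is set to \<open>0\<close>, so that equality of operators is equality on smooth functions.\<close>

definition dir_deriv ::
  "('m, 'e::real_inner) chart set \<Rightarrow> ('m, 'e) chart \<Rightarrow> 'm \<Rightarrow> 'e \<Rightarrow> ('m \<Rightarrow> real) \<Rightarrow> real" where
  "dir_deriv M = (\<lambda>(U, c) p a f.
     if f \<in> C_infinity M then frechet_derivative (f \<circ> inv_into U c) (at (c p)) a else 0)"

definition tangent_space ::
  "('m, 'e::real_inner) chart set \<Rightarrow> 'm \<Rightarrow> (('m \<Rightarrow> real) \<Rightarrow> real) set" where
  "tangent_space M p = {dir_deriv M (U, c) p a | U c a. (U, c) \<in> M \<and> p \<in> U}"

definition tangent_bundle ::
  "('m, 'e::real_inner) chart set \<Rightarrow> ('m, ('m \<Rightarrow> real) \<Rightarrow> real, 'e) vbundle" where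
  "tangent_bundle M =
     \<lparr> fibre = tangent_space M,
       trivs = {(U, \<lambda>p v. THE a. v = dir_deriv M (U, c) p a) | U c. (U, c) \<in> M} \<rparr>"

definition vector_field_bracket ::
  "('m, 'e::real_inner) chart set \<Rightarrow> ('m \<Rightarrow> ('m \<Rightarrow> real) \<Rightarrow> real) \<Rightarrow> ('m \<Rightarrow> ('m \<Rightarrow> real) \<Rightarrow> real) \<Rightarrow>
   'm \<Rightarrow> ('m \<Rightarrow> real) \<Rightarrow> real" where
  "vector_field_bracket M X Y p f =
     (if f \<in> C_infinity M then X p (\<lambda>q. Y q f) - Y p (\<lambda>q. X q f) else 0)"

section \<open>Lie algebroids\<close>

definition act ::
  "('m \<Rightarrow> 'v \<Rightarrow> ('m \<Rightarrow> real) \<Rightarrow> real) \<Rightarrow> ('m \<Rightarrow> 'v) \<Rightarrow> ('m \<Rightarrow> real) \<Rightarrow> 'm \<Rightarrow> real" where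
  "act \<rho> S f = (\<lambda>p. \<rho> p (S p) f)"

definition lie_algebroid ::
  "('m::{t2_space,second_countable_topology}, 'e::real_inner) chart set \<Rightarrow>
   ('m, 'v::real_vector, 'f::euclidean_space) vbundle \<Rightarrow>
   (('m \<Rightarrow> 'v) \<Rightarrow> ('m \<Rightarrow> 'v) \<Rightarrow> 'm \<Rightarrow> 'v) \<Rightarrow> ('m \<Rightarrow> 'v \<Rightarrow> ('m \<Rightarrow> real) \<Rightarrow> real) \<Rightarrow> bool" where
  "lie_algebroid M A br \<rho> \<longleftrightarrow>
     smooth_manifold M \<and> vector_bundle M A \<and> bundle_map M A (tangent_bundle M) \<rho> \<and>
     (\<forall>S\<in>sections M A. \<forall>T\<in>sections M A. br S T \<in> sections M A) \<and>
     (\<forall>S\<in>sections M A. \<forall>T\<in>sections M A. \<forall>W\<in>sections M A. \<forall>a b.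
        br (\<lambda>p. a *\<^sub>R S p + b *\<^sub>R T p) W = (\<lambda>p. a *\<^sub>R br S W p + b *\<^sub>R br T W p) \<and>
        br W (\<lambda>p. a *\<^sub>R S p + b *\<^sub>R T p) = (\<lambda>p. a *\<^sub>R br W S p + b *\<^sub>R br W T p)) \<and>
     (\<forall>S\<in>sections M A. br S S = (\<lambda>p. 0)) \<and>
     (\<forall>S\<in>sections M A. \<forall>T\<in>sections M A. \<forall>W\<in>sections M A. \<forall>p.
        br S (br T W) p + br T (br W S) p + br W (br S T) p = 0) \<and>
     (\<forall>S\<in>sections M A. \<forall>T\<in>sections M A. \<forall>p.
        \<rho> p (br S T p) = vector_field_bracket M (\<lambda>q. \<rho> q (S q)) (\<lambda>q. \<rho> q (T q)) p) \<and>
     (\<forall>S\<in>sections M A. \<forall>T\<in>sections M A. \<forall>f\<in>C_infinity M.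
        br S (\<lambda>p. f p *\<^sub>R T p) = (\<lambda>p. f p *\<^sub>R br S T p + act \<rho> S f p *\<^sub>R T p))"

definition ext_d0 ::
  "('m \<Rightarrow> 'v \<Rightarrow> ('m \<Rightarrow> real) \<Rightarrow> real) \<Rightarrow> ('m \<Rightarrow> real) \<Rightarrow> ('m \<Rightarrow> 'v) \<Rightarrow> 'm \<Rightarrow> real" where
  "ext_d0 \<rho> f S = act \<rho> S f"

definition ext_d1 ::
  "(('m \<Rightarrow> 'v) \<Rightarrow> ('m \<Rightarrow> 'v) \<Rightarrow> 'm \<Rightarrow> 'v) \<Rightarrow> ('m \<Rightarrow> 'v \<Rightarrow> ('m \<Rightarrow> real) \<Rightarrow> real) \<Rightarrow>
   ('m \<Rightarrow> 'v \<Rightarrow> real) \<Rightarrow> ('m \<Rightarrow> 'v) \<Rightarrow> ('m \<Rightarrow> 'v) \<Rightarrow> 'm \<Rightarrow> real" where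
  "ext_d1 br \<rho> \<eta> S T =
     (\<lambda>p. act \<rho> S (\<lambda>q. \<eta> q (T q)) p - act \<rho> T (\<lambda>q. \<eta> q (S q)) p - \<eta> p (br S T p))"

section \<open>Contact Lie algebroids\<close>

text \<open>A \<open>k\<close>-form is used as an alternating \<open>C_infinity M\<close>-multilinear map on \<open>k\<close>-tuples of
  sections; the tuple is given as a sequence of which only the entries with index less than \<open>k\<close>
  matter.  In \<open>wedge k l\<close> the two arguments are a \<open>k\<close>-form and an \<open>l\<close>-form; the normalisation is
  the one for which \<open>(\<alpha> \<and> \<beta>)(S, T) = \<alpha>(S) \<beta>(T) - \<alpha>(T) \<beta>(S)\<close> on 1-forms.\<close>

type_synonym ('m, 'v) form = "(nat \<Rightarrow> 'm \<Rightarrow> 'v) \<Rightarrow> 'm \<Rightarrow> real"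

definition wedge :: "nat \<Rightarrow> nat \<Rightarrow> ('m, 'v) form \<Rightarrow> ('m, 'v) form \<Rightarrow> ('m, 'v) form" where
  "wedge k l \<alpha> \<beta> = (\<lambda>S p.
     (\<Sum>\<sigma> | \<sigma> permutes {..<k + l}.
        of_int (sign \<sigma>) * \<alpha> (\<lambda>i. S (\<sigma> i)) p * \<beta> (\<lambda>i. S (\<sigma> (k + i))) p) / (fact k * fact l))"

primrec two_form_power :: "('m, 'v) form \<Rightarrow> nat \<Rightarrow> ('m, 'v) form" where
  "two_form_power \<omega> 0 = (\<lambda>S p. 1)"
| "two_form_power \<omega> (Suc n) = wedge 2 (2 * n) \<omega> (two_form_power \<omega> n)"

definition contact_volume ::
  "(('m \<Rightarrow> 'v) \<Rightarrow> ('m \<Rightarrow> 'v) \<Rightarrow> 'm \<Rightarrow> 'v) \<Rightarrow> ('m \<Rightarrow> 'v \<Rightarrow> ('m \<Rightarrow> real) \<Rightarrow> real) \<Rightarrow>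
   ('m \<Rightarrow> 'v \<Rightarrow> real) \<Rightarrow> nat \<Rightarrow> ('m, 'v) form" where
  "contact_volume br \<rho> \<eta> n =
     wedge 1 (2 * n) (\<lambda>S p. \<eta> p (S 0 p))
       (two_form_power (\<lambda>S. ext_d1 br \<rho> \<eta> (S 0) (S 1)) n)"

text \<open>Every vector of a fibre is the value of a global section, so a form is nonzero at \<open>p\<close> iff it
  takes a nonzero value at \<open>p\<close> on some sections.\<close>

definition contact_lie_algebroid ::
  "('m::{t2_space,second_countable_topology}, 'e::real_inner) chart set \<Rightarrow>
   ('m, 'v::real_vector, 'f::euclidean_space) vbundle \<Rightarrow>
   (('m \<Rightarrow> 'v) \<Rightarrow> ('m \<Rightarrow> 'v) \<Rightarrow> 'm \<Rightarrow> 'v) \<Rightarrow> ('m \<Rightarrow> 'v \<Rightarrow> ('m \<Rightarrow> real) \<Rightarrow> real) \<Rightarrow>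
   ('m \<Rightarrow> 'v \<Rightarrow> real) \<Rightarrow> nat \<Rightarrow> bool" where
  "contact_lie_algebroid M A br \<rho> \<eta> n \<longleftrightarrow>
     lie_algebroid M A br \<rho> \<and> (\<forall>p. dim (fibre A p) = 2 * n + 1) \<and> \<eta> \<in> dual_sections M A \<and>
     (\<forall>p. \<exists>S. (\<forall>i. S i \<in> sections M A) \<and> contact_volume br \<rho> \<eta> n S p \<noteq> 0)"

definition reeb_section ::
  "('m, 'e::real_inner) chart set \<Rightarrow> ('m, 'v::real_vector, 'f::real_normed_vector) vbundle \<Rightarrow>
   (('m \<Rightarrow> 'v) \<Rightarrow> ('m \<Rightarrow> 'v) \<Rightarrow> 'm \<Rightarrow> 'v) \<Rightarrow> ('m \<Rightarrow> 'v \<Rightarrow> ('m \<Rightarrow> real) \<Rightarrow> real) \<Rightarrow>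
   ('m \<Rightarrow> 'v \<Rightarrow> real) \<Rightarrow> 'm \<Rightarrow> 'v" where
  "reeb_section M A br \<rho> \<eta> =
     (THE \<xi>. \<xi> \<in> sections M A \<and> (\<forall>p. \<eta> p (\<xi> p) = 1) \<and>
        (\<forall>T\<in>sections M A. \<forall>p. ext_d1 br \<rho> \<eta> \<xi> T p = 0))"

definition hamiltonian_section ::
  "('m, 'e::real_inner) chart set \<Rightarrow> ('m, 'v::real_vector, 'f::real_normed_vector) vbundle \<Rightarrow>
   (('m \<Rightarrow> 'v) \<Rightarrow> ('m \<Rightarrow> 'v) \<Rightarrow> 'm \<Rightarrow> 'v) \<Rightarrow> ('m \<Rightarrow> 'v \<Rightarrow> ('m \<Rightarrow> real) \<Rightarrow> real) \<Rightarrow>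
   ('m \<Rightarrow> 'v \<Rightarrow> real) \<Rightarrow> ('m \<Rightarrow> real) \<Rightarrow> 'm \<Rightarrow> 'v" where
  "hamiltonian_section M A br \<rho> \<eta> f =
     (THE a. a \<in> sections M A \<and> (\<forall>p. \<eta> p (a p) = 0) \<and>
        (\<forall>T\<in>sections M A. \<forall>p. ext_d0 \<rho> f T p =
           ext_d1 br \<rho> \<eta> a T p + act \<rho> (reeb_section M A br \<rho> \<eta>) f p * \<eta> p (T p)))"

section \<open>Poisson structures\<close>

definition poisson_structure ::
  "('m, 'e::real_inner) chart set \<Rightarrow> (('m \<Rightarrow> real) \<Rightarrow> ('m \<Rightarrow> real) \<Rightarrow> 'm \<Rightarrow> real) \<Rightarrow> bool" where
  "poisson_structure M B \<longleftrightarrow>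
     (\<forall>f\<in>C_infinity M. \<forall>g\<in>C_infinity M. B f g \<in> C_infinity M) \<and>
     (\<forall>f\<in>C_infinity M. \<forall>g\<in>C_infinity M. \<forall>h\<in>C_infinity M. \<forall>a b.
        B (\<lambda>p. a * f p + b * g p) h = (\<lambda>p. a * B f h p + b * B g h p) \<and>
        B h (\<lambda>p. a * f p + b * g p) = (\<lambda>p. a * B h f p + b * B h g p)) \<and>
     (\<forall>f\<in>C_infinity M. \<forall>g\<in>C_infinity M. \<forall>p. B f g p = - B g f p) \<and>
     (\<forall>f\<in>C_infinity M. \<forall>g\<in>C_infinity M. \<forall>h\<in>C_infinity M. \<forall>p.
        B f (B g h) p + B g (B h f) p + B h (B f g) p = 0) \<and>
     (\<forall>f\<in>C_infinity M. \<forall>g\<in>C_infinity M. \<forall>h\<in>C_infinity M.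
        B f (\<lambda>p. g p * h p) = (\<lambda>p. B f g p * h p + g p * B f h p))"

end

theory Submission
  imports Defs "Jordan_Normal_Form.Determinant"
begin

text \<open>Since \<open>\<rho>(\<xi>) = 0\<close>, the Hamiltonian equation reads \<open>df = i\<^bsub>a_f\<^esub> d\<eta>\<close>, so \<open>{f,g} = \<rho>(a\<^sub>g) f = - \<rho>(a\<^sub>f) g\<close>,
  which gives bilinearity and the Leibniz rule.  As \<open>\<eta>(a\<^sub>f) = 0\<close>, also \<open>{f,g} = - \<eta>([a\<^sub>f, a\<^sub>g])\<close>; computing
  \<open>d\<eta>([a\<^sub>f, a\<^sub>g], a\<^sub>h)\<close> in two ways and summing cyclically yields the Jacobi identity of \<open>{ , }\<close> from that of
  the bracket of sections.

  The substance lies in the existence of \<open>\<xi>\<close> and \<open>a\<^sub>f\<close> as smooth sections.  Bump functions show that \<open>d\<eta>\<close> is a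
  pointwise form, the contact condition makes \<open>\<eta> \<otimes> \<eta> + d\<eta>\<close> nondegenerate on every fibre, and Cramer's rule
  in a local frame makes the pointwise solutions of the defining equations smooth.\<close>

text \<open>Both \<open>reeb_section\<close> and \<open>hamiltonian_section\<close> are definite
  descriptions, so existence and uniqueness of smooth solutions must precede every statement about
  the bracket. The obstacle is that \<open>ext_d1\<close> takes sections and not vectors: it
  contains derivatives and the bracket, whose axioms speak of global smooth sections. Every vector
  and every local frame therefore has to be extended globally. The summand \<eta> \<otimes> \<eta>
  repairs the degeneracy of d\<eta>, which is skew on a space of odd dimension; it equals 1 on the
  pair (\<xi>, \<xi>). With L the repaired form, L(\<xi>, .) = \<eta> and L(a_f, .) = df. Both
  right-hand sides are smooth on sections, so one regularity argument serves both. The hypothesis on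
  \<rho>(\<xi>) enters twice: testing L(v, .) = df on \<xi> forces \<eta>(v) = 0, and without the
  Reeb term f is sent to {f,g} by the vector field \<rho>(a_g) itself. In the Jacobi identity the
  cyclic sum reads 2J = J for the Jacobiator J.\<close>

no_notation Matrix.scalar_prod (infix "\<bullet>" 70)

section \<open>Calculus of smooth functions on open sets\<close>

lemma C_k_on_subset: "C_k_on k X f \<Longrightarrow> Y \<subseteq> X \<Longrightarrow> C_k_on k Y f"
  by (induction k arbitrary: f) (auto intro: continuous_on_subset)

text \<open>Frechet derivatives are taken in the whole space; since \<open>X\<close> is open,
  functions that agree on \<open>X\<close> have the same derivatives there, which keeps the
  induction on the order going.\<close>

lemma C_k_on_cong:
  assumes "open X" "\<And>x. x \<in> X \<Longrightarrow> f x = g x" "C_k_on k X f"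
  shows "C_k_on k X g"
  using assms(2,3)
proof (induction k arbitrary: f g)
  case 0
  then show ?case by (simp cong: continuous_on_cong)
next
  case (Suc k)
  have d: "(g has_derivative frechet_derivative f (at x)) (at x)" if "x \<in> X" for x
  proof (rule has_derivative_transform_within_open[OF _ assms(1) that])
    have "f differentiable (at x)" using Suc.prems(2) that by simp
    then show "(f has_derivative frechet_derivative f (at x)) (at x)"
      by (rule iffD1[OF frechet_derivative_works])
  qed (rule Suc.prems(1))
  have "C_k_on k X (\<lambda>x. frechet_derivative g (at x) v)" for v
  proof (rule Suc.IH[of "\<lambda>x. frechet_derivative f (at x) v"])
    show "frechet_derivative f (at x) v = frechet_derivative g (at x) v" if "x \<in> X" for x
      by (simp only: frechet_derivative_at[OF d[OF that]])
  qed (use Suc.prems(2) in simp)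
  moreover have "g differentiable (at x)" if "x \<in> X" for x
    by (rule differentiableI[OF d[OF that]])
  ultimately show ?case by simp
qed

text \<open>The recursive clause of \<open>C_k_on\<close> speaks only of derivatives. The inductions
  for products and compositions also need the lower order for the factors that are not
  differentiated.\<close>

lemma C_k_on_SucD: "C_k_on (Suc k) X f \<Longrightarrow> C_k_on k X f"
proof (induction k arbitrary: f)
  case 0
  then show ?case
    by (simp add: differentiable_imp_continuous_on differentiable_on_def differentiable_at_withinI)
next
  case (Suc k)
  then show ?case by (metis C_k_on.simps(2))
qed

lemma C_k_on_local:
  assumes "\<And>x. x \<in> X \<Longrightarrow> \<exists>Y. open Y \<and> x \<in> Y \<and> C_k_on k Y f"
  shows "C_k_on k X f"
  using assms
proof (induction k arbitrary: f)
  case 0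
  then have "continuous (at x) f" if "x \<in> X" for x
    using that continuous_on_eq_continuous_at by (metis C_k_on.simps(1))
  then show ?case by (simp add: continuous_at_imp_continuous_on)
next
  case (Suc k)
  have "C_k_on k X (\<lambda>x. frechet_derivative f (at x) v)" for v
    using Suc.prems by (intro Suc.IH) fastforce
  then show ?case using Suc.prems by fastforce
qed

lemma C_k_on_const: "C_k_on k X (\<lambda>x. c)"
  by (induction k arbitrary: c) auto

text \<open>Trades the chosen \<open>frechet_derivative\<close> for any explicit derivative, so that
  the inductions on the order can work with formulas.\<close>

lemma C_k_on_SucI:
  assumes "open X" "\<And>x. x \<in> X \<Longrightarrow> (f has_derivative D x) (at x)"
    and "\<And>v. C_k_on k X (\<lambda>x. D x v)"
  shows "C_k_on (Suc k) X f"
proof -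
  have eq: "D x = frechet_derivative f (at x)" if "x \<in> X" for x
    using assms(2) that frechet_derivative_at by blast
  have "C_k_on k X (\<lambda>x. frechet_derivative f (at x) v)" for v
    using C_k_on_cong[OF assms(1), where f = "\<lambda>x. D x v" and g = "\<lambda>x. frechet_derivative f (at x) v"]
      assms(3)[of v] eq by metis
  moreover have "f differentiable (at x)" if "x \<in> X" for x
    using assms(2)[OF that] by (rule differentiableI)
  ultimately show ?thesis by simp
qed

lemma C_k_on_SucE:
  assumes "C_k_on (Suc k) X f" "x \<in> X"
  shows "(f has_derivative frechet_derivative f (at x)) (at x)"
proof -
  have "f differentiable (at x)" using assms by simp
  then show ?thesis by (rule iffD1[OF frechet_derivative_works])
qed

lemma C_k_on_bounded_linear:
  assumes "bounded_linear L" "open X" "C_k_on k X f"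
  shows "C_k_on k X (\<lambda>x. L (f x))"
  using assms(3)
proof (induction k arbitrary: f)
  case 0
  then show ?case using assms(1) by (auto intro: bounded_linear.continuous_on)
next
  case (Suc k)
  show ?case
  proof (rule C_k_on_SucI[OF assms(2)])
    show "((\<lambda>x. L (f x)) has_derivative (\<lambda>h. L (frechet_derivative f (at x) h))) (at x)" if "x \<in> X" for x
      by (rule bounded_linear.has_derivative[OF assms(1) C_k_on_SucE[OF Suc.prems that]])
    show "C_k_on k X (\<lambda>x. L (frechet_derivative f (at x) v))" for v
      using Suc.prems by (intro Suc.IH) simp
  qed
qed

lemma C_k_on_add:
  assumes "open X" "C_k_on k X f" "C_k_on k X g"
  shows "C_k_on k X (\<lambda>x. f x + g x)"
  using assms(2,3)
proof (induction k arbitrary: f g)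
  case 0
  then show ?case by (auto intro: continuous_on_add)
next
  case (Suc k)
  show ?case
    by (rule C_k_on_SucI[OF assms(1)], rule has_derivative_add)
      (use Suc in \<open>auto intro!: C_k_on_SucE\<close>)
qed

text \<open>Treating an arbitrary bounded bilinear product covers multiplication, scaling and the
  inner product by one induction.\<close>

lemma C_k_on_bilinear:
  assumes "bounded_bilinear prd" "open X" "C_k_on k X f" "C_k_on k X g"
  shows "C_k_on k X (\<lambda>x. prd (f x) (g x))"
  using assms(3,4)
proof (induction k arbitrary: f g)
  case 0
  then show ?case using bounded_bilinear.continuous_on[OF assms(1)] by auto
next
  case (Suc k)
  show ?case
  proof (rule C_k_on_SucI[OF assms(2)])
    show "((\<lambda>x. prd (f x) (g x)) has_derivative
        (\<lambda>h. prd (f x) (frechet_derivative g (at x) h) + prd (frechet_derivative f (at x) h) (g x))) (at x)"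
      if "x \<in> X" for x
      by (intro bounded_bilinear.FDERIV[OF assms(1)] C_k_on_SucE[OF Suc.prems(1) that]
          C_k_on_SucE[OF Suc.prems(2) that])
    show "C_k_on k X
        (\<lambda>x. prd (f x) (frechet_derivative g (at x) v) + prd (frechet_derivative f (at x) v) (g x))" for v
    proof (rule C_k_on_add[OF assms(2)]; rule Suc.IH)
      show "C_k_on k X f" "C_k_on k X g" by (rule C_k_on_SucD[OF Suc.prems(1)] C_k_on_SucD[OF Suc.prems(2)])+
    qed (use Suc.prems in auto)
  qed
qed

lemma C_k_on_sum:
  assumes "open X" "\<And>i. i \<in> I \<Longrightarrow> C_k_on k X (f i)"
  shows "C_k_on k X (\<lambda>x. \<Sum>i\<in>I. f i x)"
proof (cases "finite I")
  case True
  then show ?thesis using assms(2)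
    by (induction I) (auto intro!: C_k_on_add[OF assms(1)] C_k_on_const)
qed (simp add: C_k_on_const)

section \<open>Orthonormal bases and the chain rule\<close>

definition orthonormal_basis :: "'e::real_inner set \<Rightarrow> bool" where
  "orthonormal_basis B \<longleftrightarrow> finite B \<and>
     (\<forall>b\<in>B. \<forall>b'\<in>B. b \<bullet> b' = (if b = b' then 1 else 0)) \<and> (\<forall>x. x = (\<Sum>b\<in>B. (x \<bullet> b) *\<^sub>R b))"

text \<open>The class \<open>euclidean_space\<close> is not available for the model space, so Gram-Schmidt is redone.\<close>

lemma Gram_Schmidt_finite:
  fixes C :: "'e::real_inner set"
  assumes "finite C"
  shows "\<exists>B. finite B \<and> (\<forall>b\<in>B. \<forall>b'\<in>B. b \<bullet> b' = (if b = b' then 1 else 0)) \<and>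
           (\<forall>x\<in>span C. x = (\<Sum>b\<in>B. (x \<bullet> b) *\<^sub>R b))"
  using assms
proof (induction C)
  case empty
  show ?case by (rule exI[of _ "{}"]) auto
next
  case (insert c C)
  then obtain B where B: "finite B" "\<And>b b'. b \<in> B \<Longrightarrow> b' \<in> B \<Longrightarrow> b \<bullet> b' = (if b = b' then 1 else 0)"
    "\<And>x. x \<in> span C \<Longrightarrow> x = (\<Sum>b\<in>B. (x \<bullet> b) *\<^sub>R b)" by blast
  \<comment> \<open>The component of \<open>c\<close> orthogonal to the basis found so far. If it
    vanishes, \<open>B\<close> already serves for \<open>insert c C\<close>; otherwise its
    normalisation is the new basis vector.\<close>
  define d where "d = c - (\<Sum>b\<in>B. (c \<bullet> b) *\<^sub>R b)"
  have db: "d \<bullet> b = 0" if "b \<in> B" for b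
  proof -
    have "(\<Sum>b'\<in>B. (c \<bullet> b') *\<^sub>R b') \<bullet> b = (\<Sum>b'\<in>B. if b' = b then c \<bullet> b' else 0)"
      unfolding inner_sum_left by (rule sum.cong) (use B(2) that in auto)
    then show ?thesis using B(1) that by (simp add: d_def inner_diff_left)
  qed
  have rep: "\<exists>k. x = (\<Sum>b\<in>B. (x \<bullet> b) *\<^sub>R b) + k *\<^sub>R d" if "x \<in> span (insert c C)" for x
  proof -
    obtain k where "x - k *\<^sub>R c \<in> span C" using \<open>x \<in> _\<close> by (auto simp: span_insert)
    from B(3)[OF this] have "x = (\<Sum>b\<in>B. (x \<bullet> b) *\<^sub>R b) + k *\<^sub>R d"
      by (simp add: d_def algebra_simps inner_diff_left inner_diff_right sum_subtractf scaleR_sum_right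
          scaleR_diff_left)
    then show ?thesis by blast
  qed
  show ?case
  proof (cases "d = 0")
    case True
    then show ?thesis using B rep by (intro exI[of _ B]) auto
  next
    case False
    define e where "e = d /\<^sub>R norm d"
    have ee: "e \<bullet> e = 1" using False by (simp add: e_def dot_square_norm power2_eq_square)
    have eb: "e \<bullet> b = 0" "b \<bullet> e = 0" if "b \<in> B" for b
      using db[OF that] by (auto simp: e_def inner_commute)
    have e: "e \<notin> B" using ee eb by force
    have "x = (\<Sum>b\<in>insert e B. (x \<bullet> b) *\<^sub>R b)" if "x \<in> span (insert c C)" for x
    proof -
      obtain k where k: "x = (\<Sum>b\<in>B. (x \<bullet> b) *\<^sub>R b) + k *\<^sub>R d" using rep[OF \<open>x \<in> _\<close>] by blast
      have "x \<bullet> e = (\<Sum>b\<in>B. (x \<bullet> b) *\<^sub>R b) \<bullet> e + k * (d \<bullet> e)"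
        by (subst k) (simp add: inner_add_left)
      also have "(\<Sum>b\<in>B. (x \<bullet> b) *\<^sub>R b) \<bullet> e = 0"
        unfolding inner_sum_left by (rule sum.neutral) (simp add: eb)
      also have "d \<bullet> e = norm d" using False
        by (simp add: e_def dot_square_norm power2_eq_square)
      finally have "(x \<bullet> e) *\<^sub>R e = k *\<^sub>R d" using False by (simp add: e_def)
      then have "(\<Sum>b\<in>insert e B. (x \<bullet> b) *\<^sub>R b) = k *\<^sub>R d + (\<Sum>b\<in>B. (x \<bullet> b) *\<^sub>R b)"
        using B(1) e by simp
      then show ?thesis using k by (metis add.commute)
    qed
    then show ?thesis using B(1,2) ee eb e by (intro exI[of _ "insert e B"]) auto
  qed
qed

lemma orthonormal_basis_exists:
  fixes C :: "'e::real_inner set"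
  assumes "finite C" "span C = UNIV"
  obtains B :: "'e set" where "orthonormal_basis B"
  using Gram_Schmidt_finite[OF assms(1)] assms(2) by (auto simp: orthonormal_basis_def)

lemma orthonormal_basis_Basis: "orthonormal_basis (Basis :: 'f::euclidean_space set)"
  by (auto simp: orthonormal_basis_def inner_Basis euclidean_representation)

lemma orthonormal_basis_linear:
  assumes "orthonormal_basis B" "linear h"
  shows "h x = (\<Sum>b\<in>B. (x \<bullet> b) *\<^sub>R h b)"
proof -
  have "h x = h (\<Sum>b\<in>B. (x \<bullet> b) *\<^sub>R b)" using assms(1) by (metis orthonormal_basis_def)
  then show ?thesis by (simp add: linear_sum[OF assms(2)] linear_scale[OF assms(2)])
qed

text \<open>In the chain rule both the point and the direction of the derivative of \<open>g\<close>
  vary with \<open>x\<close>, while \<open>C_k_on\<close> controls derivatives in fixed directions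
  only. Expanding the direction in an orthonormal basis gives a finite sum of products to which the
  induction hypothesis applies.\<close>

lemma C_k_on_compose:
  fixes f :: "'d::real_normed_vector \<Rightarrow> 'e::real_inner"
  assumes "orthonormal_basis (B :: 'e set)" "open X" "open Y" "f ` X \<subseteq> Y"
    and "C_k_on k X f" "C_k_on k Y g"
  shows "C_k_on k X (\<lambda>x. g (f x))"
  using assms(5,6)
proof (induction k arbitrary: g)
  case 0
  then show ?case using assms(4) by (auto intro: continuous_on_compose2)
next
  case (Suc k)
  have d: "((\<lambda>x. g (f x)) has_derivative
      (\<lambda>h. \<Sum>b\<in>B. (frechet_derivative f (at x) h \<bullet> b) *\<^sub>R frechet_derivative g (at (f x)) b)) (at x)"
    if "x \<in> X" for x
  proof -
    have g: "(g has_derivative frechet_derivative g (at (f x))) (at (f x))"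
      using C_k_on_SucE[OF Suc.prems(2)] that assms(4) by auto
    have "((\<lambda>x. g (f x)) has_derivative
        (\<lambda>h. frechet_derivative g (at (f x)) (frechet_derivative f (at x) h))) (at x)"
      by (rule has_derivative_compose[OF C_k_on_SucE[OF Suc.prems(1) that] g])
    then show ?thesis
      by (subst (asm) orthonormal_basis_linear[OF assms(1) has_derivative_linear[OF g]])
  qed
  show ?case
  proof (rule C_k_on_SucI[OF assms(2) d])
    fix v
    show "C_k_on k X (\<lambda>x. \<Sum>b\<in>B. (frechet_derivative f (at x) v \<bullet> b) *\<^sub>R frechet_derivative g (at (f x)) b)"
      using Suc.prems C_k_on_SucD
      by (intro C_k_on_sum[OF assms(2)] C_k_on_bilinear[OF bounded_bilinear_scaleR assms(2)] Suc.IH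
          C_k_on_bounded_linear[OF bounded_linear_inner_left assms(2)]) auto
  qed
qed

text \<open>The derivative is a polynomial in the inverse itself, so the induction closes.\<close>

lemma C_k_on_inverse: "C_k_on k (- {0}) (inverse :: real \<Rightarrow> real)"
proof (induction k)
  case 0
  show ?case by (auto intro: continuous_intros)
next
  case (Suc k)
  have o: "open (- {0::real})" by auto
  show ?case
  proof (rule C_k_on_SucI[OF o])
    show "(inverse has_derivative (\<lambda>h. (inverse x * inverse x) * (- h))) (at x)"
      if "x \<in> - {0}" for x :: real
      using has_derivative_inverse'[of x UNIV] that by (auto simp: mult_ac)
    show "C_k_on k (- {0}) (\<lambda>x::real. (inverse x * inverse x) * (- v))" for v :: real
      by (intro C_k_on_bilinear[OF bounded_bilinear_mult o] C_k_on_const Suc.IH)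
  qed
qed

section \<open>A flat function and bump functions on the model space\<close>

definition flat_exp :: "nat \<Rightarrow> real \<Rightarrow> real" where
  "flat_exp j t = (if t > 0 then (1 / t) ^ j * exp (- (1 / t)) else 0)"

lemma flat_exp_limit: "(flat_exp j \<longlongrightarrow> 0) (at 0)"
proof -
  have "((\<lambda>t. (1 / t) ^ j / exp (1 / t)) \<longlongrightarrow> 0) (at_right (0::real))"
    by (rule filterlim_compose[OF tendsto_power_div_exp_0])
      (use filterlim_inverse_at_top_right in \<open>simp add: inverse_eq_divide\<close>)
  moreover have "\<forall>\<^sub>F t in at_right 0. (1 / t) ^ j / exp (1 / t) = flat_exp j t"
    by (auto simp: flat_exp_def eventually_at_right_field exp_minus field_simps intro!: exI[of _ 1])
  ultimately have "(flat_exp j \<longlongrightarrow> 0) (at_right 0)" by (blast intro: Lim_transform_eventually)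
  moreover have "(flat_exp j \<longlongrightarrow> 0) (at_left 0)"
    by (rule tendsto_eventually)
      (auto simp: flat_exp_def eventually_at_left_field intro!: exI[of _ "-1"])
  ultimately show ?thesis by (simp add: filterlim_split_at)
qed

lemma flat_exp_derivative:
  "(flat_exp j has_real_derivative (flat_exp (j + 2) t - j * flat_exp (j + 1) t)) (at t)"
proof -
  consider "t < 0" | "t > 0" | "t = 0" by linarith
  then show ?thesis
  proof cases
    case 1
    have "((\<lambda>t. 0) has_real_derivative (flat_exp (j + 2) t - j * flat_exp (j + 1) t)) (at t)"
      using 1 by (simp add: flat_exp_def)
    then show ?thesis
      by (rule has_field_derivative_transform_within_open[of _ _ _ "{..<0}"])
        (use 1 in \<open>auto simp: flat_exp_def\<close>)
  next
    case 2
    have "((\<lambda>t. (1 / t) ^ j * exp (- (1 / t))) has_real_derivative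
        (flat_exp (j + 2) t - j * flat_exp (j + 1) t)) (at t)"
    proof -
      have u: "((\<lambda>t. 1 / t) has_real_derivative - ((1 / t)\<^sup>2)) (at t)"
        using 2 by (auto intro!: derivative_eq_intros simp: power2_eq_square)
      have e: "((\<lambda>t. exp (- (1 / t))) has_real_derivative exp (- (1 / t)) * (1 / t)\<^sup>2) (at t)"
        using DERIV_fun_exp[OF DERIV_minus[OF u]] by simp
      \<comment> \<open>The power rule yields the exponent \<open>j - Suc 0\<close>, truncated at
        \<open>j = 0\<close>; the factor \<open>j\<close> makes that case harmless, hence the case
        distinction.\<close>
      have alg: "x ^ j * (y * x\<^sup>2) + of_nat j * (- (x\<^sup>2) * x ^ (j - Suc 0)) * y
          = x ^ (j + 2) * y - j * (x ^ (j + 1) * y)" for x y :: real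
        by (cases j) (simp_all add: power2_eq_square algebra_simps)
      have "(1 / t) ^ j * (exp (- (1 / t)) * (1 / t)\<^sup>2) +
          of_nat j * (- ((1 / t)\<^sup>2) * (1 / t) ^ (j - Suc 0)) * exp (- (1 / t))
          = flat_exp (j + 2) t - j * flat_exp (j + 1) t"
        unfolding alg flat_exp_def using 2 by (simp only: if_True)
      from DERIV_mult'[OF DERIV_power[OF u] e, of j, unfolded this] show ?thesis .
    qed
    then show ?thesis
      by (rule has_field_derivative_transform_within_open[of _ _ _ "{0<..}"])
        (use 2 in \<open>auto simp: flat_exp_def\<close>)
  next
    case 3
    \<comment> \<open>At 0 the difference quotient of one member of the family is the next member,
      so differentiability there is just \<open>flat_exp_limit\<close>.\<close>
    have "(\<lambda>h. (flat_exp j (0 + h) - flat_exp j 0) / h) = flat_exp (Suc j)"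
      by (auto simp: flat_exp_def fun_eq_iff)
    then have "(flat_exp j has_real_derivative 0) (at 0)"
      using flat_exp_limit[of "Suc j"] by (simp add: DERIV_def)
    then show ?thesis using 3 by (simp add: flat_exp_def)
  qed
qed

text \<open>A single function exp(-1/t) would not survive differentiation; the derivative of each
  \<open>flat_exp j\<close> is a combination of two others of the family, so the induction works
  with \<open>j\<close> arbitrary.\<close>

lemma C_k_on_flat_exp: "C_k_on k UNIV (flat_exp j)"
proof (induction k arbitrary: j)
  case 0
  have "isCont (flat_exp j) t" for t
    by (rule DERIV_isCont[OF flat_exp_derivative])
  then show ?case by (simp add: continuous_at_imp_continuous_on)
next
  case (Suc k)
  show ?case
  proof (rule C_k_on_SucI[OF open_UNIV])
    show "(flat_exp j has_derivative
        (\<lambda>h. (flat_exp (j + 2) x + (- real j) * flat_exp (j + 1) x) * h)) (at x)" for x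
      using has_field_derivative_imp_has_derivative[OF flat_exp_derivative[of j x]] by simp
    show "C_k_on k UNIV (\<lambda>x. (flat_exp (j + 2) x + (- real j) * flat_exp (j + 1) x) * v)" for v
      by (intro C_k_on_bilinear[OF bounded_bilinear_mult open_UNIV]
          C_k_on_bilinear[OF bounded_bilinear_mult open_UNIV] C_k_on_add[OF open_UNIV]
          Suc.IH C_k_on_const)
  qed
qed

lemma C_k_on_ident: "C_k_on k UNIV (\<lambda>x. x)"
  by (cases k) (auto intro!: C_k_on_const)

text \<open>The coordinates of a vector of norm at most \<open>r\<close> lie in [-r, r], so the ball
  is a closed subset of a finite Minkowski sum of compact segments. That sum is the set
  \<open>K\<close>, built by induction over the basis.\<close>

lemma orthonormal_basis_compact_cball:
  fixes B :: "'e::real_inner set"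
  assumes "orthonormal_basis B"
  shows "compact (cball (a::'e) r)"
proof -
  have B: "finite B" "\<And>b b'. b \<in> B \<Longrightarrow> b' \<in> B \<Longrightarrow> b \<bullet> b' = (if b = b' then 1 else 0)"
      "\<And>x. x = (\<Sum>b\<in>B. (x \<bullet> b) *\<^sub>R b)"
    using assms unfolding orthonormal_basis_def by blast+
  have "\<exists>K. compact K \<and> (\<forall>t. (\<forall>b\<in>C. t b \<in> {- r..r}) \<longrightarrow> (\<Sum>b\<in>C. t b *\<^sub>R b) \<in> K)"
    if "finite C" for C :: "'e set"
    using that
  proof (induction C)
    case empty
    show ?case by (rule exI[of _ "{0}"]) simp
  next
    case (insert c C)
    then obtain K where K: "compact K"
      "\<And>t. \<forall>b\<in>C. t b \<in> {- r..r} \<Longrightarrow> (\<Sum>b\<in>C. t b *\<^sub>R b) \<in> K" by blast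
    have "compact ((\<lambda>s. s *\<^sub>R c) ` {- r..r})"
      by (intro compact_continuous_image continuous_intros) auto
    then have "compact {x + y | x y. x \<in> (\<lambda>s. s *\<^sub>R c) ` {- r..r} \<and> y \<in> K}"
      using K(1) by (rule compact_sums)
    moreover have "(\<Sum>b\<in>insert c C. t b *\<^sub>R b) \<in> {x + y | x y. x \<in> (\<lambda>s. s *\<^sub>R c) ` {- r..r} \<and> y \<in> K}"
      if "\<forall>b\<in>insert c C. t b \<in> {- r..r}" for t
      unfolding sum.insert[OF insert.hyps] using that K(2)[of t] by blast
    ultimately show ?case by blast
  qed
  from this[OF B(1)] obtain K where K: "compact K"
    "\<And>t. \<forall>b\<in>B. t b \<in> {- r..r} \<Longrightarrow> (\<Sum>b\<in>B. t b *\<^sub>R b) \<in> K" by blast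
  have "cball 0 r \<subseteq> K"
  proof
    fix x :: 'e assume x: "x \<in> cball 0 r"
    have "x \<bullet> b \<in> {- r..r}" if "b \<in> B" for b
    proof -
      have "norm b = 1" using B(2)[OF that that] by (simp add: norm_eq_sqrt_inner)
      then have "\<bar>x \<bullet> b\<bar> \<le> r" using Cauchy_Schwarz_ineq2[of x b] x by simp
      then show ?thesis by (simp add: abs_le_iff)
    qed
    then have "(\<Sum>b\<in>B. (x \<bullet> b) *\<^sub>R b) \<in> K" by (intro K(2)) blast
    then show "x \<in> K" by (simp only: B(3)[symmetric])
  qed
  then have "cball 0 r = K \<inter> cball 0 r" by blast
  moreover have "compact (K \<inter> cball 0 r)" by (rule compact_Int_closed[OF K(1) closed_cball])
  ultimately have "compact (cball (0::'e) r)" by simp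
  then have "compact ((+) a ` cball 0 r)" by (rule compact_translation)
  then show ?thesis by simp
qed

section \<open>Closure properties of smooth functions\<close>

lemma smooth_on_subset:
  "smooth_on X f \<Longrightarrow> Y \<subseteq> X \<Longrightarrow> smooth_on Y f"
  unfolding smooth_on_def by (metis C_k_on_subset)

lemma smooth_on_cong:
  "open X \<Longrightarrow> (\<And>x. x \<in> X \<Longrightarrow> f x = g x) \<Longrightarrow> smooth_on X f \<Longrightarrow> smooth_on X g"
  unfolding smooth_on_def by (intro allI C_k_on_cong[of X f g]) simp_all

lemma smooth_on_const:
  "smooth_on X (\<lambda>x. c)"
  unfolding smooth_on_def by (intro allI C_k_on_const)

lemma smooth_on_bounded_linear:
  "bounded_linear L \<Longrightarrow> open X \<Longrightarrow> smooth_on X f \<Longrightarrow> smooth_on X (\<lambda>x. L (f x))"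
  unfolding smooth_on_def by (intro allI C_k_on_bounded_linear[where L = L and f = f]) simp_all

lemma smooth_on_add:
  "open X \<Longrightarrow> smooth_on X f \<Longrightarrow> smooth_on X g \<Longrightarrow> smooth_on X (\<lambda>x. f x + g x)"
  unfolding smooth_on_def by (intro allI C_k_on_add[where f = f and g = g]) simp_all

lemma smooth_on_bilinear:
  "bounded_bilinear prd \<Longrightarrow> open X \<Longrightarrow> smooth_on X f \<Longrightarrow> smooth_on X g \<Longrightarrow>
    smooth_on X (\<lambda>x. prd (f x) (g x))"
  unfolding smooth_on_def by (intro allI C_k_on_bilinear[where prd = prd and f = f and g = g]) simp_all

lemma smooth_on_sum:
  "open X \<Longrightarrow> (\<And>i. i \<in> I \<Longrightarrow> smooth_on X (f i)) \<Longrightarrow> smooth_on X (\<lambda>x. \<Sum>i\<in>I. f i x)"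
  unfolding smooth_on_def by (intro allI C_k_on_sum[where f = f]) simp_all

lemma smooth_on_ident:
  "smooth_on X (\<lambda>x. x)"
  unfolding smooth_on_def by (intro allI C_k_on_subset[OF C_k_on_ident]) simp

lemma smooth_on_local:
  "(\<And>x. x \<in> X \<Longrightarrow> \<exists>Y. open Y \<and> x \<in> Y \<and> smooth_on Y f) \<Longrightarrow> smooth_on X f"
  unfolding smooth_on_def by (intro allI C_k_on_local) blast

lemma smooth_on_compose:
  fixes f :: "'d::real_normed_vector \<Rightarrow> 'e::real_inner"
  assumes "orthonormal_basis (B :: 'e set)" "open X" "open Y" "f ` X \<subseteq> Y" "smooth_on X f" "smooth_on Y g"
  shows "smooth_on X (\<lambda>x. g (f x))"
  using assms(5,6) unfolding smooth_on_def
  by (intro allI C_k_on_compose[OF assms(1-4), where g = g]) simp_all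

lemma orthonormal_basis_real: "orthonormal_basis {1::real}"
  by (auto simp: orthonormal_basis_def)

lemma smooth_on_inverse:
  assumes "open X" "smooth_on X f" "\<And>x. x \<in> X \<Longrightarrow> f x \<noteq> (0::real)"
  shows "smooth_on X (\<lambda>x. inverse (f x))"
  by (rule smooth_on_compose[OF orthonormal_basis_real assms(1), of "- {0}"])
    (use assms C_k_on_inverse in \<open>auto simp: smooth_on_def\<close>)

lemma smooth_on_derivative:
  assumes "smooth_on X f"
  shows "smooth_on X (\<lambda>x. frechet_derivative f (at x) v)"
  unfolding smooth_on_def
proof
  fix k
  have "C_k_on (Suc k) X f" using assms by (simp only: smooth_on_def)
  then show "C_k_on k X (\<lambda>x. frechet_derivative f (at x) v)" by simp
qed

lemma smooth_on_has_derivative: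
  assumes "smooth_on X f" "x \<in> X"
  shows "(f has_derivative frechet_derivative f (at x)) (at x)"
  using assms(1) by (intro C_k_on_SucE[OF _ assms(2)]) (simp only: smooth_on_def)

text \<open>The function exp(-1/(r^2 - |x - a|^2)), extended by 0. Written as
  \<open>flat_exp 0\<close> after a polynomial it is smooth by composition, with no case distinction
  at the sphere.\<close>

lemma smooth_bump:
  fixes a :: "'e::real_inner"
  assumes "r > 0"
  obtains g :: "'e \<Rightarrow> real"
  where "smooth_on UNIV g" "g a \<noteq> 0" "\<And>x. x \<notin> cball a r \<Longrightarrow> g x = 0"
proof
  let ?q = "\<lambda>x. r\<^sup>2 + - ((x + (- a)) \<bullet> (x + (- a)))"
  let ?g = "\<lambda>x. flat_exp 0 (?q x)"
  note diff = smooth_on_add[OF open_UNIV smooth_on_ident smooth_on_const[of _ "- a"]]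
  note sq = smooth_on_bilinear[OF bounded_bilinear_inner open_UNIV diff diff]
  note q = smooth_on_add[OF open_UNIV smooth_on_const[of _ "r\<^sup>2"]
      smooth_on_bounded_linear[OF bounded_linear_minus[OF bounded_linear_ident] open_UNIV sq]]
  have "smooth_on UNIV (flat_exp 0)" unfolding smooth_on_def by (intro allI C_k_on_flat_exp)
  from smooth_on_compose[OF orthonormal_basis_real open_UNIV open_UNIV subset_UNIV q this]
  show "smooth_on UNIV ?g" .
  show "?g a \<noteq> 0" using assms by (simp add: flat_exp_def)
  show "?g x = 0" if "x \<notin> cball a r" for x
  proof -
    have "r\<^sup>2 \<le> (norm (x - a))\<^sup>2"
      using that assms by (intro power_mono) (auto simp: dist_norm norm_minus_commute)
    then show ?thesis by (simp add: flat_exp_def dot_square_norm)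
  qed
qed

section \<open>Smooth functions on manifolds\<close>

locale smooth_mfd =
  fixes M :: "('m::{t2_space,second_countable_topology}, 'e::real_inner) chart set"
  assumes mfd: "smooth_manifold M"
begin

lemma model_basis:
  obtains B :: "'e set" where "orthonormal_basis B"
proof -
  have "\<exists>C::'e set. finite C \<and> span C = UNIV"
    by (rule conjunct1[OF mfd[unfolded smooth_manifold_def]])
  then obtain C :: "'e set" where C: "finite C" "span C = UNIV" by (elim exE conjE)
  from C show thesis by (rule orthonormal_basis_exists) (rule that)
qed

lemma chart_at:
  obtains U c where "(U, c) \<in> M" "p \<in> U"
proof -
  have "(\<Union>(U, c)\<in>M. U) = UNIV"
    by (rule conjunct1[OF conjunct2[OF mfd[unfolded smooth_manifold_def]]])
  then have "p \<in> (\<Union>(U, c)\<in>M. U)" by simp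
  then show thesis using that by blast
qed

lemma chart_homeomorphism:
  assumes "(U, c) \<in> M"
  shows "open U" "open (c ` U)" "homeomorphism U (c ` U) c (inv_into U c)"
proof -
  have "\<forall>(U, c)\<in>M. open U \<and> open (c ` U) \<and> homeomorphism U (c ` U) c (inv_into U c)"
    by (rule conjunct1[OF conjunct2[OF conjunct2[OF mfd[unfolded smooth_manifold_def]]]])
  from bspec[OF this assms]
  show "open U" "open (c ` U)" "homeomorphism U (c ` U) c (inv_into U c)" by auto
qed

lemma inv_chart [simp]:
  assumes "(U, c) \<in> M" "p \<in> U"
  shows "inv_into U c (c p) = p"
  using chart_homeomorphism(3)[OF assms(1)] assms(2) by (simp add: homeomorphism_def)

lemma chart_transition:
  assumes "(U, c) \<in> M" "(V, d) \<in> M"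
  shows "smooth_on (d ` (V \<inter> U)) (\<lambda>x. c (inv_into V d x))"
proof -
  have "\<forall>(U, c)\<in>M. \<forall>(V, d)\<in>M. smooth_on (c ` (U \<inter> V)) (d \<circ> inv_into U c)"
    by (rule conjunct2[OF conjunct2[OF conjunct2[OF mfd[unfolded smooth_manifold_def]]]])
  from bspec[OF this assms(2)]
  have "\<forall>(U, c)\<in>M. smooth_on (d ` (V \<inter> U)) (c \<circ> inv_into V d)" by simp
  from bspec[OF this assms(1)] show ?thesis by (simp add: o_def)
qed

lemma chart_open_image:
  assumes "(U, c) \<in> M" "open X"
  shows "open (c ` (X \<inter> U))"
proof -
  note h = chart_homeomorphism[OF assms(1)]
  have "c ` (X \<inter> U) = c ` U \<inter> inv_into U c -` X"
    using assms(1) by auto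
  then show ?thesis
    using continuous_open_preimage[OF homeomorphism_cont2[OF h(3)] h(2) assms(2)] by simp
qed

lemma smooth_fun_onI:
  assumes "\<And>U c. (U, c) \<in> M \<Longrightarrow> smooth_on (c ` (X \<inter> U)) (\<lambda>x. f (inv_into U c x))"
  shows "smooth_fun_on M X f"
  using assms by (auto simp: smooth_fun_on_def o_def)

lemma smooth_fun_onD:
  assumes "smooth_fun_on M X f" "(U, c) \<in> M"
  shows "smooth_on (c ` (X \<inter> U)) (\<lambda>x. f (inv_into U c x))"
  using assms by (auto simp: smooth_fun_on_def o_def)

lemma smooth_fun_on_subset:
  assumes "smooth_fun_on M X f" "Y \<subseteq> X"
  shows "smooth_fun_on M Y f"
  by (rule smooth_fun_onI, rule smooth_on_subset[OF smooth_fun_onD[OF assms(1)]]) (use assms(2) in auto)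

lemma smooth_fun_on_cong:
  assumes "open X" "\<And>p. p \<in> X \<Longrightarrow> f p = g p" "smooth_fun_on M X f"
  shows "smooth_fun_on M X g"
proof (rule smooth_fun_onI)
  fix U c assume c: "(U, c) \<in> M"
  show "smooth_on (c ` (X \<inter> U)) (\<lambda>x. g (inv_into U c x))"
    by (rule smooth_on_cong[OF chart_open_image[OF c assms(1)] _ smooth_fun_onD[OF assms(3) c]])
      (use c assms(2) in auto)
qed

lemma smooth_fun_on_const: "smooth_fun_on M X (\<lambda>p. w)"
  by (rule smooth_fun_onI) (rule smooth_on_const)

lemma smooth_fun_on_add:
  assumes "open X" "smooth_fun_on M X f" "smooth_fun_on M X g"
  shows "smooth_fun_on M X (\<lambda>p. f p + g p)"
  by (rule smooth_fun_onI, rule smooth_on_add)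
    (rule chart_open_image smooth_fun_onD assms | assumption)+

lemma smooth_fun_on_linear:
  assumes "bounded_linear L" "open X" "smooth_fun_on M X f"
  shows "smooth_fun_on M X (\<lambda>p. L (f p))"
  by (rule smooth_fun_onI, rule smooth_on_bounded_linear[OF assms(1)])
    (rule chart_open_image smooth_fun_onD assms | assumption)+

lemma smooth_fun_on_bilinear:
  assumes "bounded_bilinear prd" "open X" "smooth_fun_on M X f" "smooth_fun_on M X g"
  shows "smooth_fun_on M X (\<lambda>p. prd (f p) (g p))"
  by (rule smooth_fun_onI, rule smooth_on_bilinear[OF assms(1)])
    (rule chart_open_image smooth_fun_onD assms | assumption)+

lemmas smooth_fun_on_mult = smooth_fun_on_bilinear[OF bounded_bilinear_mult]
  and smooth_fun_on_scaleR = smooth_fun_on_bilinear[OF bounded_bilinear_scaleR]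

lemma smooth_fun_on_sum:
  assumes "open X" "\<And>i. i \<in> I \<Longrightarrow> smooth_fun_on M X (f i)"
  shows "smooth_fun_on M X (\<lambda>p. \<Sum>i\<in>I. f i p)"
  by (rule smooth_fun_onI, rule smooth_on_sum)
    (rule chart_open_image smooth_fun_onD assms | assumption)+

lemma smooth_fun_on_prod:
  fixes f :: "'i \<Rightarrow> 'm \<Rightarrow> real"
  assumes "open X" "\<And>i. i \<in> I \<Longrightarrow> smooth_fun_on M X (f i)"
  shows "smooth_fun_on M X (\<lambda>p. \<Prod>i\<in>I. f i p)"
proof (cases "finite I")
  case True
  then show ?thesis using assms(2)
  proof (induction I)
    case (insert i I)
    then have "smooth_fun_on M X (\<lambda>p. f i p * (\<Prod>j\<in>I. f j p))"
      by (intro smooth_fun_on_mult[OF assms(1)]) simp_all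
    then show ?case using insert.hyps by simp
  qed (simp add: smooth_fun_on_const)
qed (simp add: smooth_fun_on_const)

lemma smooth_fun_on_inverse:
  assumes "open X" "smooth_fun_on M X f" "\<And>p. p \<in> X \<Longrightarrow> f p \<noteq> (0::real)"
  shows "smooth_fun_on M X (\<lambda>p. inverse (f p))"
proof (rule smooth_fun_onI)
  fix U c assume c: "(U, c) \<in> M"
  show "smooth_on (c ` (X \<inter> U)) (\<lambda>x. inverse (f (inv_into U c x)))"
    by (rule smooth_on_inverse[OF chart_open_image[OF c assms(1)] smooth_fun_onD[OF assms(2) c]])
      (use c assms(3) in auto)
qed

lemma smooth_fun_on_local:
  assumes "\<And>p. p \<in> X \<Longrightarrow> \<exists>Y. open Y \<and> p \<in> Y \<and> smooth_fun_on M Y f"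
  shows "smooth_fun_on M X f"
proof (rule smooth_fun_onI, rule smooth_on_local)
  fix U c x assume c: "(U, c) \<in> M" and "x \<in> c ` (X \<inter> U)"
  then obtain p where p: "p \<in> X" "p \<in> U" "x = c p" by blast
  obtain Y where Y: "open Y" "p \<in> Y" "smooth_fun_on M Y f" using assms[OF p(1)] by blast
  show "\<exists>Z. open Z \<and> x \<in> Z \<and> smooth_on Z (\<lambda>x. f (inv_into U c x))"
    using chart_open_image[OF c Y(1)] smooth_fun_onD[OF Y(3) c] p Y(2)
    by (intro exI[of _ "c ` (Y \<inter> U)"]) simp
qed

text \<open>In any other chart the representative is the given one composed with a smooth transition
  map, so a single chart that contains \<open>X\<close> decides.\<close>

lemma smooth_fun_on_chart:
  assumes c: "(U, c) \<in> M" and X: "open X" "X \<subseteq> U"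
    and f: "smooth_on (c ` X) (\<lambda>x. f (inv_into U c x))"
  shows "smooth_fun_on M X f"
proof (rule smooth_fun_onI)
  fix V d assume d: "(V, d) \<in> M"
  obtain B :: "'e set" where B: "orthonormal_basis B" by (rule model_basis)
  have XU: "X \<inter> U = X" using X(2) by blast
  have "smooth_on (d ` (X \<inter> V)) (\<lambda>y. f (inv_into U c (c (inv_into V d y))))"
  proof (rule smooth_on_compose[OF B chart_open_image[OF d X(1)] _ _ _ f])
    show "open (c ` X)" using chart_open_image[OF c X(1)] XU by simp
    show "(\<lambda>y. c (inv_into V d y)) ` d ` (X \<inter> V) \<subseteq> c ` X" using d by auto
    show "smooth_on (d ` (X \<inter> V)) (\<lambda>y. c (inv_into V d y))"
      by (rule smooth_on_subset[OF chart_transition[OF c d]]) (use X(2) in auto)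
  qed
  then show "smooth_on (d ` (X \<inter> V)) (\<lambda>x. f (inv_into V d x))"
    by (rule smooth_on_cong[OF chart_open_image[OF d X(1)], rotated]) (use c d X(2) in auto)
qed

lemma smooth_fun_on_chart_pullback:
  assumes c: "(U, c) \<in> M" and g: "smooth_on (c ` U) g"
  shows "smooth_fun_on M U (\<lambda>p. g (c p))"
proof (rule smooth_fun_on_chart[OF c chart_homeomorphism(1)[OF c] subset_refl])
  show "smooth_on (c ` U) (\<lambda>x. g (c (inv_into U c x)))"
    by (rule smooth_on_cong[OF chart_homeomorphism(2)[OF c] _ g]) (use c in auto)
qed

lemma C_infinityD: "f \<in> C_infinity M \<Longrightarrow> smooth_fun_on M X f"
  unfolding C_infinity_def by (blast intro: smooth_fun_on_subset)

lemma C_infinity_const: "(\<lambda>p. r) \<in> C_infinity M"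
  by (simp add: C_infinity_def smooth_fun_on_const)

lemma C_infinity_add:
  "f \<in> C_infinity M \<Longrightarrow> g \<in> C_infinity M \<Longrightarrow> (\<lambda>p. f p + g p) \<in> C_infinity M"
  unfolding C_infinity_def mem_Collect_eq by (rule smooth_fun_on_add[OF open_UNIV])

lemma C_infinity_mult:
  "f \<in> C_infinity M \<Longrightarrow> g \<in> C_infinity M \<Longrightarrow> (\<lambda>p. f p * g p) \<in> C_infinity M"
  unfolding C_infinity_def mem_Collect_eq by (rule smooth_fun_on_mult[OF open_UNIV])

lemma C_infinity_scale: "f \<in> C_infinity M \<Longrightarrow> (\<lambda>p. r * f p) \<in> C_infinity M"
  by (rule C_infinity_mult[OF C_infinity_const])

lemma C_infinity_uminus: "f \<in> C_infinity M \<Longrightarrow> (\<lambda>p. - f p) \<in> C_infinity M"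
  using C_infinity_scale[of f "-1"] by simp

lemma C_infinity_diff:
  "f \<in> C_infinity M \<Longrightarrow> g \<in> C_infinity M \<Longrightarrow> (\<lambda>p. f p - g p) \<in> C_infinity M"
  using C_infinity_add[OF _ C_infinity_uminus, of f g] by simp

section \<open>Bump functions on the manifold\<close>

definition bump :: "('m \<Rightarrow> real) \<Rightarrow> 'm set \<Rightarrow> bool" where
  "bump f W \<longleftrightarrow> f \<in> C_infinity M \<and> (\<exists>K. closed K \<and> K \<subseteq> W \<and> (\<forall>q. q \<notin> K \<longrightarrow> f q = 0))"

lemma bump_smooth: "bump f W \<Longrightarrow> f \<in> C_infinity M"
  and bump_outside: "bump f W \<Longrightarrow> q \<notin> W \<Longrightarrow> f q = 0"
  unfolding bump_def by blast+

text \<open>A bump function on a ball in a chart is pulled back and extended by 0. The extension is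
  smooth because the closed ball is compact, so that its preimage \<open>K\<close> is compact and,
  by the Hausdorff property, closed in all of the manifold.\<close>

lemma bump_exists:
  assumes "open W" "p \<in> W"
  obtains f where "bump f W" "f p \<noteq> 0"
proof -
  obtain U c where c: "(U, c) \<in> M" "p \<in> U" by (rule chart_at)
  obtain B :: "'e set" where B: "orthonormal_basis B" by (rule model_basis)
  note h = chart_homeomorphism[OF c(1)]
  have "open (c ` (W \<inter> U))" by (rule chart_open_image[OF c(1) assms(1)])
  moreover have "c p \<in> c ` (W \<inter> U)" using assms(2) c(2) by blast
  ultimately obtain r where r: "r > 0" "cball (c p) r \<subseteq> c ` (W \<inter> U)"
    using open_contains_cball by blast
  obtain g where g: "smooth_on UNIV g" "g (c p) \<noteq> 0" "\<And>x. x \<notin> cball (c p) r \<Longrightarrow> g x = (0::real)"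
    by (rule smooth_bump[OF r(1), of "c p"]) blast
  define K where "K = inv_into U c ` cball (c p) r"
  have "compact K" unfolding K_def
  proof (rule compact_continuous_image[OF _ orthonormal_basis_compact_cball[OF B]])
    show "continuous_on (cball (c p) r) (inv_into U c)"
      by (rule continuous_on_subset[OF homeomorphism_cont2[OF h(3)]]) (use r(2) in blast)
  qed
  then have K: "closed K" by (rule compact_imp_closed)
  have KWU: "K \<subseteq> W \<inter> U"
  proof
    fix q assume "q \<in> K"
    then obtain x where x: "x \<in> cball (c p) r" "q = inv_into U c x" unfolding K_def by blast
    then obtain q' where "q' \<in> W \<inter> U" "x = c q'" using r(2) by blast
    then show "q \<in> W \<inter> U" using x(2) c(1) by simp
  qed
  define f where "f q = (if q \<in> U then g (c q) else 0)" for q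
  have f0: "f q = 0" if "q \<notin> K" for q
  proof (cases "q \<in> U")
    case True
    have "c q \<notin> cball (c p) r"
    proof
      assume "c q \<in> cball (c p) r"
      then have "inv_into U c (c q) \<in> K" unfolding K_def by (rule imageI)
      then show False using True c(1) that by simp
    qed
    then show ?thesis using g(3) by (simp add: f_def)
  qed (simp add: f_def)
  have "smooth_fun_on M UNIV f"
  proof (rule smooth_fun_on_local)
    fix q
    show "\<exists>Y. open Y \<and> q \<in> Y \<and> smooth_fun_on M Y f"
    proof (cases "q \<in> U")
      case True
      have "smooth_fun_on M U (\<lambda>q. g (c q))"
        by (rule smooth_fun_on_chart_pullback[OF c(1) smooth_on_subset[OF g(1) subset_UNIV]])
      then have "smooth_fun_on M U f"
        by (rule smooth_fun_on_cong[OF h(1), rotated]) (simp add: f_def)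
      then show ?thesis using True h(1) by blast
    next
      case False
      have "smooth_fun_on M (- K) f"
        by (rule smooth_fun_on_cong[OF _ _ smooth_fun_on_const[of _ 0]]) (use K f0 in auto)
      then show ?thesis using False KWU K by blast
    qed
  qed
  then have "bump f W" using K KWU f0 unfolding bump_def C_infinity_def by blast
  moreover have "f p \<noteq> 0" using g(2) c(2) by (simp add: f_def)
  ultimately show thesis using that by blast
qed

text \<open>\<open>W\<close> and the complement of \<open>K\<close> are open and cover everything:
  on the first the product is smooth, on the second it is 0. This is the purpose of the closed set
  in \<open>bump\<close>; mere vanishing outside \<open>W\<close> would leave the boundary of
  \<open>W\<close> uncontrolled.\<close>

lemma smooth_fun_on_bump_scaleR:
  assumes "bump f W" "open W" "open X" "smooth_fun_on M (W \<inter> X) g"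
  shows "smooth_fun_on M X (\<lambda>q. f q *\<^sub>R g q)"
proof (rule smooth_fun_on_local)
  fix q assume q: "q \<in> X"
  obtain K where K: "closed K" "K \<subseteq> W" "\<And>q. q \<notin> K \<Longrightarrow> f q = 0"
    using assms(1) unfolding bump_def by blast
  show "\<exists>Y. open Y \<and> q \<in> Y \<and> smooth_fun_on M Y (\<lambda>q. f q *\<^sub>R g q)"
  proof (cases "q \<in> W")
    case True
    have "smooth_fun_on M (W \<inter> X) (\<lambda>q. f q *\<^sub>R g q)"
      by (rule smooth_fun_on_scaleR[OF open_Int[OF assms(2,3)] C_infinityD[OF bump_smooth[OF assms(1)]] assms(4)])
    then show ?thesis using open_Int[OF assms(2,3)] True q by blast
  next
    case False
    have "smooth_fun_on M (- K) (\<lambda>q. f q *\<^sub>R g q)"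
      by (rule smooth_fun_on_cong[OF _ _ smooth_fun_on_const[of _ 0]]) (use K in auto)
    then show ?thesis using False K by blast
  qed
qed

lemma C_infinity_bump_mult:
  fixes g :: "'m \<Rightarrow> real"
  assumes "bump f W" "open W" "smooth_fun_on M W g"
  shows "(\<lambda>q. f q * g q) \<in> C_infinity M"
  using smooth_fun_on_bump_scaleR[OF assms(1,2) open_UNIV, of g] assms(3) by (simp add: C_infinity_def)

section \<open>Tangent vectors\<close>

lemma chart_has_derivative:
  fixes f :: "'m \<Rightarrow> 'w::real_normed_vector"
  assumes "(U, c) \<in> M" "p \<in> U" "smooth_fun_on M UNIV f"
  shows "((\<lambda>x. f (inv_into U c x)) has_derivative
    frechet_derivative (\<lambda>x. f (inv_into U c x)) (at (c p))) (at (c p))"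
  by (rule smooth_on_has_derivative[OF smooth_fun_onD[OF assms(3,1)]]) (use assms(2) in blast)

lemma dir_deriv_eqI:
  assumes "(U, c) \<in> M" "p \<in> U" "f \<in> C_infinity M"
    and "((\<lambda>x. f (inv_into U c x)) has_derivative D) (at (c p))"
  shows "dir_deriv M (U, c) p a f = D a"
  using frechet_derivative_at[OF assms(4)] assms(3) by (simp add: dir_deriv_def o_def)

lemma dir_deriv_has_derivative:
  assumes "(U, c) \<in> M" "p \<in> U" "f \<in> C_infinity M"
  shows "((\<lambda>x. f (inv_into U c x)) has_derivative (\<lambda>a. dir_deriv M (U, c) p a f)) (at (c p))"
  using chart_has_derivative[OF assms(1,2), of f] assms(3)
  by (simp add: dir_deriv_def o_def C_infinity_def)

lemma dir_deriv_linear_fun: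
  assumes c: "(U, c) \<in> M" "p \<in> U" and f: "f \<in> C_infinity M" "g \<in> C_infinity M"
  shows "dir_deriv M (U, c) p a (\<lambda>q. r * f q + s * g q) =
    r * dir_deriv M (U, c) p a f + s * dir_deriv M (U, c) p a g"
  by (rule dir_deriv_eqI[OF c C_infinity_add[OF C_infinity_scale[OF f(1)] C_infinity_scale[OF f(2)]]
      has_derivative_add[OF has_derivative_mult_right[OF dir_deriv_has_derivative[OF c f(1)]]
        has_derivative_mult_right[OF dir_deriv_has_derivative[OF c f(2)]]]])

lemma dir_deriv_mult:
  assumes c: "(U, c) \<in> M" "p \<in> U" and f: "f \<in> C_infinity M" "g \<in> C_infinity M"
  shows "dir_deriv M (U, c) p a (\<lambda>q. f q * g q) =
    f p * dir_deriv M (U, c) p a g + dir_deriv M (U, c) p a f * g p"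
  using dir_deriv_eqI[OF c C_infinity_mult[OF f] has_derivative_mult[OF
      dir_deriv_has_derivative[OF c f(1)] dir_deriv_has_derivative[OF c f(2)]], of a] c by simp

lemma tangent_spaceE:
  assumes "v \<in> tangent_space M p"
  obtains U c a where "(U, c) \<in> M" "p \<in> U" "v = dir_deriv M (U, c) p a"
  using assms unfolding tangent_space_def by blast

lemma tangent_linear_fun:
  assumes "v \<in> tangent_space M p" "f \<in> C_infinity M" "g \<in> C_infinity M"
  shows "v (\<lambda>q. r * f q + s * g q) = r * v f + s * v g"
  using assms(1) by (rule tangent_spaceE) (simp add: dir_deriv_linear_fun assms(2,3))

lemma tangent_mult:
  assumes "v \<in> tangent_space M p" "f \<in> C_infinity M" "g \<in> C_infinity M"
  shows "v (\<lambda>q. f q * g q) = f p * v g + v f * g p"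
  using assms(1) by (rule tangent_spaceE) (simp add: dir_deriv_mult assms(2,3))

lemma tangent_uminus:
  assumes "v \<in> tangent_space M p" "f \<in> C_infinity M"
  shows "v (\<lambda>q. - f q) = - v f"
  using tangent_linear_fun[OF assms assms(2), of "-1" 0] by simp

text \<open>Chain rule with the transition map. It shows that every chart around \<open>p\<close>
  parametrises the same tangent space.\<close>

lemma dir_deriv_change_chart:
  assumes c: "(U, c) \<in> M" "p \<in> U" and d: "(V, d) \<in> M" "p \<in> V"
  shows "dir_deriv M (V, d) p a =
    dir_deriv M (U, c) p (frechet_derivative (\<lambda>x. c (inv_into V d x)) (at (d p)) a)"
proof
  fix f
  show "dir_deriv M (V, d) p a f =
    dir_deriv M (U, c) p (frechet_derivative (\<lambda>x. c (inv_into V d x)) (at (d p)) a) f"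
  proof (cases "f \<in> C_infinity M")
    case True
    let ?D = "frechet_derivative (\<lambda>x. c (inv_into V d x)) (at (d p))"
    have dp: "d p \<in> d ` (V \<inter> U)" using c d by blast
    have t: "((\<lambda>x. c (inv_into V d x)) has_derivative ?D) (at (d p))"
      by (rule smooth_on_has_derivative[OF chart_transition[OF c(1) d(1)] dp])
    have cp: "c (inv_into V d (d p)) = c p" using d by simp
    have "((\<lambda>x. f (inv_into U c (c (inv_into V d x)))) has_derivative
        (\<lambda>h. dir_deriv M (U, c) p (?D h) f)) (at (d p))"
      by (rule has_derivative_compose[OF t, unfolded cp, OF dir_deriv_has_derivative[OF c True]])
    then have "((\<lambda>x. f (inv_into V d x)) has_derivative
        (\<lambda>h. dir_deriv M (U, c) p (?D h) f)) (at (d p))"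
    proof (rule has_derivative_transform_within_open)
      show "open (d ` (V \<inter> U))"
        using chart_open_image[OF d(1) chart_homeomorphism(1)[OF c(1)]] by (simp add: Int_commute)
    qed (use dp c d in auto)
    then show ?thesis by (rule dir_deriv_eqI[OF d True])
  qed (simp add: dir_deriv_def)
qed

lemma tangent_space_chart:
  assumes "(U, c) \<in> M" "p \<in> U" "v \<in> tangent_space M p"
  obtains a where "v = dir_deriv M (U, c) p a"
  using assms(3) by (rule tangent_spaceE) (use dir_deriv_change_chart[OF assms(1,2)] that in blast)

text \<open>Bump functions times linear functions in a chart separate tangent vectors.\<close>

lemma dir_deriv_inject:
  assumes c: "(U, c) \<in> M" "p \<in> U" and eq: "dir_deriv M (U, c) p a = dir_deriv M (U, c) p a'"
  shows "a = a'"
proof -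
  obtain f where f: "bump f U" "f p \<noteq> 0" by (rule bump_exists[OF chart_homeomorphism(1)[OF c(1)] c(2)])
  \<comment> \<open>This function vanishes at \<open>c p\<close>, so the product rule leaves only
    its own derivative, multiplied by \<open>f p\<close>. That derivative pairs directions with
    \<open>a - a'\<close>, hence tells \<open>a\<close> and \<open>a'\<close> apart.\<close>
  let ?l = "\<lambda>x. (x + (- c p)) \<bullet> (a - a')"
  have "smooth_on UNIV ?l"
    by (rule smooth_on_bounded_linear[OF bounded_linear_inner_left[of "a - a'"] open_UNIV
          smooth_on_add[OF open_UNIV smooth_on_ident smooth_on_const[of _ "- c p"]]])
  then have "smooth_fun_on M U (\<lambda>q. ?l (c q))"
    by (rule smooth_fun_on_chart_pullback[OF c(1) smooth_on_subset[OF _ subset_UNIV]])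
  then have g: "(\<lambda>q. f q * ?l (c q)) \<in> C_infinity M"
    by (rule C_infinity_bump_mult[OF f(1) chart_homeomorphism(1)[OF c(1)]])
  have "((\<lambda>x. x + (- c p)) has_derivative (\<lambda>h. h)) (at (c p))"
    by (rule has_derivative_eq_rhs[OF has_derivative_add[OF has_derivative_ident has_derivative_const]]) simp
  note l = bounded_linear.has_derivative[OF bounded_linear_inner_left[of "a - a'"] this]
  have "((\<lambda>x. f (inv_into U c x) * ?l x) has_derivative
      (\<lambda>h. f p * (h \<bullet> (a - a')))) (at (c p))"
    using has_derivative_mult[OF dir_deriv_has_derivative[OF c bump_smooth[OF f(1)]] l] c by simp
  then have "((\<lambda>x. f (inv_into U c x) * ?l (c (inv_into U c x))) has_derivative
      (\<lambda>h. f p * (h \<bullet> (a - a')))) (at (c p))"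
    by (rule has_derivative_transform_within_open[OF _ chart_homeomorphism(2)[OF c(1)]])
      (use c in auto)
  note dd = dir_deriv_eqI[OF c g this]
  have "f p * (a \<bullet> (a - a')) = f p * (a' \<bullet> (a - a'))"
    using dd[of a] dd[of a'] eq by simp
  then have "(a - a') \<bullet> (a - a') = 0" using f(2) by (simp add: inner_diff_left)
  then show ?thesis by simp
qed

text \<open>Existence by change of chart and uniqueness by \<open>dir_deriv_inject\<close> give a
  meaning to the description \<open>THE a\<close> in the trivialisations of
  \<open>tangent_bundle\<close>.\<close>

lemma dir_deriv_coordinate:
  assumes "(U, c) \<in> M" "p \<in> U" "v \<in> tangent_space M p"
  shows "dir_deriv M (U, c) p (THE a. v = dir_deriv M (U, c) p a) = v"
proof -
  obtain a where a: "v = dir_deriv M (U, c) p a" by (rule tangent_space_chart[OF assms])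
  then have "(THE a. v = dir_deriv M (U, c) p a) = a"
    using dir_deriv_inject[OF assms(1,2)] by (intro the_equality) auto
  then show ?thesis using a by simp
qed

text \<open>As in the chain rule, the varying direction is expanded in a fixed orthonormal basis;
  what remains are smooth coefficients times derivatives in constant directions.\<close>

lemma smooth_fun_on_dir_deriv:
  assumes c: "(U, c) \<in> M" and f: "f \<in> C_infinity M"
    and X: "open X" "X \<subseteq> U" "smooth_fun_on M X a"
  shows "smooth_fun_on M X (\<lambda>q. dir_deriv M (U, c) q (a q) f)"
proof -
  obtain B :: "'e set" where B: "orthonormal_basis B" by (rule model_basis)
  let ?f = "\<lambda>x. f (inv_into U c x)"
  have sf: "smooth_on (c ` U) ?f" using smooth_fun_onD[OF C_infinityD[OF f, of UNIV] c] by simp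
  have "smooth_fun_on M X (\<lambda>q. \<Sum>b\<in>B. (a q \<bullet> b) *\<^sub>R frechet_derivative ?f (at (c q)) b)"
  proof (rule smooth_fun_on_sum[OF X(1)], rule smooth_fun_on_scaleR[OF X(1)])
    fix b
    show "smooth_fun_on M X (\<lambda>q. a q \<bullet> b)"
      by (rule smooth_fun_on_linear[OF bounded_linear_inner_left X(1,3)])
    show "smooth_fun_on M X (\<lambda>q. frechet_derivative ?f (at (c q)) b)"
      by (rule smooth_fun_on_subset[OF smooth_fun_on_chart_pullback[OF c smooth_on_derivative[OF sf]] X(2)])
  qed
  then show ?thesis
  proof (rule smooth_fun_on_cong[OF X(1), rotated])
    fix q assume "q \<in> X"
    then have q: "q \<in> U" using X(2) by blast
    have "linear (frechet_derivative ?f (at (c q)))"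
      by (rule has_derivative_linear[OF smooth_on_has_derivative[OF sf]]) (use q in blast)
    from orthonormal_basis_linear[OF B this, of "a q"]
    show "(\<Sum>b\<in>B. (a q \<bullet> b) *\<^sub>R frechet_derivative ?f (at (c q)) b) = dir_deriv M (U, c) q (a q) f"
      using f by (simp add: dir_deriv_def o_def)
  qed
qed

end

section \<open>Sections of vector bundles\<close>

lemma fibrewise_linear_zero:
  assumes "fibrewise_linear E h" "0 \<in> E"
  shows "h 0 = 0"
proof -
  have "\<forall>r. \<forall>v\<in>E. h (r *\<^sub>R v) = r *\<^sub>R h v" using assms(1) unfolding fibrewise_linear_def by (rule conjunct2)
  from bspec[OF spec[OF this, of 0] assms(2)] show ?thesis by simp
qed

lemma fibrewise_linear_add:
  assumes "fibrewise_linear E h" "v \<in> E" "w \<in> E"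
  shows "h (v + w) = h v + h w"
  using assms(1) unfolding fibrewise_linear_def by (elim conjE) (rule bspec[OF bspec[OF _ assms(2)] assms(3)])

lemma fibrewise_linear_scale:
  assumes "fibrewise_linear E h" "v \<in> E"
  shows "h (r *\<^sub>R v) = r *\<^sub>R h v"
proof -
  have "\<forall>r. \<forall>v\<in>E. h (r *\<^sub>R v) = r *\<^sub>R h v" using assms(1) unfolding fibrewise_linear_def by (rule conjunct2)
  from bspec[OF spec[OF this, of r] assms(2)] show ?thesis .
qed

locale smooth_vbundle = smooth_mfd M
  for M :: "('m::{t2_space,second_countable_topology}, 'e::real_inner) chart set" +
  fixes A :: "('m, 'v::real_vector, 'f::euclidean_space) vbundle"
  assumes vb: "vector_bundle M A"
begin

lemma fibre_subspace: "subspace (fibre A p)"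
  by (rule spec[OF conjunct1[OF vb[unfolded vector_bundle_def]]])

lemmas fibre_zero = subspace_0[OF fibre_subspace]
  and fibre_add = subspace_add[OF fibre_subspace]
  and fibre_scale = subspace_scale[OF fibre_subspace]

lemma triv_at:
  obtains U \<phi> where "(U, \<phi>) \<in> trivs A" "p \<in> U"
proof -
  have "(\<Union>(U, \<phi>)\<in>trivs A. U) = UNIV"
    by (rule conjunct1[OF conjunct2[OF vb[unfolded vector_bundle_def]]])
  then have "p \<in> (\<Union>(U, \<phi>)\<in>trivs A. U)" by simp
  then show thesis using that by blast
qed

section \<open>Trivialisations and their local frames\<close>

definition frame :: "('m \<Rightarrow> 'v \<Rightarrow> 'f) \<Rightarrow> 'f \<Rightarrow> 'm \<Rightarrow> 'v" where
  "frame \<phi> w p = inv_into (fibre A p) (\<phi> p) w"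

lemma triv_props:
  assumes "(U, \<phi>) \<in> trivs A"
  shows "open U" "p \<in> U \<Longrightarrow> bij_betw (\<phi> p) (fibre A p) UNIV"
    "p \<in> U \<Longrightarrow> fibrewise_linear (fibre A p) (\<phi> p)"
proof -
  have "\<forall>(U, \<phi>)\<in>trivs A. open U \<and>
        (\<forall>p\<in>U. bij_betw (\<phi> p) (fibre A p) UNIV \<and> fibrewise_linear (fibre A p) (\<phi> p))"
    by (rule conjunct1[OF conjunct2[OF conjunct2[OF vb[unfolded vector_bundle_def]]]])
  from bspec[OF this assms]
  show "open U" "p \<in> U \<Longrightarrow> bij_betw (\<phi> p) (fibre A p) UNIV"
    "p \<in> U \<Longrightarrow> fibrewise_linear (fibre A p) (\<phi> p)" by auto
qed

lemma triv_transition: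
  assumes "(U, \<phi>) \<in> trivs A" "(V, \<psi>) \<in> trivs A"
  shows "smooth_fun_on M (U \<inter> V) (\<lambda>p. \<psi> p (frame \<phi> w p))"
proof -
  have "\<forall>(U, \<phi>)\<in>trivs A. \<forall>(V, \<psi>)\<in>trivs A. \<forall>w.
        smooth_fun_on M (U \<inter> V) (\<lambda>p. \<psi> p (inv_into (fibre A p) (\<phi> p) w))"
    by (rule conjunct2[OF conjunct2[OF conjunct2[OF vb[unfolded vector_bundle_def]]]])
  from bspec[OF this assms(1)]
  have "\<forall>(V, \<psi>)\<in>trivs A. \<forall>w. smooth_fun_on M (U \<inter> V) (\<lambda>p. \<psi> p (inv_into (fibre A p) (\<phi> p) w))"
    by simp
  from bspec[OF this assms(2)] show ?thesis by (simp add: frame_def)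
qed

lemma frame_fibre:
  assumes "(U, \<phi>) \<in> trivs A" "p \<in> U"
  shows "frame \<phi> w p \<in> fibre A p" "\<phi> p (frame \<phi> w p) = w"
    "v \<in> fibre A p \<Longrightarrow> frame \<phi> (\<phi> p v) p = v"
proof -
  have im: "\<phi> p ` fibre A p = UNIV" and inj: "inj_on (\<phi> p) (fibre A p)"
    using triv_props(2)[OF assms] by (simp_all add: bij_betw_def)
  show "frame \<phi> w p \<in> fibre A p" "\<phi> p (frame \<phi> w p) = w"
    unfolding frame_def by (simp_all add: im inv_into_into f_inv_into_f)
  show "v \<in> fibre A p \<Longrightarrow> frame \<phi> (\<phi> p v) p = v"
    unfolding frame_def by (rule inv_into_f_f[OF inj])
qed

lemma frame_linear:
  assumes U: "(U, \<phi>) \<in> trivs A" "p \<in> U"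
  shows "linear (\<lambda>w. frame \<phi> w p)"
proof -
  note lin = triv_props(3)[OF U] and fr = frame_fibre[OF U]
  have "frame \<phi> (v + w) p = frame \<phi> v p + frame \<phi> w p" for v w
    using fr(3)[OF fibre_add[OF fr(1)[of v] fr(1)[of w]]]
    by (simp add: fibrewise_linear_add[OF lin fr(1) fr(1)] fr(2))
  moreover have "frame \<phi> (r *\<^sub>R w) p = r *\<^sub>R frame \<phi> w p" for r w
    using fr(3)[OF fibre_scale[OF fr(1)[of w], of r]]
    by (simp add: fibrewise_linear_scale[OF lin fr(1)] fr(2))
  ultimately show ?thesis by (rule linearI)
qed

text \<open>The expansion in components through which the smoothness of anything fibrewise linear is
  reduced to its values on a frame. With the identity for \<open>h\<close> it expands the vector
  itself.\<close>

lemma fibrewise_linear_frame: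
  fixes h :: "'v \<Rightarrow> 'w::real_vector"
  assumes U: "(U, \<phi>) \<in> trivs A" "p \<in> U"
    and h: "fibrewise_linear (fibre A p) h" and v: "v \<in> fibre A p"
  shows "h v = (\<Sum>i\<in>Basis. (\<phi> p v \<bullet> i) *\<^sub>R h (frame \<phi> i p))"
proof -
  note fr = frame_fibre[OF U] and lin = frame_linear[OF U]
  have "linear (\<lambda>w. h (frame \<phi> w p))"
  proof (rule linearI)
    show "h (frame \<phi> (v + w) p) = h (frame \<phi> v p) + h (frame \<phi> w p)" for v w
      by (simp add: linear_add[OF lin] fibrewise_linear_add[OF h fr(1) fr(1)])
    show "h (frame \<phi> (r *\<^sub>R w) p) = r *\<^sub>R h (frame \<phi> w p)" for r w
      by (simp add: linear_scale[OF lin] fibrewise_linear_scale[OF h fr(1)])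
  qed
  from orthonormal_basis_linear[OF orthonormal_basis_Basis this, of "\<phi> p v"]
  show ?thesis by (simp add: fr(3)[OF v])
qed

section \<open>Smooth sections and tensoriality\<close>

lemma sectionsD:
  assumes "S \<in> sections M A"
  shows "S p \<in> fibre A p"
    "(U, \<phi>) \<in> trivs A \<Longrightarrow> smooth_fun_on M U (\<lambda>p. \<phi> p (S p))"
  using assms by (auto simp: sections_def)

text \<open>One trivialisation near each point is enough: in any other the components are combined
  with the smooth transition functions.\<close>

lemma sections_localI:
  assumes "\<And>p. S p \<in> fibre A p"
    and "\<And>p. \<exists>U \<phi> W. (U, \<phi>) \<in> trivs A \<and> open W \<and> p \<in> W \<and> W \<subseteq> U \<and>
           smooth_fun_on M W (\<lambda>q. \<phi> q (S q))"
  shows "S \<in> sections M A"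
proof -
  have "smooth_fun_on M V (\<lambda>p. \<psi> p (S p))" if V: "(V, \<psi>) \<in> trivs A" for V \<psi>
  proof (rule smooth_fun_on_local)
    fix p assume p: "p \<in> V"
    from assms(2)[of p] obtain U \<phi> W where U: "(U, \<phi>) \<in> trivs A"
      and W: "open W" "p \<in> W" "W \<subseteq> U" "smooth_fun_on M W (\<lambda>q. \<phi> q (S q))" by (elim exE conjE)
    have o: "open (W \<inter> V)" by (rule open_Int[OF W(1) triv_props(1)[OF V]])
    have "smooth_fun_on M (W \<inter> V) (\<lambda>q. \<Sum>i\<in>Basis. (\<phi> q (S q) \<bullet> i) *\<^sub>R \<psi> q (frame \<phi> i q))"
    proof (rule smooth_fun_on_sum[OF o], rule smooth_fun_on_scaleR[OF o])
      fix i
      show "smooth_fun_on M (W \<inter> V) (\<lambda>q. \<phi> q (S q) \<bullet> i)"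
        by (rule smooth_fun_on_linear[OF bounded_linear_inner_left o smooth_fun_on_subset[OF W(4)]]) blast
      show "smooth_fun_on M (W \<inter> V) (\<lambda>q. \<psi> q (frame \<phi> i q))"
        by (rule smooth_fun_on_subset[OF triv_transition[OF U V]]) (use W(3) in blast)
    qed
    then have "smooth_fun_on M (W \<inter> V) (\<lambda>q. \<psi> q (S q))"
    proof (rule smooth_fun_on_cong[OF o, rotated])
      fix q assume "q \<in> W \<inter> V"
      then have "q \<in> U" "q \<in> V" using W(3) by blast+
      from fibrewise_linear_frame[OF U this(1) triv_props(3)[OF V this(2)] assms(1)]
      show "(\<Sum>i\<in>Basis. (\<phi> q (S q) \<bullet> i) *\<^sub>R \<psi> q (frame \<phi> i q)) = \<psi> q (S q)" by simp
    qed
    then show "\<exists>Y. open Y \<and> p \<in> Y \<and> smooth_fun_on M Y (\<lambda>q. \<psi> q (S q))"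
      using o p W(2) by blast
  qed
  then show ?thesis using assms(1) by (auto simp: sections_def)
qed

lemma sectionsI:
  assumes "\<And>p. S p \<in> fibre A p" "\<And>U \<phi>. (U, \<phi>) \<in> trivs A \<Longrightarrow> smooth_fun_on M U (\<lambda>p. \<phi> p (S p))"
  shows "S \<in> sections M A"
  using assms by (auto simp: sections_def)

lemma sections_add:
  assumes S: "S \<in> sections M A" and T: "T \<in> sections M A"
  shows "(\<lambda>p. S p + T p) \<in> sections M A"
proof (rule sectionsI)
  show "S p + T p \<in> fibre A p" for p by (rule fibre_add[OF sectionsD(1)[OF S] sectionsD(1)[OF T]])
  fix U \<phi> assume U: "(U, \<phi>) \<in> trivs A"
  show "smooth_fun_on M U (\<lambda>p. \<phi> p (S p + T p))"
    by (rule smooth_fun_on_cong[OF triv_props(1)[OF U] _ smooth_fun_on_add[OF triv_props(1)[OF U]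
            sectionsD(2)[OF S U] sectionsD(2)[OF T U]]])
      (simp add: fibrewise_linear_add[OF triv_props(3)[OF U] sectionsD(1)[OF S] sectionsD(1)[OF T]])
qed

lemma sections_mult:
  assumes f: "f \<in> C_infinity M" and S: "S \<in> sections M A"
  shows "(\<lambda>p. f p *\<^sub>R S p) \<in> sections M A"
proof (rule sectionsI)
  show "f p *\<^sub>R S p \<in> fibre A p" for p by (rule fibre_scale[OF sectionsD(1)[OF S]])
  fix U \<phi> assume U: "(U, \<phi>) \<in> trivs A"
  show "smooth_fun_on M U (\<lambda>p. \<phi> p (f p *\<^sub>R S p))"
    by (rule smooth_fun_on_cong[OF triv_props(1)[OF U] _ smooth_fun_on_scaleR[OF triv_props(1)[OF U]
            C_infinityD[OF f] sectionsD(2)[OF S U]]])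
      (simp add: fibrewise_linear_scale[OF triv_props(3)[OF U] sectionsD(1)[OF S]])
qed

lemma sections_scale: "S \<in> sections M A \<Longrightarrow> (\<lambda>p. r *\<^sub>R S p) \<in> sections M A"
  by (rule sections_mult[OF C_infinity_const])

lemma sections_zero: "(\<lambda>p. 0) \<in> sections M A"
proof (rule sectionsI)
  show "0 \<in> fibre A p" for p by (rule fibre_zero)
  fix U \<phi> assume U: "(U, \<phi>) \<in> trivs A"
  show "smooth_fun_on M U (\<lambda>p. \<phi> p 0)"
    by (rule smooth_fun_on_cong[OF triv_props(1)[OF U] _ smooth_fun_on_const[of _ 0]])
      (simp add: fibrewise_linear_zero[OF triv_props(3)[OF U] fibre_zero])
qed

lemma sections_sum:
  assumes "\<And>i. i \<in> I \<Longrightarrow> S i \<in> sections M A"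
  shows "(\<lambda>p. \<Sum>i\<in>I. S i p) \<in> sections M A"
proof (cases "finite I")
  case True
  then show ?thesis using assms
  proof (induction I)
    case (insert i I)
    then have "(\<lambda>p. S i p + (\<Sum>j\<in>I. S j p)) \<in> sections M A"
      by (intro sections_add) simp_all
    then show ?case using insert.hyps by simp
  qed (simp add: sections_zero)
qed (simp add: sections_zero)

text \<open>Outside \<open>U\<close> the value of \<open>frame\<close> is an arbitrary result of
  \<open>inv_into\<close> and may leave the fibre; the bump factor is 0 there, and its closed
  support makes the product smooth across the boundary.\<close>

lemma sections_bump_frame:
  assumes U: "(U, \<phi>) \<in> trivs A" and f: "bump f U"
  shows "(\<lambda>q. f q *\<^sub>R frame \<phi> w q) \<in> sections M A"
proof (rule sectionsI)
  show "f q *\<^sub>R frame \<phi> w q \<in> fibre A q" for q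
  proof (cases "q \<in> U")
    case True
    then show ?thesis by (rule fibre_scale[OF frame_fibre(1)[OF U]])
  next
    case False
    then show ?thesis using bump_outside[OF f] fibre_zero by simp
  qed
  fix V \<psi> assume V: "(V, \<psi>) \<in> trivs A"
  note V' = triv_props[OF V]
  show "smooth_fun_on M V (\<lambda>q. \<psi> q (f q *\<^sub>R frame \<phi> w q))"
  proof (rule smooth_fun_on_cong[OF V'(1) _
        smooth_fun_on_bump_scaleR[OF f triv_props(1)[OF U] V'(1) triv_transition[OF U V]]])
    fix q assume q: "q \<in> V"
    show "f q *\<^sub>R \<psi> q (frame \<phi> w q) = \<psi> q (f q *\<^sub>R frame \<phi> w q)"
    proof (cases "q \<in> U")
      case True
      show ?thesis by (rule fibrewise_linear_scale[OF V'(3)[OF q] frame_fibre(1)[OF U True], symmetric])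
    next
      case False
      then have "f q = 0" by (rule bump_outside[OF f])
      then show ?thesis using fibrewise_linear_zero[OF V'(3)[OF q] fibre_zero] by simp
    qed
  qed
qed

text \<open>Dividing by \<open>f p\<close> normalises the bump, of which only
  \<open>f p \<noteq> 0\<close> is known. Identities between global sections thereby become
  identities between vectors of a fibre.\<close>

lemma section_through:
  assumes "v \<in> fibre A p"
  obtains S where "S \<in> sections M A" "S p = v"
proof -
  obtain U \<phi> where U: "(U, \<phi>) \<in> trivs A" "p \<in> U" by (rule triv_at)
  obtain f where f: "bump f U" "f p \<noteq> 0" by (rule bump_exists[OF triv_props(1)[OF U(1)] U(2)])
  let ?S = "\<lambda>q. (1 / f p) *\<^sub>R (f q *\<^sub>R frame \<phi> (\<phi> p v) q)"
  have "?S \<in> sections M A" by (rule sections_scale[OF sections_bump_frame[OF U(1) f(1)]])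
  moreover have "?S p = v" using f(2) frame_fibre(3)[OF U assms] by simp
  ultimately show thesis by (rule that)
qed

lemma dual_sectionsD:
  assumes "\<eta> \<in> dual_sections M A"
  shows "fibrewise_linear (fibre A p) (\<eta> p)"
    "(U, \<phi>) \<in> trivs A \<Longrightarrow> smooth_fun_on M U (\<lambda>p. \<eta> p (frame \<phi> w p))"
  using assms by (auto simp: dual_sections_def frame_def)

lemma dual_section_smooth:
  assumes \<eta>: "\<eta> \<in> dual_sections M A" and S: "S \<in> sections M A"
  shows "(\<lambda>p. \<eta> p (S p)) \<in> C_infinity M"
proof -
  have "smooth_fun_on M UNIV (\<lambda>p. \<eta> p (S p))"
  proof (rule smooth_fun_on_local)
    fix p
    obtain U \<phi> where U: "(U, \<phi>) \<in> trivs A" "p \<in> U" by (rule triv_at)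
    note o = triv_props(1)[OF U(1)]
    have "smooth_fun_on M U (\<lambda>q. \<Sum>i\<in>Basis. (\<phi> q (S q) \<bullet> i) *\<^sub>R \<eta> q (frame \<phi> i q))"
    proof (rule smooth_fun_on_sum[OF o], rule smooth_fun_on_scaleR[OF o])
      fix i
      show "smooth_fun_on M U (\<lambda>q. \<phi> q (S q) \<bullet> i)"
        by (rule smooth_fun_on_linear[OF bounded_linear_inner_left o sectionsD(2)[OF S U(1)]])
      show "smooth_fun_on M U (\<lambda>q. \<eta> q (frame \<phi> i q))"
        by (rule dual_sectionsD(2)[OF \<eta> U(1)])
    qed
    then have "smooth_fun_on M U (\<lambda>q. \<eta> q (S q))"
      by (rule smooth_fun_on_cong[OF o, rotated])
        (rule fibrewise_linear_frame[OF U(1) _ dual_sectionsD(1)[OF \<eta>] sectionsD(1)[OF S], symmetric])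
    then show "\<exists>Y. open Y \<and> p \<in> Y \<and> smooth_fun_on M Y (\<lambda>p. \<eta> p (S p))"
      using o U(2) by blast
  qed
  then show ?thesis by (simp add: C_infinity_def)
qed

text \<open>With \<open>f\<close> a bump function at \<open>p\<close>, \<open>s\<^sub>i\<close> the components of \<open>S\<close> and \<open>e\<^sub>i\<close> a local frame, all
  factors of \<open>f\<^sup>2 S = \<Sum> (f s\<^sub>i) (f e\<^sub>i)\<close> are global.\<close>

lemma tensorial:
  fixes \<Phi> :: "('m \<Rightarrow> 'v) \<Rightarrow> real"
  assumes add: "\<And>S T. S \<in> sections M A \<Longrightarrow> T \<in> sections M A \<Longrightarrow> \<Phi> (\<lambda>q. S q + T q) = \<Phi> S + \<Phi> T"
    and mult: "\<And>f S. f \<in> C_infinity M \<Longrightarrow> S \<in> sections M A \<Longrightarrow> \<Phi> (\<lambda>q. f q *\<^sub>R S q) = f p * \<Phi> S"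
    and S: "S \<in> sections M A" and S0: "S p = 0"
  shows "\<Phi> S = 0"
proof -
  obtain U \<phi> where U: "(U, \<phi>) \<in> trivs A" "p \<in> U" by (rule triv_at)
  obtain f where f: "bump f U" "f p \<noteq> 0" by (rule bump_exists[OF triv_props(1)[OF U(1)] U(2)])
  note fs = bump_smooth[OF f(1)]
  let ?s = "\<lambda>i q. f q * (\<phi> q (S q) \<bullet> i)" and ?e = "\<lambda>i q. f q *\<^sub>R frame \<phi> i q"
  have s: "?s i \<in> C_infinity M" for i
    by (rule C_infinity_bump_mult[OF f(1) triv_props(1)[OF U(1)]
          smooth_fun_on_linear[OF bounded_linear_inner_left triv_props(1)[OF U(1)] sectionsD(2)[OF S U(1)]]])
  have e: "?e i \<in> sections M A" for i by (rule sections_bump_frame[OF U(1) f(1)])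
  have zero: "\<Phi> (\<lambda>q. 0) = 0"
    using mult[OF C_infinity_const[of 0] sections_zero] by simp
  have "\<Phi> (\<lambda>q. \<Sum>i\<in>I. ?s i q *\<^sub>R ?e i q) = 0" if "finite I" for I
    using that
  proof (induction I)
    case (insert i I)
    have "\<Phi> (\<lambda>q. ?s i q *\<^sub>R ?e i q + (\<Sum>i\<in>I. ?s i q *\<^sub>R ?e i q)) =
        \<Phi> (\<lambda>q. ?s i q *\<^sub>R ?e i q) + \<Phi> (\<lambda>q. \<Sum>i\<in>I. ?s i q *\<^sub>R ?e i q)"
      by (rule add[OF sections_mult[OF s e] sections_sum[OF sections_mult[OF s e]]])
    also have "\<Phi> (\<lambda>q. ?s i q *\<^sub>R ?e i q) = ?s i p * \<Phi> (?e i)"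
      by (rule mult[OF s e])
    also have "?s i p = 0"
      using S0 fibrewise_linear_zero[OF triv_props(3)[OF U] fibre_zero] by simp
    finally show ?case using insert by simp
  qed (simp add: zero)
  from this[OF finite_Basis] have z: "\<Phi> (\<lambda>q. \<Sum>i\<in>Basis. ?s i q *\<^sub>R ?e i q) = 0" .
  have "(\<lambda>q. \<Sum>i\<in>Basis. ?s i q *\<^sub>R ?e i q) = (\<lambda>q. f q *\<^sub>R (f q *\<^sub>R S q))"
  proof
    fix q
    show "(\<Sum>i\<in>Basis. ?s i q *\<^sub>R ?e i q) = f q *\<^sub>R (f q *\<^sub>R S q)"
    proof (cases "q \<in> U")
      case True
      have "fibrewise_linear (fibre A q) (\<lambda>v. v)" by (simp add: fibrewise_linear_def)
      from fibrewise_linear_frame[OF U(1) True this sectionsD(1)[OF S]]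
      have "S q = (\<Sum>i\<in>Basis. (\<phi> q (S q) \<bullet> i) *\<^sub>R frame \<phi> i q)" .
      then have "f q *\<^sub>R (f q *\<^sub>R S q) = f q *\<^sub>R (f q *\<^sub>R (\<Sum>i\<in>Basis. (\<phi> q (S q) \<bullet> i) *\<^sub>R frame \<phi> i q))"
        by (rule arg_cong)
      then show ?thesis by (simp add: scaleR_sum_right mult_ac)
    next
      case False
      then show ?thesis using bump_outside[OF f(1)] by simp
    qed
  qed
  with z have "\<Phi> (\<lambda>q. f q *\<^sub>R (f q *\<^sub>R S q)) = 0" by (simp only:)
  then have "f p * (f p * \<Phi> S) = 0"
    by (simp only: mult[OF fs sections_mult[OF fs S]] mult[OF fs S])
  then show ?thesis using f(2) by simp
qed

end

section \<open>Lie algebroids\<close>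

locale lie_algd = smooth_vbundle M A
  for M :: "('m::{t2_space,second_countable_topology}, 'e::real_inner) chart set"
    and A :: "('m, 'v::real_vector, 'f::euclidean_space) vbundle" +
  fixes br :: "('m \<Rightarrow> 'v) \<Rightarrow> ('m \<Rightarrow> 'v) \<Rightarrow> 'm \<Rightarrow> 'v"
    and \<rho> :: "'m \<Rightarrow> 'v \<Rightarrow> ('m \<Rightarrow> real) \<Rightarrow> real"
  assumes anchor: "bundle_map M A (tangent_bundle M) \<rho>"
    and br_section: "\<And>S T. S \<in> sections M A \<Longrightarrow> T \<in> sections M A \<Longrightarrow> br S T \<in> sections M A"
    and br_linear: "\<And>S T W a b. S \<in> sections M A \<Longrightarrow> T \<in> sections M A \<Longrightarrow> W \<in> sections M A \<Longrightarrow>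
        br (\<lambda>p. a *\<^sub>R S p + b *\<^sub>R T p) W = (\<lambda>p. a *\<^sub>R br S W p + b *\<^sub>R br T W p)"
      "\<And>S T W a b. S \<in> sections M A \<Longrightarrow> T \<in> sections M A \<Longrightarrow> W \<in> sections M A \<Longrightarrow>
        br W (\<lambda>p. a *\<^sub>R S p + b *\<^sub>R T p) = (\<lambda>p. a *\<^sub>R br W S p + b *\<^sub>R br W T p)"
    and br_self: "\<And>S. S \<in> sections M A \<Longrightarrow> br S S = (\<lambda>p. 0)"
    and br_Jacobi: "\<And>S T W p. S \<in> sections M A \<Longrightarrow> T \<in> sections M A \<Longrightarrow> W \<in> sections M A \<Longrightarrow>
        br S (br T W) p + br T (br W S) p + br W (br S T) p = 0"
    and anchor_br: "\<And>S T p. S \<in> sections M A \<Longrightarrow> T \<in> sections M A \<Longrightarrow>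
        \<rho> p (br S T p) = vector_field_bracket M (\<lambda>q. \<rho> q (S q)) (\<lambda>q. \<rho> q (T q)) p"
    and br_Leibniz: "\<And>S T f. S \<in> sections M A \<Longrightarrow> T \<in> sections M A \<Longrightarrow> f \<in> C_infinity M \<Longrightarrow>
        br S (\<lambda>p. f p *\<^sub>R T p) = (\<lambda>p. f p *\<^sub>R br S T p + act \<rho> S f p *\<^sub>R T p)"
begin

lemma anchor_tangent: "v \<in> fibre A p \<Longrightarrow> \<rho> p v \<in> tangent_space M p"
  using conjunct1[OF anchor[unfolded bundle_map_def]] by (simp add: tangent_bundle_def)

lemma anchor_linear: "fibrewise_linear (fibre A p) (\<rho> p)"
  by (rule spec[OF conjunct1[OF conjunct2[OF anchor[unfolded bundle_map_def]]]])

lemma anchor_linear_at: "fibrewise_linear (fibre A p) (\<lambda>v. \<rho> p v f)"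
  unfolding fibrewise_linear_def
proof (intro conjI ballI allI)
  show "\<rho> p (v + w) f = \<rho> p v f + \<rho> p w f" if "v \<in> fibre A p" "w \<in> fibre A p" for v w
    by (simp add: fibrewise_linear_add[OF anchor_linear that])
  show "\<rho> p (r *\<^sub>R v) f = r *\<^sub>R \<rho> p v f" if "v \<in> fibre A p" for r v
    by (simp add: fibrewise_linear_scale[OF anchor_linear that] scaleR_fun_def)
qed

lemma anchor_smooth:
  assumes "(U, \<phi>) \<in> trivs A" "(V, c) \<in> M"
  shows "smooth_fun_on M (U \<inter> V) (\<lambda>p. THE a. \<rho> p (frame \<phi> w p) = dir_deriv M (V, c) p a)"
proof -
  have "\<forall>(U, \<phi>)\<in>trivs A. \<forall>(V, \<psi>)\<in>trivs (tangent_bundle M). \<forall>w.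
        smooth_fun_on M (U \<inter> V) (\<lambda>p. \<psi> p (\<rho> p (inv_into (fibre A p) (\<phi> p) w)))"
    by (rule conjunct2[OF conjunct2[OF anchor[unfolded bundle_map_def]]])
  from bspec[OF this assms(1)]
  have *: "\<forall>(V, \<psi>)\<in>trivs (tangent_bundle M). \<forall>w.
        smooth_fun_on M (U \<inter> V) (\<lambda>p. \<psi> p (\<rho> p (inv_into (fibre A p) (\<phi> p) w)))" by simp
  have "(V, \<lambda>p v. THE a. v = dir_deriv M (V, c) p a) \<in> trivs (tangent_bundle M)"
    using assms(2) unfolding tangent_bundle_def by auto
  from bspec[OF * this] show ?thesis by (simp add: frame_def)
qed

text \<open>Smoothness of the anchor is known through the chart coordinates of the images of frame
  vectors. So \<open>S\<close> is expanded in a trivialisation and each image acts by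
  \<open>smooth_fun_on_dir_deriv\<close> in a chart.\<close>

lemma act_smooth:
  assumes S: "S \<in> sections M A" and f: "f \<in> C_infinity M"
  shows "act \<rho> S f \<in> C_infinity M"
proof -
  have "smooth_fun_on M UNIV (act \<rho> S f)"
  proof (rule smooth_fun_on_local)
    fix p
    obtain U \<phi> where U: "(U, \<phi>) \<in> trivs A" "p \<in> U" by (rule triv_at)
    obtain V c where V: "(V, c) \<in> M" "p \<in> V" by (rule chart_at)
    let ?a = "\<lambda>i q. THE a. \<rho> q (frame \<phi> i q) = dir_deriv M (V, c) q a"
    have o: "open (U \<inter> V)"
      by (rule open_Int[OF triv_props(1)[OF U(1)] chart_homeomorphism(1)[OF V(1)]])
    have "smooth_fun_on M (U \<inter> V) (\<lambda>q. \<Sum>i\<in>Basis. (\<phi> q (S q) \<bullet> i) *\<^sub>R dir_deriv M (V, c) q (?a i q) f)"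
    proof (rule smooth_fun_on_sum[OF o], rule smooth_fun_on_scaleR[OF o])
      fix i
      show "smooth_fun_on M (U \<inter> V) (\<lambda>q. \<phi> q (S q) \<bullet> i)"
        by (rule smooth_fun_on_linear[OF bounded_linear_inner_left o
              smooth_fun_on_subset[OF sectionsD(2)[OF S U(1)]]]) blast
      show "smooth_fun_on M (U \<inter> V) (\<lambda>q. dir_deriv M (V, c) q (?a i q) f)"
        by (rule smooth_fun_on_dir_deriv[OF V(1) f o _ anchor_smooth[OF U(1) V(1)]]) blast
    qed
    then have "smooth_fun_on M (U \<inter> V) (act \<rho> S f)"
    proof (rule smooth_fun_on_cong[OF o, rotated])
      fix q assume q: "q \<in> U \<inter> V"
      then have qU: "q \<in> U" and qV: "q \<in> V" by blast+
      have "dir_deriv M (V, c) q (?a i q) = \<rho> q (frame \<phi> i q)" for i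
        by (rule dir_deriv_coordinate[OF V(1) qV anchor_tangent[OF frame_fibre(1)[OF U(1) qU]]])
      then show "(\<Sum>i\<in>Basis. (\<phi> q (S q) \<bullet> i) *\<^sub>R dir_deriv M (V, c) q (?a i q) f) = act \<rho> S f q"
        using fibrewise_linear_frame[OF U(1) qU anchor_linear_at sectionsD(1)[OF S], of f]
        by (simp add: act_def)
    qed
    then show "\<exists>Y. open Y \<and> p \<in> Y \<and> smooth_fun_on M Y (act \<rho> S f)"
      using o U(2) V(2) by blast
  qed
  then show ?thesis by (simp add: C_infinity_def)
qed

lemma act_linear_fun:
  assumes "S \<in> sections M A" "f \<in> C_infinity M" "g \<in> C_infinity M"
  shows "act \<rho> S (\<lambda>q. r * f q + s * g q) p = r * act \<rho> S f p + s * act \<rho> S g p"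
  unfolding act_def by (rule tangent_linear_fun[OF anchor_tangent[OF sectionsD(1)[OF assms(1)]] assms(2,3)])

lemma act_add_fun:
  assumes "S \<in> sections M A" "f \<in> C_infinity M" "g \<in> C_infinity M"
  shows "act \<rho> S (\<lambda>q. f q + g q) p = act \<rho> S f p + act \<rho> S g p"
  using act_linear_fun[OF assms, of 1 1] by simp

lemma act_mult_fun:
  assumes "S \<in> sections M A" "f \<in> C_infinity M" "g \<in> C_infinity M"
  shows "act \<rho> S (\<lambda>q. f q * g q) p = f p * act \<rho> S g p + act \<rho> S f p * g p"
  unfolding act_def by (rule tangent_mult[OF anchor_tangent[OF sectionsD(1)[OF assms(1)]] assms(2,3)])

lemma act_uminus_fun:
  assumes "S \<in> sections M A" "f \<in> C_infinity M"
  shows "act \<rho> S (\<lambda>q. - f q) p = - act \<rho> S f p"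
  unfolding act_def by (rule tangent_uminus[OF anchor_tangent[OF sectionsD(1)[OF assms(1)]] assms(2)])

lemma act_add:
  assumes "S \<in> sections M A" "T \<in> sections M A"
  shows "act \<rho> (\<lambda>q. S q + T q) f p = act \<rho> S f p + act \<rho> T f p"
  unfolding act_def by (rule fibrewise_linear_add[OF anchor_linear_at sectionsD(1)[OF assms(1)] sectionsD(1)[OF assms(2)]])

lemma act_scale:
  assumes "S \<in> sections M A"
  shows "act \<rho> (\<lambda>q. g q *\<^sub>R S q) f p = g p * act \<rho> S f p"
  unfolding act_def fibrewise_linear_scale[OF anchor_linear_at sectionsD(1)[OF assms]] by simp

lemma br_add:
  assumes "S \<in> sections M A" "T \<in> sections M A" "W \<in> sections M A"
  shows "br W (\<lambda>p. S p + T p) = (\<lambda>p. br W S p + br W T p)"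
    "br (\<lambda>p. S p + T p) W = (\<lambda>p. br S W p + br T W p)"
  using br_linear(2)[OF assms, of 1 1] br_linear(1)[OF assms, of 1 1] by simp_all

lemma br_skew:
  assumes S: "S \<in> sections M A" and T: "T \<in> sections M A"
  shows "br S T p = - br T S p"
proof -
  note ST = sections_add[OF S T]
  have "br (\<lambda>p. S p + T p) (\<lambda>p. S p + T p) p = 0" by (simp add: br_self[OF ST])
  then have "(br S S p + br T S p) + (br S T p + br T T p) = 0"
    by (simp add: br_add(1)[OF S T ST] br_add(2)[OF S T S] br_add(2)[OF S T T])
  then show ?thesis by (simp add: br_self[OF S] br_self[OF T] eq_neg_iff_add_eq_0 add.commute)
qed

lemma act_br:
  assumes "S \<in> sections M A" "T \<in> sections M A" "f \<in> C_infinity M"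
  shows "act \<rho> (br S T) f p = act \<rho> S (act \<rho> T f) p - act \<rho> T (act \<rho> S f) p"
  using fun_cong[OF anchor_br[OF assms(1,2), of p], of f] assms(3)
  by (simp add: act_def vector_field_bracket_def)

end

lemma lie_algdI:
  assumes "lie_algebroid M A br \<rho>"
  shows "lie_algd M A br \<rho>"
proof -
  have "smooth_manifold M" "vector_bundle M A"
    using assms unfolding lie_algebroid_def by simp_all
  then interpret smooth_vbundle M A by unfold_locales
  show ?thesis
    using assms unfolding lie_algebroid_def by unfold_locales (elim conjE, simp)+
qed

section \<open>Linear systems with smooth coefficients\<close>

text \<open>The indices are transposed because the unknowns will multiply the first index of
  \<open>g\<close>, the slot of the bilinear form that holds the unknown vector; this makes the
  system an ordinary matrix times vector.\<close>

abbreviation tmat :: "nat \<Rightarrow> (nat \<Rightarrow> nat \<Rightarrow> real) \<Rightarrow> real Matrix.mat" where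
  "tmat d g \<equiv> Matrix.mat d d (\<lambda>(j, i). g i j)"

lemma tmat_carrier: "tmat d g \<in> carrier_mat d d"
  by simp

lemma tmat_mult_vec:
  "tmat d g *\<^sub>v Matrix.vec d y = Matrix.vec d (\<lambda>j. \<Sum>i<d. y i * g i j)"
  by (rule eq_vecI) (auto simp: Matrix.scalar_prod_def atLeast0LessThan mult.commute intro!: sum.cong)

lemma det_tmat_nonzero:
  assumes "\<And>y. \<forall>j<d. (\<Sum>i<d. y i * g i j) = 0 \<Longrightarrow> \<forall>i<d. y i = 0"
  shows "Determinant.det (tmat d g) \<noteq> 0"
proof
  assume "Determinant.det (tmat d g) = 0"
  then obtain v where v: "v \<in> carrier_vec d" "v \<noteq> 0\<^sub>v d" "tmat d g *\<^sub>v v = 0\<^sub>v d"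
    using det_0_iff_vec_prod_zero_field[OF tmat_carrier] by blast
  let ?y = "vec_index v"
  have v': "Matrix.vec d ?y = v" by (rule eq_vecI) (use v(1) in auto)
  have eq: "Matrix.vec d (\<lambda>j. \<Sum>i<d. ?y i * g i j) = 0\<^sub>v d"
    unfolding tmat_mult_vec[symmetric] v' by (rule v(3))
  have "(\<Sum>i<d. ?y i * g i j) = 0" if "j < d" for j
    using arg_cong[OF eq, of "\<lambda>v. vec_index v j"] that by simp
  then have "\<forall>j<d. (\<Sum>i<d. ?y i * g i j) = 0" by (intro allI impI)
  then have "\<forall>i<d. ?y i = 0" by (rule assms)
  then have "v = 0\<^sub>v d" using v(1) by (intro eq_vecI) auto
  with v(2) show False by (rule notE)
qed

lemma injective_system_solvable:
  fixes d :: nat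
  assumes "\<And>y. \<forall>j<d. (\<Sum>i<d. y i * g i j) = 0 \<Longrightarrow> \<forall>i<d. y i = (0::real)"
  obtains x where "\<And>j. j < d \<Longrightarrow> (\<Sum>i<d. x i * g i j) = \<beta> j"
proof -
  let ?A = "tmat d g" and ?b = "Matrix.vec d \<beta>"
  note D = det_tmat_nonzero[OF assms]
  \<comment> \<open>Cramer's rule in matrix form: the adjugate applied to the right-hand side,
    divided by the determinant.\<close>
  define v where "v = (1 / Determinant.det ?A) \<cdot>\<^sub>v (adj_mat ?A *\<^sub>v ?b)"
  note adj = adj_mat[OF tmat_carrier[of d g]]
  have vc: "v \<in> carrier_vec d" unfolding v_def using adj(1) by (simp add: carrier_vecI)
  have "?A *\<^sub>v v = (1 / Determinant.det ?A) \<cdot>\<^sub>v (?A *\<^sub>v (adj_mat ?A *\<^sub>v ?b))"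
    unfolding v_def by (rule mult_mat_vec[OF tmat_carrier]) (use adj(1) in \<open>simp add: carrier_vecI\<close>)
  also have "?A *\<^sub>v (adj_mat ?A *\<^sub>v ?b) = (?A * adj_mat ?A) *\<^sub>v ?b"
    by (rule assoc_mult_mat_vec[symmetric, OF tmat_carrier adj(1)]) simp
  also have "\<dots> = Determinant.det ?A \<cdot>\<^sub>v ?b"
    unfolding adj(2) by (intro eq_vecI) auto
  finally have "?A *\<^sub>v v = ?b" using D by (simp add: smult_smult_assoc)
  moreover have v': "Matrix.vec d (vec_index v) = v" by (rule eq_vecI) (use vc in auto)
  ultimately have eq: "Matrix.vec d (\<lambda>j. \<Sum>i<d. vec_index v i * g i j) = ?b"
    unfolding tmat_mult_vec[symmetric] v' by simp
  have "(\<Sum>i<d. vec_index v i * g i j) = \<beta> j" if "j < d" for j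
    using arg_cong[OF eq, of "\<lambda>v. vec_index v j"] that by simp
  then show thesis by (rule that)
qed

text \<open>Transposition preserves the determinant and here multiplies the matrix by -1, so for odd
  size the determinant equals its own negative.\<close>

lemma odd_skew_kernel:
  fixes d :: nat
  assumes "odd d" "\<And>i j. g i j = - g j i"
  obtains y where "\<exists>i<d. y i \<noteq> (0::real)" "\<And>j. j < d \<Longrightarrow> (\<Sum>i<d. y i * g i j) = 0"
proof -
  have "transpose_mat (tmat d g) = (-1) \<cdot>\<^sub>m tmat d g"
  proof (rule eq_matI)
    fix j i assume "j < dim_row (- 1 \<cdot>\<^sub>m tmat d g)" "i < dim_col (- 1 \<cdot>\<^sub>m tmat d g)"
    moreover have "g j i = - g i j" by (rule assms(2))
    ultimately show "transpose_mat (tmat d g) $$ (j, i) = (- 1 \<cdot>\<^sub>m tmat d g) $$ (j, i)" by simp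
  qed simp_all
  then have "Determinant.det (tmat d g) = (-1) ^ d * Determinant.det (tmat d g)"
    using Determinant.det_transpose[OF tmat_carrier[of d g]] by simp
  then have "Determinant.det (tmat d g) = 0" using assms(1) by simp
  have "\<exists>y. (\<forall>j<d. (\<Sum>i<d. y i * g i j) = 0) \<and> (\<exists>i<d. y i \<noteq> 0)"
  proof (rule ccontr)
    assume *: "\<not> ?thesis"
    have "Determinant.det (tmat d g) \<noteq> 0"
    proof (rule det_tmat_nonzero)
      fix y :: "nat \<Rightarrow> real"
      assume "\<forall>j<d. (\<Sum>i<d. y i * g i j) = 0"
      with * show "\<forall>i<d. y i = 0" by blast
    qed
    then show False using \<open>Determinant.det (tmat d g) = 0\<close> by simp
  qed
  then show thesis using that by blast
qed

context smooth_mfd begin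

lemma smooth_fun_on_det:
  fixes g :: "nat \<Rightarrow> nat \<Rightarrow> 'm \<Rightarrow> real"
  assumes o: "open X" and g: "\<And>i j. i < d \<Longrightarrow> j < d \<Longrightarrow> smooth_fun_on M X (g i j)"
  shows "smooth_fun_on M X (\<lambda>q. Determinant.det (Matrix.mat d d (\<lambda>(i, j). g i j q)))"
proof -
  have eq: "Determinant.det (Matrix.mat d d (\<lambda>(i, j). g i j q)) =
      (\<Sum>\<sigma> | \<sigma> permutes {0..<d}. signof \<sigma> * (\<Prod>i = 0..<d. g i (\<sigma> i) q))" for q
    by (subst det_def'[of _ d]) (auto intro!: sum.cong prod.cong simp: permutes_in_image)
  show ?thesis unfolding eq
  proof (rule smooth_fun_on_sum[OF o])
    fix \<sigma> assume \<sigma>: "\<sigma> \<in> {\<sigma>. \<sigma> permutes {0..<d}}"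
    have "smooth_fun_on M X (\<lambda>q. \<Prod>i = 0..<d. g i (\<sigma> i) q)"
    proof (rule smooth_fun_on_prod[OF o])
      fix i assume "i \<in> {0..<d}"
      moreover from this have "\<sigma> i \<in> {0..<d}" using \<sigma> by (simp only: permutes_in_image mem_Collect_eq)
      ultimately show "smooth_fun_on M X (g i (\<sigma> i))" by (intro g) simp_all
    qed
    then show "smooth_fun_on M X (\<lambda>q. signof \<sigma> * (\<Prod>i = 0..<d. g i (\<sigma> i) q))"
      by (rule smooth_fun_on_mult[OF o smooth_fun_on_const])
  qed
qed

text \<open>The solution \<open>x\<close> is given point by point, with no continuity assumed. By
  Cramer's rule each component is a quotient of determinants with smooth entries, the denominator
  being nonzero by injectivity.\<close>

lemma smooth_linear_solution:
  fixes d :: nat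
  assumes o: "open X"
    and g: "\<And>i j. i < d \<Longrightarrow> j < d \<Longrightarrow> smooth_fun_on M X (g i j)"
    and \<beta>: "\<And>j. j < d \<Longrightarrow> smooth_fun_on M X (\<beta> j)"
    and sol: "\<And>q j. q \<in> X \<Longrightarrow> j < d \<Longrightarrow> (\<Sum>i<d. x i q * g i j q) = \<beta> j q"
    and inj: "\<And>q (y :: nat \<Rightarrow> real). q \<in> X \<Longrightarrow> \<forall>j<d. (\<Sum>i<d. y i * g i j q) = 0 \<Longrightarrow> \<forall>i<d. y i = (0::real)"
    and k: "k < d"
  shows "smooth_fun_on M X (x k)"
proof -
  let ?A = "\<lambda>q. tmat d (\<lambda>i j. g i j q)"
  \<comment> \<open>The numerator in Cramer's rule: the system matrix with column \<open>k\<close>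
    replaced by the right-hand side.\<close>
  let ?B = "\<lambda>q. Matrix.mat d d (\<lambda>(j, i). if i = k then \<beta> j q else g i j q)"
  have A: "smooth_fun_on M X (\<lambda>q. Determinant.det (?A q))"
    by (rule smooth_fun_on_det[OF o, of d "\<lambda>j i. g i j"]) (rule g)
  have B: "smooth_fun_on M X (\<lambda>q. Determinant.det (?B q))"
    by (rule smooth_fun_on_det[OF o, of d "\<lambda>j i q. if i = k then \<beta> j q else g i j q"])
      (rename_tac j i, case_tac "i = k", use g \<beta> in simp_all)
  have D: "Determinant.det (?A q) \<noteq> 0" if "q \<in> X" for q
    by (rule det_tmat_nonzero) (rule inj[OF that])
  have "smooth_fun_on M X (\<lambda>q. Determinant.det (?B q) * inverse (Determinant.det (?A q)))"
    by (rule smooth_fun_on_mult[OF o B smooth_fun_on_inverse[OF o A D]])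
  then show ?thesis
  proof (rule smooth_fun_on_cong[OF o, rotated])
    fix q assume q: "q \<in> X"
    let ?x = "Matrix.vec d (\<lambda>i. x i q)"
    have "?A q *\<^sub>v ?x = Matrix.vec d (\<lambda>j. \<beta> j q)"
      unfolding tmat_mult_vec using sol[OF q] by (intro eq_vecI) auto
    then have "replace_col (?A q) (?A q *\<^sub>v ?x) k = ?B q"
      unfolding replace_col_def by (intro eq_matI) auto
    then have "Determinant.det (?B q) = x k q * Determinant.det (?A q)"
      using cramer_lemma_mat[OF tmat_carrier vec_carrier k, of "\<lambda>i j. g i j q" "\<lambda>i. x i q"] k by simp
    then show "Determinant.det (?B q) * inverse (Determinant.det (?A q)) = x k q"
      using D[OF q] by simp
  qed
qed

end

section \<open>Multilinear forms\<close>

text \<open>\<open>K\<close> is a set of sections on which the form vanishes as soon as one argument lies in \<open>K\<close>.\<close>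

definition multilinear_form ::
  "('m \<Rightarrow> 'v::real_vector) set \<Rightarrow> ('m \<Rightarrow> 'v) set \<Rightarrow> 'm \<Rightarrow> nat \<Rightarrow> ('m, 'v) form \<Rightarrow> bool" where
  "multilinear_form V K p k \<alpha> \<longleftrightarrow>
     (\<forall>S S'. (\<forall>i<k. S i = S' i) \<longrightarrow> \<alpha> S p = \<alpha> S' p) \<and>
     (\<forall>S i X Y a b. i < k \<longrightarrow> (\<forall>j. S j \<in> V) \<longrightarrow> X \<in> V \<longrightarrow> Y \<in> V \<longrightarrow>
        \<alpha> (S(i := \<lambda>q. a *\<^sub>R X q + b *\<^sub>R Y q)) p = a * \<alpha> (S(i := X)) p + b * \<alpha> (S(i := Y)) p) \<and>
     (\<forall>S i. i < k \<longrightarrow> (\<forall>j. S j \<in> V) \<longrightarrow> S i \<in> K \<longrightarrow> \<alpha> S p = 0)"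

lemma multilinear_formD:
  assumes "multilinear_form V K p k \<alpha>"
  shows "(\<And>i. i < k \<Longrightarrow> S i = S' i) \<Longrightarrow> \<alpha> S p = \<alpha> S' p"
    and "i < k \<Longrightarrow> (\<And>j. S j \<in> V) \<Longrightarrow> X \<in> V \<Longrightarrow> Y \<in> V \<Longrightarrow>
        \<alpha> (S(i := \<lambda>q. a *\<^sub>R X q + b *\<^sub>R Y q)) p = a * \<alpha> (S(i := X)) p + b * \<alpha> (S(i := Y)) p"
    and "i < k \<Longrightarrow> (\<And>j. S j \<in> V) \<Longrightarrow> S i \<in> K \<Longrightarrow> \<alpha> S p = 0"
proof -
  note m = assms[unfolded multilinear_form_def]
  show "\<alpha> S p = \<alpha> S' p" if "\<And>i. i < k \<Longrightarrow> S i = S' i"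
    by (rule mp[OF spec[OF spec[OF conjunct1[OF m], of S], of S']]) (simp add: that)
  show "\<alpha> (S(i := \<lambda>q. a *\<^sub>R X q + b *\<^sub>R Y q)) p = a * \<alpha> (S(i := X)) p + b * \<alpha> (S(i := Y)) p"
    if "i < k" "\<And>j. S j \<in> V" "X \<in> V" "Y \<in> V"
    by (rule conjunct1[OF conjunct2[OF m], rule_format]) (rule that)+
  show "\<alpha> S p = 0" if "i < k" "\<And>j. S j \<in> V" "S i \<in> K"
    by (rule conjunct2[OF conjunct2[OF m], rule_format, of i]) (rule that)+
qed

text \<open>Each permutation is a bijection, so in each summand argument \<open>j\<close> fills
  exactly one slot, either of \<alpha> or, shifted by \<open>k\<close>, of \<beta>. Linearity and
  vanishing on \<open>K\<close> are inherited from that factor, while the other factor does not see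
  the argument.\<close>

lemma multilinear_form_wedge:
  assumes \<alpha>: "multilinear_form V K p k \<alpha>" and \<beta>: "multilinear_form V K p l \<beta>"
  shows "multilinear_form V K p (k + l) (wedge k l \<alpha> \<beta>)"
proof -
  let ?P = "{\<sigma>. \<sigma> permutes {..<k + l}}"
  let ?t = "\<lambda>\<sigma> S. \<alpha> (\<lambda>i. S (\<sigma> i)) p * \<beta> (\<lambda>i. S (\<sigma> (k + i))) p"
  have w: "wedge k l \<alpha> \<beta> S p = (\<Sum>\<sigma>\<in>?P. of_int (sign \<sigma>) * ?t \<sigma> S) / (fact k * fact l)" for S
    by (simp add: wedge_def mult.assoc)
  have indep: "?t \<sigma> S = ?t \<sigma> S'" if \<sigma>: "\<sigma> \<in> ?P" and S: "\<And>i. i < k + l \<Longrightarrow> S i = S' i" for \<sigma> S S'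
  proof -
    have \<sigma>': "\<sigma> i < k + l" if "i < k + l" for i
      using \<sigma> permutes_in_image[of \<sigma> "{..<k + l}" i] that by simp
    have "\<alpha> (\<lambda>i. S (\<sigma> i)) p = \<alpha> (\<lambda>i. S' (\<sigma> i)) p"
      by (rule multilinear_formD(1)[OF \<alpha>]) (rule S, rule \<sigma>', simp)
    moreover have "\<beta> (\<lambda>i. S (\<sigma> (k + i))) p = \<beta> (\<lambda>i. S' (\<sigma> (k + i))) p"
      by (rule multilinear_formD(1)[OF \<beta>]) (rule S, rule \<sigma>', simp)
    ultimately show ?thesis by simp
  qed
  have slot: "\<exists>i. i < k + l \<and> (\<forall>i'. \<sigma> i' = j \<longleftrightarrow> i' = i)"
    if \<sigma>: "\<sigma> \<in> ?P" and j: "j < k + l" for \<sigma> j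
  proof -
    have \<sigma>p: "\<sigma> permutes {..<k + l}" using \<sigma> by simp
    have "j \<in> \<sigma> ` {..<k + l}" using j permutes_image[OF \<sigma>p] by simp
    then obtain i where i: "i < k + l" "\<sigma> i = j" by auto
    have "\<sigma> i' = j \<longleftrightarrow> i' = i" for i'
      unfolding i(2)[symmetric] by (rule inj_eq[OF permutes_inj[OF \<sigma>p]])
    with i(1) show ?thesis by (intro exI[of _ i]) simp
  qed
  have lin: "?t \<sigma> (S(j := \<lambda>q. a *\<^sub>R X q + b *\<^sub>R Y q)) = a * ?t \<sigma> (S(j := X)) + b * ?t \<sigma> (S(j := Y))"
    if \<sigma>: "\<sigma> \<in> ?P" and j: "j < k + l" and V: "\<And>j. S j \<in> V" "X \<in> V" "Y \<in> V" for \<sigma> S j X Y a b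
  proof -
    from slot[OF \<sigma> j] obtain i where i: "i < k + l" and u: "\<forall>i'. \<sigma> i' = j \<longleftrightarrow> i' = i"
      by (elim exE conjE)
    show ?thesis
    proof (cases "i < k")
      case True
      have \<beta>eq: "(\<lambda>i'. (S(j := Z)) (\<sigma> (k + i'))) = (\<lambda>i'. S (\<sigma> (k + i')))" for Z
        using True by (simp add: fun_eq_iff u)
      have \<alpha>eq: "(\<lambda>i'. (S(j := Z)) (\<sigma> i')) = (\<lambda>i'. S (\<sigma> i'))(i := Z)" for Z
        by (simp add: fun_eq_iff u)
      show ?thesis unfolding \<alpha>eq \<beta>eq
        by (subst multilinear_formD(2)[OF \<alpha> True V(1) V(2,3)]) (simp add: algebra_simps)
    next
      case False
      then obtain m where m: "i = k + m" using le_Suc_ex not_less by blast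
      have ml: "m < l" using i m by simp
      have \<alpha>eq: "\<alpha> (\<lambda>i'. (S(j := Z)) (\<sigma> i')) p = \<alpha> (\<lambda>i'. S (\<sigma> i')) p" for Z
        by (rule multilinear_formD(1)[OF \<alpha>]) (simp add: u m)
      have \<beta>eq: "(\<lambda>i'. (S(j := Z)) (\<sigma> (k + i'))) = (\<lambda>i'. S (\<sigma> (k + i')))(m := Z)" for Z
        by (simp add: fun_eq_iff u m)
      show ?thesis unfolding \<alpha>eq \<beta>eq
        by (subst multilinear_formD(2)[OF \<beta> ml V(1) V(2,3)]) (simp add: algebra_simps)
    qed
  qed
  have kill: "?t \<sigma> S = 0" if \<sigma>: "\<sigma> \<in> ?P" and j: "j < k + l" and V: "\<And>j. S j \<in> V" "S j \<in> K" for \<sigma> S j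
  proof -
    from slot[OF \<sigma> j] obtain i where i: "i < k + l" "\<sigma> i = j" by auto
    show ?thesis
    proof (cases "i < k")
      case True
      have "\<alpha> (\<lambda>i. S (\<sigma> i)) p = 0"
        by (rule multilinear_formD(3)[OF \<alpha> True V(1)]) (use i V(2) in simp)
      then show ?thesis by simp
    next
      case False
      then obtain m where m: "i = k + m" using le_Suc_ex not_less by blast
      have "\<beta> (\<lambda>i. S (\<sigma> (k + i))) p = 0"
        by (rule multilinear_formD(3)[OF \<beta> _ V(1), of m]) (use i m V(2) in simp_all)
      then show ?thesis by simp
    qed
  qed
  show ?thesis unfolding multilinear_form_def
  proof (intro conjI allI impI)
    fix S S' :: "nat \<Rightarrow> 'a \<Rightarrow> 'b" assume S: "\<forall>i<k + l. S i = S' i"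
    have "(\<Sum>\<sigma>\<in>?P. of_int (sign \<sigma>) * ?t \<sigma> S) = (\<Sum>\<sigma>\<in>?P. of_int (sign \<sigma>) * ?t \<sigma> S')"
      by (rule sum.cong[OF refl], rule arg_cong, rule indep) (use S in simp_all)
    then show "wedge k l \<alpha> \<beta> S p = wedge k l \<alpha> \<beta> S' p" unfolding w by (rule arg_cong)
  next
    fix S :: "nat \<Rightarrow> 'a \<Rightarrow> 'b" and j X Y a b
    assume *: "j < k + l" "\<forall>j. S j \<in> V" "X \<in> V" "Y \<in> V"
    have "(\<Sum>\<sigma>\<in>?P. of_int (sign \<sigma>) * ?t \<sigma> (S(j := \<lambda>q. a *\<^sub>R X q + b *\<^sub>R Y q))) =
        (\<Sum>\<sigma>\<in>?P. a * (of_int (sign \<sigma>) * ?t \<sigma> (S(j := X))) + b * (of_int (sign \<sigma>) * ?t \<sigma> (S(j := Y))))"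
    proof (rule sum.cong[OF refl])
      fix \<sigma> assume \<sigma>: "\<sigma> \<in> ?P"
      show "of_int (sign \<sigma>) * ?t \<sigma> (S(j := \<lambda>q. a *\<^sub>R X q + b *\<^sub>R Y q)) =
        a * (of_int (sign \<sigma>) * ?t \<sigma> (S(j := X))) + b * (of_int (sign \<sigma>) * ?t \<sigma> (S(j := Y)))"
        unfolding lin[OF \<sigma> *(1) spec[OF *(2)] *(3,4)] by (simp only: algebra_simps)
    qed
    also have "\<dots> = a * (\<Sum>\<sigma>\<in>?P. of_int (sign \<sigma>) * ?t \<sigma> (S(j := X))) +
        b * (\<Sum>\<sigma>\<in>?P. of_int (sign \<sigma>) * ?t \<sigma> (S(j := Y)))"
      by (simp only: sum.distrib sum_distrib_left)
    finally show "wedge k l \<alpha> \<beta> (S(j := \<lambda>q. a *\<^sub>R X q + b *\<^sub>R Y q)) p =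
        a * wedge k l \<alpha> \<beta> (S(j := X)) p + b * wedge k l \<alpha> \<beta> (S(j := Y)) p"
      unfolding w by (simp only: add_divide_distrib times_divide_eq_right)
  next
    fix S :: "nat \<Rightarrow> 'a \<Rightarrow> 'b" and j assume *: "j < k + l" "\<forall>j. S j \<in> V" "S j \<in> K"
    have "(\<Sum>\<sigma>\<in>?P. of_int (sign \<sigma>) * ?t \<sigma> S) = 0"
    proof (rule sum.neutral, rule ballI)
      fix \<sigma> assume \<sigma>: "\<sigma> \<in> ?P"
      have "?t \<sigma> S = 0" by (rule kill[OF \<sigma> *(1)]) (use *(2,3) in simp_all)
      then show "of_int (sign \<sigma>) * ?t \<sigma> S = 0" by simp
    qed
    then show "wedge k l \<alpha> \<beta> S p = 0" unfolding w by simp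
  qed
qed

lemma multilinear_form_power:
  assumes "multilinear_form V K p 2 \<omega>"
  shows "multilinear_form V K p (2 * n) (two_form_power \<omega> n)"
proof (induction n)
  case 0
  show ?case by (simp add: multilinear_form_def)
next
  case (Suc n)
  show ?case using multilinear_form_wedge[OF assms Suc] by simp
qed

text \<open>The sum over all permutations is alternating for arbitrary \<alpha> and \<beta>:
  following a permutation by the transposition of \<open>i\<close> and \<open>j\<close> flips its
  sign and, as the two arguments agree, changes nothing else. The sum thus equals its
  negative.\<close>

lemma wedge_repeat:
  assumes "i < k + l" "j < k + l" "i \<noteq> j" "S i = S j"
  shows "wedge k l \<alpha> \<beta> S p = 0"
proof -
  let ?P = "{\<sigma>. \<sigma> permutes {..<k + l}}"
  let ?t = "\<lambda>\<sigma>. of_int (sign \<sigma>) * \<alpha> (\<lambda>i. S (\<sigma> i)) p * \<beta> (\<lambda>i. S (\<sigma> (k + i))) p"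
  let ?\<tau> = "Transposition.transpose i j"
  have \<tau>: "?\<tau> permutes {..<k + l}" using assms(1,2) by (intro permutes_swap_id) simp_all
  have S: "S (?\<tau> x) = S x" for x using assms(4) by (simp add: Transposition.transpose_def)
  have "sum ?t ?P = (\<Sum>\<sigma>\<in>?P. ?t (?\<tau> \<circ> \<sigma>))"
    by (rule setum_permutations_compose_left[OF \<tau>])
  also have "\<dots> = (\<Sum>\<sigma>\<in>?P. - ?t \<sigma>)"
  proof (rule sum.cong[OF refl])
    fix \<sigma> assume "\<sigma> \<in> ?P"
    then have "permutation \<sigma>" by (auto intro: permutation_permutes[THEN iffD2])
    then have "sign (?\<tau> \<circ> \<sigma>) = - sign \<sigma>"
      using assms(3) by (simp add: sign_compose permutation_swap_id sign_swap_id)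
    then show "?t (?\<tau> \<circ> \<sigma>) = - ?t \<sigma>" by (simp add: S)
  qed
  also have "\<dots> = - sum ?t ?P" by (rule sum_negf)
  finally have "sum ?t ?P = 0" by simp
  then show ?thesis by (simp add: wedge_def)
qed

text \<open>Linear dependence is a property of sets, whereas a relation between family members is
  wanted. A family with a repetition is therefore treated apart, with the relation
  \<open>y i - y j = 0\<close>.\<close>

lemma linear_relation:
  fixes y :: "nat \<Rightarrow> 'f::euclidean_space"
  assumes "DIM('f) < m"
  obtains c where "\<exists>i<m. c i \<noteq> 0" "(\<Sum>i<m. c i *\<^sub>R y i) = 0"
proof (cases "inj_on y {..<m}")
  case True
  have fin: "finite (y ` {..<m})" by simp
  have "dependent (y ` {..<m})"
    using assms by (intro dependent_biggerset) (simp add: card_image[OF True])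
  then obtain u where u: "\<exists>v\<in>y ` {..<m}. u v \<noteq> 0" "(\<Sum>v\<in>y ` {..<m}. u v *\<^sub>R v) = 0"
    unfolding dependent_finite[OF fin] by blast
  show ?thesis
  proof (rule that[of "\<lambda>i. u (y i)"])
    show "\<exists>i<m. u (y i) \<noteq> 0" using u(1) by auto
    show "(\<Sum>i<m. u (y i) *\<^sub>R y i) = 0" using u(2) by (simp add: sum.reindex[OF True])
  qed
next
  case False
  then obtain i j where ij: "i < m" "j < m" "i \<noteq> j" "y i = y j" by (auto simp: inj_on_def)
  let ?c = "\<lambda>k. (if k = i then 1 else 0) - (if k = j then 1 else 0 :: real)"
  have "(\<Sum>k<m. ?c k *\<^sub>R y k) = (\<Sum>k<m. (if k = i then y k else 0) - (if k = j then y k else 0))"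
    by (rule sum.cong) auto
  also have "\<dots> = y i - y j" unfolding sum_subtractf using ij by (simp add: sum.delta)
  finally have "(\<Sum>k<m. ?c k *\<^sub>R y k) = 0" using ij(4) by simp
  then show ?thesis using ij by (intro that[of ?c]) auto
qed

section \<open>Local frames of global sections\<close>

lemma (in smooth_mfd) open_nonzero:
  assumes f: "f \<in> C_infinity M"
  shows "open {q. f q \<noteq> (0::real)}"
proof (rule Topological_Spaces.openI)
  fix q assume q: "q \<in> {q. f q \<noteq> 0}"
  obtain U c where c: "(U, c) \<in> M" "q \<in> U" by (rule chart_at)
  note h = chart_homeomorphism[OF c(1)]
  have "smooth_on (c ` U) (\<lambda>x. f (inv_into U c x))"
    using smooth_fun_onD[OF C_infinityD[OF f, of UNIV] c(1)] by simp
  then have "C_k_on 0 (c ` U) (\<lambda>x. f (inv_into U c x))" unfolding smooth_on_def by (rule spec)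
  then have "continuous_on (c ` U) (\<lambda>x. f (inv_into U c x))" by simp
  from continuous_on_compose2[OF this homeomorphism_cont1[OF h(3)] subset_refl]
  have "continuous_on U f" by (rule continuous_on_eq) (use c in simp)
  from continuous_open_preimage[OF this h(1), of "- {0}"]
  have "open (U \<inter> f -` (- {0}))" by auto
  moreover have "q \<in> U \<inter> f -` (- {0})" "U \<inter> f -` (- {0}) \<subseteq> {q. f q \<noteq> 0}" using q c by auto
  ultimately show "\<exists>T. open T \<and> q \<in> T \<and> T \<subseteq> {q. f q \<noteq> 0}" by blast
qed

context smooth_vbundle begin

text \<open>Only the entries of \<open>e\<close> with index less than \<open>DIM('f)\<close> form the basis.\<close>

definition is_frame :: "'m \<Rightarrow> (nat \<Rightarrow> 'v) \<Rightarrow> bool" where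
  "is_frame q e \<longleftrightarrow> (\<forall>i. e i \<in> fibre A q) \<and>
     (\<forall>v\<in>fibre A q. \<exists>y. v = (\<Sum>i<DIM('f). y i *\<^sub>R e i)) \<and>
     (\<forall>y. (\<Sum>i<DIM('f). y i *\<^sub>R e i) = 0 \<longrightarrow> (\<forall>i<DIM('f). y i = 0))"

lemma is_frameD:
  assumes "is_frame q e"
  shows "e i \<in> fibre A q"
    and "v \<in> fibre A q \<Longrightarrow> \<exists>y. v = (\<Sum>i<DIM('f). y i *\<^sub>R e i)"
    and "(\<Sum>i<DIM('f). y i *\<^sub>R e i) = 0 \<Longrightarrow> \<forall>i<DIM('f). y i = 0"
  using assms by (simp_all add: is_frame_def)

text \<open>The frame must consist of global sections, since the axioms of the bracket, and with
  them all facts about \<open>ext_d1\<close>, concern those. A trivialising frame multiplied by a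
  bump function is global and remains a basis wherever the bump does not vanish.\<close>

lemma local_frame:
  obtains W e where "open W" "p \<in> W" "\<And>i. e i \<in> sections M A" "\<And>q. q \<in> W \<Longrightarrow> is_frame q (\<lambda>i. e i q)"
proof -
  obtain U \<phi> where U: "(U, \<phi>) \<in> trivs A" "p \<in> U" by (rule triv_at)
  obtain f where f: "bump f U" "f p \<noteq> 0" by (rule bump_exists[OF triv_props(1)[OF U(1)] U(2)])
  obtain b where "bij_betw b {0..<DIM('f)} (Basis :: 'f set)"
    using ex_bij_betw_nat_finite[OF finite_Basis] by blast
  then have b: "bij_betw b {..<DIM('f)} (Basis :: 'f set)" by (simp only: atLeast0LessThan)
  define W where "W = {q. f q \<noteq> 0}"
  have WU: "W \<subseteq> U" unfolding W_def using bump_outside[OF f(1)] by blast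
  show thesis
  proof (rule that[of W "\<lambda>i q. f q *\<^sub>R frame \<phi> (b i) q"])
    show "open W" unfolding W_def by (rule open_nonzero[OF bump_smooth[OF f(1)]])
    show "p \<in> W" using f(2) by (simp add: W_def)
    show e: "(\<lambda>q. f q *\<^sub>R frame \<phi> (b i) q) \<in> sections M A" for i
      by (rule sections_bump_frame[OF U(1) f(1)])
    fix q assume q: "q \<in> W"
    show "is_frame q (\<lambda>i. f q *\<^sub>R frame \<phi> (b i) q)"
      unfolding is_frame_def
    proof (intro conjI allI ballI impI)
      show "f q *\<^sub>R frame \<phi> (b i) q \<in> fibre A q" for i by (rule sectionsD(1)[OF e])
    next
      fix v assume v: "v \<in> fibre A q"
      have qU: "q \<in> U" using q WU by blast
      have fq: "f q \<noteq> 0" using q by (simp add: W_def)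
      have "fibrewise_linear (fibre A q) (\<lambda>v. v)" by (simp add: fibrewise_linear_def)
      from fibrewise_linear_frame[OF U(1) qU this v]
      have "v = (\<Sum>i\<in>Basis. (\<phi> q v \<bullet> i) *\<^sub>R frame \<phi> i q)" .
      also have "\<dots> = (\<Sum>k<DIM('f). (\<phi> q v \<bullet> b k) *\<^sub>R frame \<phi> (b k) q)"
        by (rule sum.reindex_bij_betw[OF b, symmetric])
      also have "\<dots> = (\<Sum>k<DIM('f). ((\<phi> q v \<bullet> b k) / f q) *\<^sub>R (f q *\<^sub>R frame \<phi> (b k) q))"
        by (rule sum.cong) (use fq in simp_all)
      finally show "\<exists>y. v = (\<Sum>i<DIM('f). y i *\<^sub>R (f q *\<^sub>R frame \<phi> (b i) q))"
        by (rule exI[of _ "\<lambda>k. (\<phi> q v \<bullet> b k) / f q"])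
    next
      fix y :: "nat \<Rightarrow> real" and j
      assume y: "(\<Sum>i<DIM('f). y i *\<^sub>R (f q *\<^sub>R frame \<phi> (b i) q)) = 0" and j: "j < DIM('f)"
      have qU: "q \<in> U" using q WU by blast
      have fq: "f q \<noteq> 0" using q by (simp add: W_def)
      note lin = frame_linear[OF U(1) qU]
      let ?w = "\<Sum>i<DIM('f). (y i * f q) *\<^sub>R b i"
      have "frame \<phi> ?w q = 0"
        using y by (simp add: linear_sum[OF lin] linear_scale[OF lin])
      then have w: "?w = 0"
        using frame_fibre(2)[OF U(1) qU, of ?w] fibrewise_linear_zero[OF triv_props(3)[OF U(1) qU] fibre_zero]
        by simp
      show "y j = 0"
      proof -
        have "(\<Sum>i<DIM('f). (y i * f q) * (b i \<bullet> b j)) = ?w \<bullet> b j" by (simp add: inner_sum_left)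
        also have "\<dots> = 0" unfolding w by simp
        also have "(\<Sum>i<DIM('f). (y i * f q) * (b i \<bullet> b j)) = (\<Sum>i<DIM('f). if i = j then y i * f q else 0)"
        proof (rule sum.cong[OF refl])
          fix i assume i: "i \<in> {..<DIM('f)}"
          have "b i \<in> Basis" "b j \<in> Basis" using b i j by (auto simp: bij_betw_def)
          moreover have "b i = b j \<longleftrightarrow> i = j" using b i j by (auto simp: bij_betw_def inj_on_def)
          ultimately show "(y i * f q) * (b i \<bullet> b j) = (if i = j then y i * f q else 0)"
            by (simp add: inner_Basis)
        qed
        also have "\<dots> = y j * f q" using j by simp
        finally show "y j = 0" using fq by simp
      qed
    qed
  qed
qed

lemma fibrewise_linear_sum:
  fixes k :: nat
  assumes h: "fibrewise_linear (fibre A q) h" and e: "\<And>i. e i \<in> fibre A q"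
  shows "h (\<Sum>i<k. y i *\<^sub>R e i) = (\<Sum>i<k. y i *\<^sub>R h (e i))"
proof (induction k)
  case 0
  show ?case using fibrewise_linear_zero[OF h fibre_zero] by simp
next
  case (Suc k)
  have "(\<Sum>i<k. y i *\<^sub>R e i) \<in> fibre A q"
    by (rule subspace_sum[OF fibre_subspace fibre_scale[OF e]])
  from fibrewise_linear_add[OF h this fibre_scale[OF e]] Suc
  show ?case by (simp add: fibrewise_linear_scale[OF h e])
qed

lemma sections_frameI:
  assumes a: "\<And>p. a p \<in> fibre A p"
    and loc: "\<And>p. \<exists>W e x d. open W \<and> p \<in> W \<and> (\<forall>i. e i \<in> sections M A) \<and>
      (\<forall>i<d. smooth_fun_on M W (x i)) \<and> (\<forall>q\<in>W. a q = (\<Sum>i<(d::nat). x i q *\<^sub>R e i q))"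
  shows "a \<in> sections M A"
proof (rule sections_localI[OF a])
  fix p
  from loc[of p] obtain W e x and d :: nat where W: "open W" "p \<in> W" and e: "\<forall>i. e i \<in> sections M A"
    and x: "\<forall>i<d. smooth_fun_on M W (x i)" and eq: "\<forall>q\<in>W. a q = (\<Sum>i<d. x i q *\<^sub>R e i q)"
    by (elim exE conjE)
  obtain U \<phi> where U: "(U, \<phi>) \<in> trivs A" "p \<in> U" by (rule triv_at)
  note o = open_Int[OF W(1) triv_props(1)[OF U(1)]]
  have "smooth_fun_on M (W \<inter> U) (\<lambda>q. \<Sum>i<d. x i q *\<^sub>R \<phi> q (e i q))"
  proof (rule smooth_fun_on_sum[OF o], rule smooth_fun_on_scaleR[OF o])
    fix i assume i: "i \<in> {..<d}"
    show "smooth_fun_on M (W \<inter> U) (x i)"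
      by (rule smooth_fun_on_subset[of W]) (use x i in auto)
    show "smooth_fun_on M (W \<inter> U) (\<lambda>q. \<phi> q (e i q))"
      by (rule smooth_fun_on_subset[OF sectionsD(2)[OF spec[OF e] U(1)]]) blast
  qed
  then have "smooth_fun_on M (W \<inter> U) (\<lambda>q. \<phi> q (a q))"
  proof (rule smooth_fun_on_cong[OF o, rotated])
    fix q assume q: "q \<in> W \<inter> U"
    then have qU: "q \<in> U" by blast
    have "\<phi> q (\<Sum>i<d. x i q *\<^sub>R e i q) = (\<Sum>i<d. x i q *\<^sub>R \<phi> q (e i q))"
      by (rule fibrewise_linear_sum[OF triv_props(3)[OF U(1) qU] sectionsD(1)[OF spec[OF e]]])
    moreover have "a q = (\<Sum>i<d. x i q *\<^sub>R e i q)" using eq q by blast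
    ultimately show "(\<Sum>i<d. x i q *\<^sub>R \<phi> q (e i q)) = \<phi> q (a q)" by simp
  qed
  then show "\<exists>U \<phi> W. (U, \<phi>) \<in> trivs A \<and> open W \<and> p \<in> W \<and> W \<subseteq> U \<and> smooth_fun_on M W (\<lambda>q. \<phi> q (a q))"
    using U o W(2) by (intro exI[of _ U] exI[of _ \<phi>] exI[of _ "W \<inter> U"]) simp
qed

text \<open>Connects the rank \<open>2 * n + 1\<close>, stated for the abstract fibres, with the
  size of the linear systems, which is the dimension of the model fibre.\<close>

lemma rank_eq_DIM: "dim (fibre A p) = DIM('f)"
proof -
  obtain U \<phi> where U: "(U, \<phi>) \<in> trivs A" "p \<in> U" by (rule triv_at)
  let ?h = "\<lambda>w. frame \<phi> w p"
  note lin = frame_linear[OF U]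
  have inj: "inj ?h" by (rule injI) (metis frame_fibre(2)[OF U])
  have im: "fibre A p = ?h ` UNIV"
  proof (intro equalityI subsetI)
    fix v assume "v \<in> fibre A p"
    then have "v = ?h (\<phi> p v)" by (rule frame_fibre(3)[OF U, symmetric])
    then show "v \<in> ?h ` UNIV" by (rule image_eqI) simp
  qed (use frame_fibre(1)[OF U] in auto)
  have "dim (fibre A p) = card (?h ` Basis)"
  proof (rule dim_eq_card)
    show "span (?h ` Basis) = span (fibre A p)"
      unfolding span_eq_iff[THEN iffD2, OF fibre_subspace]
      using linear_span_image[OF lin, of Basis] im by simp
    show "independent (?h ` Basis)"
      by (rule linear_independent_injective_image[OF lin independent_Basis]) (use inj in \<open>simp add: inj_on_def\<close>)
  qed
  also have "\<dots> = DIM('f)" by (rule card_image) (use inj in \<open>simp add: inj_on_def\<close>)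
  finally show ?thesis .
qed

end

section \<open>Contact Lie algebroids\<close>

locale contact_algd = lie_algd M A br \<rho>
  for M :: "('m::{t2_space,second_countable_topology}, 'e::real_inner) chart set"
    and A :: "('m, 'v::real_vector, 'f::euclidean_space) vbundle"
    and br :: "('m \<Rightarrow> 'v) \<Rightarrow> ('m \<Rightarrow> 'v) \<Rightarrow> 'm \<Rightarrow> 'v"
    and \<rho> :: "'m \<Rightarrow> 'v \<Rightarrow> ('m \<Rightarrow> real) \<Rightarrow> real" +
  fixes \<eta> :: "'m \<Rightarrow> 'v \<Rightarrow> real" and n :: nat
  assumes eta: "\<eta> \<in> dual_sections M A"
    and rank: "\<And>p. dim (fibre A p) = 2 * n + 1"
    and volume: "\<And>p. \<exists>S. (\<forall>i. S i \<in> sections M A) \<and> contact_volume br \<rho> \<eta> n S p \<noteq> 0"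
begin

abbreviation d\<eta> :: "('m \<Rightarrow> 'v) \<Rightarrow> ('m \<Rightarrow> 'v) \<Rightarrow> 'm \<Rightarrow> real" where
  "d\<eta> \<equiv> ext_d1 br \<rho> \<eta>"

lemma DIM_rank: "DIM('f) = 2 * n + 1"
  using rank_eq_DIM rank by metis

lemmas eta_linear = dual_sectionsD(1)[OF eta]
  and eta_smooth = dual_section_smooth[OF eta]

lemma eta_add: "S \<in> sections M A \<Longrightarrow> T \<in> sections M A \<Longrightarrow> \<eta> p (S p + T p) = \<eta> p (S p) + \<eta> p (T p)"
  by (rule fibrewise_linear_add[OF eta_linear sectionsD(1) sectionsD(1)])

lemma eta_scale: "S \<in> sections M A \<Longrightarrow> \<eta> p (r *\<^sub>R S p) = r * \<eta> p (S p)"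
  using fibrewise_linear_scale[OF eta_linear sectionsD(1)] by simp

lemma d\<eta>_smooth:
  assumes S: "S \<in> sections M A" and T: "T \<in> sections M A"
  shows "d\<eta> S T \<in> C_infinity M"
  unfolding ext_d1_def
  by (rule C_infinity_diff[OF C_infinity_diff[OF act_smooth[OF S eta_smooth[OF T]]
        act_smooth[OF T eta_smooth[OF S]]] eta_smooth[OF br_section[OF S T]]])

lemma d\<eta>_skew:
  assumes S: "S \<in> sections M A" and T: "T \<in> sections M A"
  shows "d\<eta> S T p = - d\<eta> T S p"
proof -
  have "br S T p = (-1) *\<^sub>R br T S p" using br_skew[OF S T] by simp
  then have "\<eta> p (br S T p) = - \<eta> p (br T S p)"
    using eta_scale[OF br_section[OF T S], of p "-1"] by simp
  then show ?thesis by (simp add: ext_d1_def)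
qed

lemma d\<eta>_add_right:
  assumes S: "S \<in> sections M A" and T: "T \<in> sections M A" and W: "W \<in> sections M A"
  shows "d\<eta> S (\<lambda>q. T q + W q) p = d\<eta> S T p + d\<eta> S W p"
proof -
  have e: "(\<lambda>q. \<eta> q (T q + W q)) = (\<lambda>q. \<eta> q (T q) + \<eta> q (W q))" by (rule ext) (rule eta_add[OF T W])
  show ?thesis
    unfolding ext_d1_def e br_add(1)[OF T W S] act_add[OF T W]
      act_add_fun[OF S eta_smooth[OF T] eta_smooth[OF W]]
      eta_add[OF br_section[OF S T] br_section[OF S W]] by simp
qed

text \<open>The derivative of \<open>f\<close> appears twice, from the product rule in \<rho>(S)
  \<cdot> \<eta>(f T) and from the Leibniz rule of the bracket; the two terms cancel.\<close>

lemma d\<eta>_mult_right: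
  assumes S: "S \<in> sections M A" and T: "T \<in> sections M A" and f: "f \<in> C_infinity M"
  shows "d\<eta> S (\<lambda>q. f q *\<^sub>R T q) p = f p * d\<eta> S T p"
proof -
  have e: "(\<lambda>q. \<eta> q (f q *\<^sub>R T q)) = (\<lambda>q. f q * \<eta> q (T q))" by (rule ext) (rule eta_scale[OF T])
  have "\<eta> p (f p *\<^sub>R br S T p + act \<rho> S f p *\<^sub>R T p) = f p * \<eta> p (br S T p) + act \<rho> S f p * \<eta> p (T p)"
    using eta_add[OF sections_scale[OF br_section[OF S T], of "f p"] sections_scale[OF T, of "act \<rho> S f p"], of p]
    by (simp add: eta_scale[OF br_section[OF S T]] eta_scale[OF T])
  then show ?thesis
    unfolding ext_d1_def e br_Leibniz[OF S T f] act_scale[OF T] act_mult_fun[OF S f eta_smooth[OF T]]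
    by (simp add: algebra_simps)
qed

lemma d\<eta>_add_left:
  assumes S: "S \<in> sections M A" and T: "T \<in> sections M A" and W: "W \<in> sections M A"
  shows "d\<eta> (\<lambda>q. T q + W q) S p = d\<eta> T S p + d\<eta> W S p"
  using d\<eta>_add_right[OF S T W, of p] d\<eta>_skew[OF sections_add[OF T W] S, of p]
    d\<eta>_skew[OF T S, of p] d\<eta>_skew[OF W S, of p] by linarith

lemma d\<eta>_mult_left:
  assumes S: "S \<in> sections M A" and T: "T \<in> sections M A" and f: "f \<in> C_infinity M"
  shows "d\<eta> (\<lambda>q. f q *\<^sub>R T q) S p = f p * d\<eta> T S p"
  unfolding d\<eta>_skew[OF sections_mult[OF f T] S, of p] d\<eta>_skew[OF T S, of p]
    d\<eta>_mult_right[OF S T f] by simp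

lemma d\<eta>_scale_left:
  "S \<in> sections M A \<Longrightarrow> T \<in> sections M A \<Longrightarrow> d\<eta> (\<lambda>q. r *\<^sub>R T q) S p = r * d\<eta> T S p"
  by (rule d\<eta>_mult_left[OF _ _ C_infinity_const])

section \<open>The pointwise two-form and its common kernel with \<eta>\<close>

lemma d\<eta>_vanish:
  assumes "S \<in> sections M A" "T \<in> sections M A" "S p = 0"
  shows "d\<eta> S T p = 0"
  by (rule tensorial[where \<Phi> = "\<lambda>S. d\<eta> S T p", OF d\<eta>_add_left[OF assms(2)]
        d\<eta>_mult_left[OF assms(2)] assms(1,3)])

lemma d\<eta>_cong_left:
  assumes S: "S \<in> sections M A" and S': "S' \<in> sections M A" and T: "T \<in> sections M A" and eq: "S p = S' p"
  shows "d\<eta> S T p = d\<eta> S' T p"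
proof -
  have "d\<eta> (\<lambda>q. S q + (-1) *\<^sub>R S' q) T p = 0"
    by (rule d\<eta>_vanish[OF sections_add[OF S sections_scale[OF S']] T]) (simp add: eq)
  then show ?thesis
    unfolding d\<eta>_add_left[OF T S sections_scale[OF S']] d\<eta>_scale_left[OF T S'] by simp
qed

lemma d\<eta>_cong:
  assumes S: "S \<in> sections M A" "S' \<in> sections M A" and T: "T \<in> sections M A" "T' \<in> sections M A"
    and eq: "S p = S' p" "T p = T' p"
  shows "d\<eta> S T p = d\<eta> S' T' p"
  using d\<eta>_cong_left[OF S T(1) eq(1)] d\<eta>_cong_left[OF T S(2) eq(2)]
    d\<eta>_skew[OF S(2) T(1), of p] d\<eta>_skew[OF S(2) T(2), of p] by simp

text \<open>The extending sections are arbitrary; \<open>d\<eta>_cong\<close> makes the value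
  independent of them. It is meaningful only for vectors of the fibre over \<open>p\<close>.\<close>

definition d\<eta>_at :: "'m \<Rightarrow> 'v \<Rightarrow> 'v \<Rightarrow> real" where
  "d\<eta>_at p v w = d\<eta> (SOME S. S \<in> sections M A \<and> S p = v) (SOME T. T \<in> sections M A \<and> T p = w) p"

lemma d\<eta>_at_eq:
  assumes S: "S \<in> sections M A" and T: "T \<in> sections M A"
  shows "d\<eta>_at p (S p) (T p) = d\<eta> S T p"
proof -
  have *: "(SOME S'. S' \<in> sections M A \<and> S' p = S p) \<in> sections M A \<and> (SOME S'. S' \<in> sections M A \<and> S' p = S p) p = S p"
    if "S \<in> sections M A" for S
    by (rule someI[of "\<lambda>S'. S' \<in> sections M A \<and> S' p = S p" S]) (use that in simp)
  show ?thesis unfolding d\<eta>_at_def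
    using *[OF S] *[OF T] by (intro d\<eta>_cong) (simp_all add: S T)
qed

text \<open>Nondegeneracy: the \<open>2n + 1\<close> sections with nonzero contact volume, together with \<open>X\<close>, satisfy
  a nontrivial linear relation at \<open>p\<close>, so a nontrivial combination of these sections lies in the
  common kernel of \<open>\<eta>\<close> and \<open>d\<eta>\<close>; inserting it into the volume form gives \<open>0\<close>.\<close>

lemma common_kernel_zero:
  assumes X: "X \<in> sections M A" and X0: "\<eta> p (X p) = 0" and X1: "\<And>T. T \<in> sections M A \<Longrightarrow> d\<eta> X T p = 0"
  shows "X p = 0"
proof (rule ccontr)
  assume Xp: "X p \<noteq> 0"
  let ?V = "sections M A"
  \<comment> \<open>The sections that annihilate \<eta> and d\<eta> at \<open>p\<close>. Every
    factor of the contact volume vanishes once such a section is inserted, hence so does the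
    volume.\<close>
  define K where "K = {X \<in> ?V. \<eta> p (X p) = 0 \<and> (\<forall>T\<in>?V. d\<eta> X T p = 0)}"
  let ?\<eta> = "\<lambda>S p. \<eta> p (S (0::nat) p)" and ?\<omega> = "\<lambda>S. d\<eta> (S (0::nat)) (S 1)"
  let ?vol = "\<lambda>S. contact_volume br \<rho> \<eta> n S p"
  have lin: "\<eta> p (a *\<^sub>R X p + b *\<^sub>R Y p) = a * \<eta> p (X p) + b * \<eta> p (Y p)"
    if "X \<in> ?V" "Y \<in> ?V" for X Y a b
    using eta_add[OF sections_scale[OF that(1), of a] sections_scale[OF that(2), of b], of p]
    by (simp add: eta_scale that)
  have dlin: "d\<eta> (\<lambda>q. a *\<^sub>R X q + b *\<^sub>R Y q) T p = a * d\<eta> X T p + b * d\<eta> Y T p"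
    if "X \<in> ?V" "Y \<in> ?V" "T \<in> ?V" for X Y T a b
    unfolding d\<eta>_add_left[OF that(3) sections_scale[OF that(1)] sections_scale[OF that(2)]]
      d\<eta>_scale_left[OF that(3,1)] d\<eta>_scale_left[OF that(3,2)] by (rule refl)
  have comb: "(\<lambda>q. a *\<^sub>R X q + b *\<^sub>R Y q) \<in> ?V" if "X \<in> ?V" "Y \<in> ?V" for X Y a b
    by (rule sections_add[OF sections_scale[OF that(1)] sections_scale[OF that(2)]])
  have m1: "multilinear_form ?V K p 1 ?\<eta>"
    unfolding multilinear_form_def using lin by (auto simp: K_def)
  have m2: "multilinear_form ?V K p 2 ?\<omega>"
    unfolding multilinear_form_def
  proof (intro conjI allI impI)
    fix S :: "nat \<Rightarrow> 'm \<Rightarrow> 'v" and i X Y a b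
    assume i: "i < (2::nat)" and S: "\<forall>j. S j \<in> ?V" and X: "X \<in> ?V" and Y: "Y \<in> ?V"
    have S0: "S 0 \<in> ?V" and S1: "S 1 \<in> ?V" using S by blast+
    consider "i = 0" | "i = 1" using i by linarith
    then show "?\<omega> (S(i := \<lambda>q. a *\<^sub>R X q + b *\<^sub>R Y q)) p = a * ?\<omega> (S(i := X)) p + b * ?\<omega> (S(i := Y)) p"
    proof cases
      case 1
      then show ?thesis using dlin[OF X Y S1, of a b] by simp
    next
      case 2
      then show ?thesis
        using dlin[OF X Y S0, of a b] d\<eta>_skew[OF S0 comb[OF X Y], of a b p] d\<eta>_skew[OF S0 X, of p]
          d\<eta>_skew[OF S0 Y, of p] by simp
    qed
  next
    fix S :: "nat \<Rightarrow> 'm \<Rightarrow> 'v" and i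
    assume i: "i < (2::nat)" and S: "\<forall>j. S j \<in> ?V" and K: "S i \<in> K"
    have S0: "S 0 \<in> ?V" and S1: "S 1 \<in> ?V" using S by blast+
    have i2: "i = 0 \<or> i = 1" using i by linarith
    have "d\<eta> (S i) T p = 0" if "T \<in> ?V" for T using K that by (simp add: K_def)
    then show "?\<omega> S p = 0" using i2 d\<eta>_skew[OF S0 S1, of p] S0 S1 by auto
  qed simp
  have m: "multilinear_form ?V K p (1 + 2 * n) (contact_volume br \<rho> \<eta> n)"
    unfolding contact_volume_def by (rule multilinear_form_wedge[OF m1 multilinear_form_power[OF m2]])
  obtain S where S: "\<And>i. S i \<in> ?V" and vol: "?vol S \<noteq> 0" using volume[of p] by blast
  obtain U \<phi> where U: "(U, \<phi>) \<in> trivs A" "p \<in> U" by (rule triv_at)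
  define N where "N = 1 + 2 * n"
  \<comment> \<open>The \<open>N\<close> sections of the volume, with \<open>X\<close> appended as
    entry \<open>N\<close>: one vector more than the rank.\<close>
  let ?y = "\<lambda>i. \<phi> p (if i < N then S i p else X p)"
  have "DIM('f) < Suc N" using DIM_rank by (simp add: N_def)
  then obtain c where c: "\<exists>i<Suc N. c i \<noteq> 0" "(\<Sum>i<Suc N. c i *\<^sub>R ?y i) = 0"
    using linear_relation[of "Suc N" ?y] by blast
  note fl = frame_linear[OF U]
  have "(\<Sum>i<Suc N. c i *\<^sub>R frame \<phi> (?y i) p) = frame \<phi> (\<Sum>i<Suc N. c i *\<^sub>R ?y i) p"
    by (simp only: linear_sum[OF fl] linear_scale[OF fl])
  also have "\<dots> = 0" unfolding c(2) by (rule linear_0[OF fl])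
  finally have "(\<Sum>i<Suc N. c i *\<^sub>R (if i < N then S i p else X p)) = 0"
    using frame_fibre(3)[OF U] sectionsD(1)[OF S] sectionsD(1)[OF X] by (simp add: if_distrib cong: if_cong)
  then have rel: "(\<Sum>i<N. c i *\<^sub>R S i p) + c N *\<^sub>R X p = 0" by simp
  \<comment> \<open>Were \<open>c N\<close> the only nonzero coefficient, the relation would say
    that a nonzero multiple of \<open>X p\<close> is 0.\<close>
  have "\<exists>k<N. c k \<noteq> 0"
  proof (rule ccontr)
    assume "\<not> ?thesis"
    then have c0: "\<And>k. k < N \<Longrightarrow> c k = 0" by blast
    then have "c N *\<^sub>R X p = 0" using rel by simp
    then have "c N = 0" using Xp by simp
    then show False using c(1) c0 by (auto simp: less_Suc_eq)
  qed
  then obtain k where k: "k < N" "c k \<noteq> 0" by blast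
  define u where "u I q = (\<Sum>i\<in>I. c i *\<^sub>R S i q)" for I q
  have uV: "u I \<in> ?V" for I unfolding u_def by (rule sections_sum[OF sections_scale[OF S]])
  have up: "u {..<N} p = (- c N) *\<^sub>R X p" using rel by (simp add: u_def eq_neg_iff_add_eq_0)
  \<comment> \<open>The combination agrees with a multiple of \<open>X\<close> at the point
    \<open>p\<close> only; as d\<eta> depends on values at \<open>p\<close>, this suffices.\<close>
  have "u {..<N} \<in> K" unfolding K_def
  proof (intro CollectI conjI ballI)
    show "u {..<N} \<in> ?V" by (rule uV)
    show "\<eta> p (u {..<N} p) = 0" unfolding up eta_scale[OF X] X0 by simp
    show "d\<eta> (u {..<N}) T p = 0" if T: "T \<in> ?V" for T
      unfolding d\<eta>_cong_left[OF uV sections_scale[OF X] T up] d\<eta>_scale_left[OF T X] X1[OF T] by simp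
  qed
  moreover have "(S(k := u {..<N})) j \<in> ?V" for j using S uV by simp
  ultimately have F0: "?vol (S(k := u {..<N})) = 0"
    by (intro multilinear_formD(3)[OF m, of k]) (use k(1) in \<open>simp_all add: N_def\<close>)
  define F where "F Z = ?vol (S(k := Z))" for Z
  have Fadd: "F (\<lambda>q. a *\<^sub>R Y q + b *\<^sub>R Z q) = a * F Y + b * F Z" if "Y \<in> ?V" "Z \<in> ?V" for a b Y Z
    unfolding F_def by (rule multilinear_formD(2)[OF m k(1)[unfolded N_def] S that])
  have F: "F (u I) = (\<Sum>i\<in>I. c i * F (S i))" if "finite I" for I
    using that
  proof (induction I)
    case empty
    have "u {} = (\<lambda>q. 0 *\<^sub>R X q + 0 *\<^sub>R X q)" by (simp add: u_def fun_eq_iff)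
    then show ?case using Fadd[OF X X, of 0 0] by simp
  next
    case (insert i I)
    have "u (insert i I) = (\<lambda>q. c i *\<^sub>R S i q + 1 *\<^sub>R u I q)"
      using insert.hyps by (simp add: u_def fun_eq_iff)
    then show ?case using Fadd[OF S uV, of "c i" i 1 I] insert by simp
  qed
  \<comment> \<open>Slot \<open>k\<close> is expanded by linearity. A term with
    \<open>i \<noteq> k\<close> has \<open>S i\<close> both in slot \<open>i\<close> and in slot
    \<open>k\<close> and vanishes, so only the multiple \<open>c k\<close> of the original volume is
    left.\<close>
  have "(\<Sum>i<N. c i * F (S i)) = (\<Sum>i<N. if i = k then c k * ?vol S else 0)"
  proof (rule sum.cong[OF refl])
    fix i assume i: "i \<in> {..<N}"
    show "c i * F (S i) = (if i = k then c k * ?vol S else 0)"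
    proof (cases "i = k")
      case False
      have "F (S i) = 0" unfolding F_def contact_volume_def
        by (rule wedge_repeat[of i _ _ k]) (use i k(1) False in \<open>simp_all add: N_def\<close>)
      then show ?thesis using False by simp
    qed (simp add: F_def)
  qed
  then have "c k * ?vol S = 0" using F[of "{..<N}"] F0 k(1) by (simp add: F_def)
  then show False using k(2) vol by simp
qed

end

context contact_algd begin

lemma d\<eta>_at_skew:
  assumes "v \<in> fibre A p" "w \<in> fibre A p"
  shows "d\<eta>_at p v w = - d\<eta>_at p w v"
proof -
  obtain S where S: "S \<in> sections M A" "S p = v" by (rule section_through[OF assms(1)])
  obtain T where T: "T \<in> sections M A" "T p = w" by (rule section_through[OF assms(2)])
  show ?thesis
    using d\<eta>_skew[OF S(1) T(1), of p] d\<eta>_at_eq[OF S(1) T(1), of p] d\<eta>_at_eq[OF T(1) S(1), of p] S(2) T(2)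
    by simp
qed

lemma d\<eta>_at_linear_left:
  assumes w: "w \<in> fibre A p"
  shows "fibrewise_linear (fibre A p) (\<lambda>v. d\<eta>_at p v w)"
proof -
  obtain T where T: "T \<in> sections M A" "T p = w" by (rule section_through[OF w])
  show ?thesis unfolding fibrewise_linear_def
  proof (intro conjI ballI allI)
    fix u v assume uv: "u \<in> fibre A p" "v \<in> fibre A p"
    obtain X where X: "X \<in> sections M A" "X p = u" by (rule section_through[OF uv(1)])
    obtain Y where Y: "Y \<in> sections M A" "Y p = v" by (rule section_through[OF uv(2)])
    show "d\<eta>_at p (u + v) w = d\<eta>_at p u w + d\<eta>_at p v w"
      using d\<eta>_at_eq[OF sections_add[OF X(1) Y(1)] T(1), of p] d\<eta>_at_eq[OF X(1) T(1), of p]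
        d\<eta>_at_eq[OF Y(1) T(1), of p] d\<eta>_add_left[OF T(1) X(1) Y(1), of p] X(2) Y(2) T(2) by simp
  next
    fix r v assume v: "v \<in> fibre A p"
    obtain X where X: "X \<in> sections M A" "X p = v" by (rule section_through[OF v])
    show "d\<eta>_at p (r *\<^sub>R v) w = r *\<^sub>R d\<eta>_at p v w"
      using d\<eta>_at_eq[OF sections_scale[OF X(1), of r] T(1), of p] d\<eta>_at_eq[OF X(1) T(1), of p]
        d\<eta>_scale_left[OF T(1) X(1), where r = r and p = p] X(2) T(2) by simp
  qed
qed

lemma d\<eta>_at_linear_right:
  assumes w: "w \<in> fibre A p"
  shows "fibrewise_linear (fibre A p) (d\<eta>_at p w)"
proof -
  note lin = d\<eta>_at_linear_left[OF w]
  show ?thesis unfolding fibrewise_linear_def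
  proof (intro conjI ballI allI)
    show "d\<eta>_at p w (u + v) = d\<eta>_at p w u + d\<eta>_at p w v" if "u \<in> fibre A p" "v \<in> fibre A p" for u v
      using fibrewise_linear_add[OF lin that] d\<eta>_at_skew[OF w fibre_add[OF that]] d\<eta>_at_skew[OF w that(1)]
        d\<eta>_at_skew[OF w that(2)] by simp
    show "d\<eta>_at p w (r *\<^sub>R v) = r *\<^sub>R d\<eta>_at p w v" if "v \<in> fibre A p" for r v
      using fibrewise_linear_scale[OF lin that] d\<eta>_at_skew[OF w fibre_scale[OF that]] d\<eta>_at_skew[OF w that]
      by simp
  qed
qed

lemma d\<eta>_at_kernel:
  assumes v: "v \<in> fibre A p" "\<eta> p v = 0" and z: "\<And>w. w \<in> fibre A p \<Longrightarrow> d\<eta>_at p v w = 0"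
  shows "v = 0"
proof -
  obtain S where S: "S \<in> sections M A" "S p = v" by (rule section_through[OF v(1)])
  have "d\<eta> S T p = 0" if T: "T \<in> sections M A" for T
    using z[OF sectionsD(1)[OF T]] d\<eta>_at_eq[OF S(1) T, of p] S(2) by simp
  from common_kernel_zero[OF S(1) _ this] show ?thesis using S(2) v(2) by simp
qed

text \<open>The bilinear form \<open>\<eta> \<otimes> \<eta> + d\<eta>\<close> is nondegenerate, and turns the defining equations of the Reeb
  section and of the Hamiltonian sections into linear systems with a unique solution.\<close>

definition L :: "'m \<Rightarrow> 'v \<Rightarrow> 'v \<Rightarrow> real" where
  "L p v w = d\<eta>_at p v w + \<eta> p v * \<eta> p w"

lemma L_eq: "S \<in> sections M A \<Longrightarrow> T \<in> sections M A \<Longrightarrow> L p (S p) (T p) = d\<eta> S T p + \<eta> p (S p) * \<eta> p (T p)"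
  by (simp add: L_def d\<eta>_at_eq)

lemma L_linear_left:
  assumes w: "w \<in> fibre A p"
  shows "fibrewise_linear (fibre A p) (\<lambda>v. L p v w)"
  unfolding fibrewise_linear_def L_def
  by (auto simp: fibrewise_linear_add[OF d\<eta>_at_linear_left[OF w]] fibrewise_linear_add[OF eta_linear]
      fibrewise_linear_scale[OF d\<eta>_at_linear_left[OF w]] fibrewise_linear_scale[OF eta_linear] algebra_simps)

lemma L_linear_right:
  assumes w: "w \<in> fibre A p"
  shows "fibrewise_linear (fibre A p) (L p w)"
  unfolding fibrewise_linear_def L_def
  by (auto simp: fibrewise_linear_add[OF d\<eta>_at_linear_right[OF w]] fibrewise_linear_add[OF eta_linear]
      fibrewise_linear_scale[OF d\<eta>_at_linear_right[OF w]] fibrewise_linear_scale[OF eta_linear] algebra_simps)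

text \<open>On the pair (v, v) the skew part drops out and leaves the square of \<eta>(v). Thus
  \<eta>(v) = 0, the product term disappears for every \<open>w\<close>, and \<open>v\<close> lies
  in the common kernel.\<close>

lemma L_nondegenerate:
  assumes v: "v \<in> fibre A p" and z: "\<And>w. w \<in> fibre A p \<Longrightarrow> L p v w = 0"
  shows "v = 0"
proof -
  have "d\<eta>_at p v v = 0" using d\<eta>_at_skew[OF v v] by simp
  then have e: "\<eta> p v = 0" using z[OF v] by (simp add: L_def)
  then have "d\<eta>_at p v w = 0" if "w \<in> fibre A p" for w using z[OF that] by (simp add: L_def)
  then show ?thesis by (rule d\<eta>_at_kernel[OF v e])
qed

lemma frame_test:
  fixes h :: "'v \<Rightarrow> real"
  assumes h: "fibrewise_linear (fibre A q) h" and e: "is_frame q e" and v: "v \<in> fibre A q"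
    and z: "\<And>j. j < DIM('f) \<Longrightarrow> h (e j) = 0"
  shows "h v = 0"
proof -
  obtain y where "v = (\<Sum>i<DIM('f). y i *\<^sub>R e i)" using is_frameD(2)[OF e v] by blast
  then show ?thesis using z by (simp add: fibrewise_linear_sum[OF h is_frameD(1)[OF e]])
qed

lemma L_sum_left:
  assumes "\<And>i. e i \<in> fibre A q" "w \<in> fibre A q"
  shows "L q (\<Sum>i<k. y i *\<^sub>R e i) w = (\<Sum>i<(k::nat). y i * L q (e i) w)"
  using fibrewise_linear_sum[OF L_linear_left[OF assms(2)], where e = e and k = k and y = y] assms(1) by simp

text \<open>Nondegeneracy of \<open>L\<close> in matrix form, as the results on linear systems
  require it.\<close>

lemma frame_L_injective:
  fixes y :: "nat \<Rightarrow> real"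
  assumes e: "is_frame q e"
    and y: "\<forall>j<DIM('f). (\<Sum>i<DIM('f). y i * L q (e i) (e j)) = 0"
  shows "\<forall>i<DIM('f). y i = 0"
proof (rule is_frameD(3)[OF e], rule L_nondegenerate)
  let ?v = "\<Sum>i<DIM('f). y i *\<^sub>R e i"
  note ef = is_frameD(1)[OF e]
  show v: "?v \<in> fibre A q" by (rule subspace_sum[OF fibre_subspace fibre_scale[OF ef]])
  fix w assume w: "w \<in> fibre A q"
  show "L q ?v w = 0"
    by (rule frame_test[OF L_linear_right[OF v] e w]) (use y in \<open>simp add: L_sum_left[OF ef ef]\<close>)
qed

text \<open>In a local frame the coefficients of \<open>a\<close> solve a linear system with matrix
  L(e_i, e_j) and right-hand side L(a, e_j), all smooth, so Cramer's rule makes them smooth although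
  \<open>a\<close> was chosen pointwise.\<close>

lemma section_of_smooth_system:
  assumes a: "\<And>p. a p \<in> fibre A p"
    and smooth: "\<And>T. T \<in> sections M A \<Longrightarrow> (\<lambda>p. L p (a p) (T p)) \<in> C_infinity M"
  shows "a \<in> sections M A"
proof (rule sections_frameI[OF a])
  fix p
  obtain W e where W: "open W" "p \<in> W" and e: "\<And>i. e i \<in> sections M A"
    and fr: "\<And>q. q \<in> W \<Longrightarrow> is_frame q (\<lambda>i. e i q)"
    by (rule local_frame[of p]) blast
  note ef = sectionsD(1)[OF e]
  \<comment> \<open>Coefficients chosen separately at each point; outside \<open>W\<close>, where
    the frame may fail to span, they are irrelevant.\<close>
  define x where "x i q = (SOME y. a q = (\<Sum>i<DIM('f). y i *\<^sub>R e i q)) i" for i q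
  have x: "a q = (\<Sum>i<DIM('f). x i q *\<^sub>R e i q)" if "q \<in> W" for q
    unfolding x_def by (rule someI_ex[OF is_frameD(2)[OF fr[OF that] a]])
  have "smooth_fun_on M W (x k)" if k: "k < DIM('f)" for k
  proof (rule smooth_linear_solution[OF W(1), of "DIM('f)" "\<lambda>i j q. L q (e i q) (e j q)" "\<lambda>j q. L q (a q) (e j q)"])
    show "smooth_fun_on M W (\<lambda>q. L q (e i q) (e j q))" for i j
      unfolding L_eq[OF e e]
      by (rule C_infinityD[OF C_infinity_add[OF d\<eta>_smooth[OF e e] C_infinity_mult[OF eta_smooth[OF e] eta_smooth[OF e]]]])
    show "smooth_fun_on M W (\<lambda>q. L q (a q) (e j q))" for j
      by (rule C_infinityD[OF smooth[OF e]])
    show "(\<Sum>i<DIM('f). x i q * L q (e i q) (e j q)) = L q (a q) (e j q)" if "q \<in> W" for q j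
      unfolding x[OF that] by (rule L_sum_left[OF ef ef, symmetric])
    show "\<forall>i<DIM('f). y i = 0"
      if "q \<in> W" "\<forall>j<DIM('f). (\<Sum>i<DIM('f). y i * L q (e i q) (e j q)) = 0" for q and y :: "nat \<Rightarrow> real"
      by (rule frame_L_injective[OF fr[OF that(1)] that(2)])
  qed (rule k)
  then show "\<exists>W e x d. open W \<and> p \<in> W \<and> (\<forall>i. e i \<in> sections M A) \<and>
      (\<forall>i<d. smooth_fun_on M W (x i)) \<and> (\<forall>q\<in>W. a q = (\<Sum>i<(d::nat). x i q *\<^sub>R e i q))"
    using W e x by (intro exI[of _ W] exI[of _ e] exI[of _ x] exI[of _ "DIM('f)"]) simp
qed

text \<open>The rank is odd, so \<open>d\<eta>\<close> is degenerate at every point.\<close>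

lemma reeb_vector_exists:
  "\<exists>v. v \<in> fibre A p \<and> \<eta> p v = 1 \<and> (\<forall>w\<in>fibre A p. d\<eta>_at p v w = 0)"
proof -
  obtain W e where W: "p \<in> W" and e: "\<And>i. e i \<in> sections M A"
    and fr: "\<And>q. q \<in> W \<Longrightarrow> is_frame q (\<lambda>i. e i q)"
    by (rule local_frame[of p]) blast
  note ef = sectionsD(1)[OF e, of _ p]
  have "odd DIM('f)" using DIM_rank by simp
  from odd_skew_kernel[of _ "\<lambda>i j. d\<eta>_at p (e i p) (e j p)", OF this d\<eta>_at_skew[OF ef ef]]
  obtain y where y: "\<exists>i<DIM('f). y i \<noteq> 0"
    "\<And>j. j < DIM('f) \<Longrightarrow> (\<Sum>i<DIM('f). y i * d\<eta>_at p (e i p) (e j p)) = 0"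
    by blast
  define v where "v = (\<Sum>i<DIM('f). y i *\<^sub>R e i p)"
  have v: "v \<in> fibre A p" unfolding v_def by (rule subspace_sum[OF fibre_subspace fibre_scale[OF ef]])
  have v0: "v \<noteq> 0" using is_frameD(3)[OF fr[OF W], of y] y(1) unfolding v_def by blast
  have z: "d\<eta>_at p v w = 0" if w: "w \<in> fibre A p" for w
  proof (rule frame_test[OF d\<eta>_at_linear_right[OF v] fr[OF W] w])
    fix j assume "j < DIM('f)"
    then show "d\<eta>_at p v (e j p) = 0"
      unfolding v_def
      using y(2) fibrewise_linear_sum[OF d\<eta>_at_linear_left[OF ef[of j]] ef, where k = "DIM('f)" and y = y]
      by simp
  qed
  \<comment> \<open>A kernel vector of d\<eta> that also annihilated \<eta> would be 0. So \<eta>(v)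
    can be normalised to 1.\<close>
  have ev: "\<eta> p v \<noteq> 0" using d\<eta>_at_kernel[OF v _ z] v0 by blast
  let ?v = "(1 / \<eta> p v) *\<^sub>R v"
  show ?thesis
  proof (intro exI[of _ ?v] conjI ballI)
    show "?v \<in> fibre A p" by (rule fibre_scale[OF v])
    show "\<eta> p ?v = 1" using ev by (simp add: fibrewise_linear_scale[OF eta_linear v])
    show "d\<eta>_at p ?v w = 0" if w: "w \<in> fibre A p" for w
      by (simp add: fibrewise_linear_scale[OF d\<eta>_at_linear_left[OF w] v] z[OF w])
  qed
qed

section \<open>The Reeb section\<close>

definition is_reeb :: "('m \<Rightarrow> 'v) \<Rightarrow> bool" where
  "is_reeb \<xi> \<longleftrightarrow> \<xi> \<in> sections M A \<and> (\<forall>p. \<eta> p (\<xi> p) = 1) \<and> (\<forall>T\<in>sections M A. \<forall>p. d\<eta> \<xi> T p = 0)"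

lemma is_reeb_exists: "\<exists>\<xi>. is_reeb \<xi>"
proof -
  obtain \<xi> where \<xi>: "\<And>p. \<xi> p \<in> fibre A p" "\<And>p. \<eta> p (\<xi> p) = 1"
    "\<And>p w. w \<in> fibre A p \<Longrightarrow> d\<eta>_at p (\<xi> p) w = 0"
  proof -
    have "\<forall>p. \<exists>v. v \<in> fibre A p \<and> \<eta> p v = 1 \<and> (\<forall>w\<in>fibre A p. d\<eta>_at p v w = 0)"
      by (rule allI) (rule reeb_vector_exists)
    from choice[OF this] obtain \<xi> where
      "\<forall>p. \<xi> p \<in> fibre A p \<and> \<eta> p (\<xi> p) = 1 \<and> (\<forall>w\<in>fibre A p. d\<eta>_at p (\<xi> p) w = 0)" by (elim exE)
    then show thesis by (intro that[of \<xi>]) simp_all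
  qed
  have "\<xi> \<in> sections M A"
  proof (rule section_of_smooth_system[OF \<xi>(1)])
    fix T assume T: "T \<in> sections M A"
    \<comment> \<open>The pointwise Reeb vectors solve the system whose right-hand side is \<eta>
      itself, which is smooth on sections.\<close>
    have "L p (\<xi> p) (T p) = \<eta> p (T p)" for p
      by (simp add: L_def \<xi>(2) \<xi>(3)[OF sectionsD(1)[OF T]])
    then show "(\<lambda>p. L p (\<xi> p) (T p)) \<in> C_infinity M" using eta_smooth[OF T] by simp
  qed
  moreover from this have "d\<eta> \<xi> T p = 0" if T: "T \<in> sections M A" for T p
    using d\<eta>_at_eq[OF _ T, of \<xi> p] \<xi>(3)[OF sectionsD(1)[OF T]] by simp
  ultimately show ?thesis using \<xi>(2) unfolding is_reeb_def by blast
qed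

text \<open>The difference lies in the common kernel of \<eta> and d\<eta>. This is the uniqueness
  behind both definite descriptions.\<close>

lemma sections_eqI:
  assumes S: "S \<in> sections M A" and T: "T \<in> sections M A"
    and \<eta>: "\<And>p. \<eta> p (S p) = \<eta> p (T p)"
    and d: "\<And>X p. X \<in> sections M A \<Longrightarrow> d\<eta> S X p = d\<eta> T X p"
  shows "S = T"
proof
  fix p
  let ?D = "\<lambda>q. S q + (-1) *\<^sub>R T q"
  note T' = sections_scale[OF T, of "-1"]
  have "?D p = 0"
  proof (rule common_kernel_zero[OF sections_add[OF S T']])
    show "\<eta> p (?D p) = 0" unfolding eta_add[OF S T'] eta_scale[OF T] by (simp add: \<eta>)
    show "d\<eta> ?D X p = 0" if X: "X \<in> sections M A" for X
      unfolding d\<eta>_add_left[OF X S T'] d\<eta>_scale_left[OF X T] by (simp add: d[OF X])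
  qed
  then show "S p = T p" by simp
qed

lemma reeb_section_is_reeb: "is_reeb (reeb_section M A br \<rho> \<eta>)"
proof -
  obtain \<xi> where \<xi>: "is_reeb \<xi>" using is_reeb_exists by blast
  have "\<zeta> = \<xi>" if "is_reeb \<zeta>" for \<zeta>
    by (rule sections_eqI) (use that \<xi> in \<open>auto simp: is_reeb_def\<close>)
  with \<xi> have "is_reeb (THE \<xi>. is_reeb \<xi>)" by (rule theI)
  then show ?thesis unfolding reeb_section_def is_reeb_def .
qed

text \<open>The Hamiltonian equation without its Reeb term; it agrees with the defining condition of
  \<open>hamiltonian_section\<close> once the anchor kills the Reeb section.\<close>

definition is_hamiltonian :: "('m \<Rightarrow> real) \<Rightarrow> ('m \<Rightarrow> 'v) \<Rightarrow> bool" where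
  "is_hamiltonian f a \<longleftrightarrow> a \<in> sections M A \<and> (\<forall>p. \<eta> p (a p) = 0) \<and>
     (\<forall>T\<in>sections M A. \<forall>p. act \<rho> T f p = d\<eta> a T p)"

end

section \<open>Hamiltonian sections when the anchor kills the Reeb section\<close>

locale reeb_trivial_contact_algd = contact_algd M A br \<rho> \<eta> n
  for M :: "('m::{t2_space,second_countable_topology}, 'e::real_inner) chart set"
    and A :: "('m, 'v::real_vector, 'f::euclidean_space) vbundle"
    and br :: "('m \<Rightarrow> 'v) \<Rightarrow> ('m \<Rightarrow> 'v) \<Rightarrow> 'm \<Rightarrow> 'v"
    and \<rho> :: "'m \<Rightarrow> 'v \<Rightarrow> ('m \<Rightarrow> real) \<Rightarrow> real"
    and \<eta> :: "'m \<Rightarrow> 'v \<Rightarrow> real" and n :: nat +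
  assumes reeb: "\<And>p. \<rho> p (reeb_section M A br \<rho> \<eta> p) = 0"
begin

abbreviation ham :: "('m \<Rightarrow> real) \<Rightarrow> 'm \<Rightarrow> 'v" where
  "ham \<equiv> hamiltonian_section M A br \<rho> \<eta>"

text \<open>The system L(v, .) = df is solved first. Tested on \<xi>, its right-hand side
  \<rho>(\<xi>) f is 0 and d\<eta>(v, \<xi>) = 0, so \<eta>(v) = \<eta>(v) \<eta>(\<xi>) = 0. The
  product term of \<open>L\<close> then vanishes and the solution satisfies the Hamiltonian
  equation.\<close>

lemma hamiltonian_vector_exists:
  assumes f: "f \<in> C_infinity M"
  shows "\<exists>v. v \<in> fibre A p \<and> \<eta> p v = 0 \<and> (\<forall>w\<in>fibre A p. d\<eta>_at p v w = \<rho> p w f)"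
proof -
  obtain W e where W: "p \<in> W" and e: "\<And>i. e i \<in> sections M A"
    and fr: "\<And>q. q \<in> W \<Longrightarrow> is_frame q (\<lambda>i. e i q)"
    by (rule local_frame[of p]) blast
  note ef = sectionsD(1)[OF e, of _ p]
  obtain x where x: "\<And>j. j < DIM('f) \<Longrightarrow> (\<Sum>i<DIM('f). x i * L p (e i p) (e j p)) = \<rho> p (e j p) f"
    using injective_system_solvable[of "DIM('f)" "\<lambda>i j. L p (e i p) (e j p)" "\<lambda>j. \<rho> p (e j p) f",
          OF frame_L_injective[OF fr[OF W]]] by blast
  define v where "v = (\<Sum>i<DIM('f). x i *\<^sub>R e i p)"
  have v: "v \<in> fibre A p" unfolding v_def by (rule subspace_sum[OF fibre_subspace fibre_scale[OF ef]])
  have L: "L p v w = \<rho> p w f" if w: "w \<in> fibre A p" for w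
  proof -
    have "fibrewise_linear (fibre A p) (\<lambda>w. L p v w - \<rho> p w f)"
      unfolding fibrewise_linear_def
      by (simp add: fibrewise_linear_add[OF L_linear_right[OF v]] fibrewise_linear_add[OF anchor_linear_at]
          fibrewise_linear_scale[OF L_linear_right[OF v]] fibrewise_linear_scale[OF anchor_linear_at] algebra_simps)
    then have "L p v w - \<rho> p w f = 0"
      by (rule frame_test[OF _ fr[OF W] w]) (simp add: v_def L_sum_left[OF ef ef] x)
    then show ?thesis by simp
  qed
  let ?\<xi> = "reeb_section M A br \<rho> \<eta>"
  have \<xi>: "?\<xi> \<in> sections M A" "\<eta> p (?\<xi> p) = 1" "\<And>T. T \<in> sections M A \<Longrightarrow> d\<eta> ?\<xi> T p = 0"
    using reeb_section_is_reeb unfolding is_reeb_def by blast+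
  obtain X where X: "X \<in> sections M A" "X p = v" by (rule section_through[OF v])
  have "L p v (?\<xi> p) = 0" using L[OF sectionsD(1)[OF \<xi>(1)]] reeb by simp
  moreover have "d\<eta>_at p v (?\<xi> p) = 0"
    using d\<eta>_at_eq[OF X(1) \<xi>(1), of p] d\<eta>_skew[OF X(1) \<xi>(1), of p] \<xi>(3)[OF X(1)] X(2) by simp
  ultimately have "\<eta> p v = 0" using \<xi>(2) by (simp add: L_def)
  moreover from this have "d\<eta>_at p v w = \<rho> p w f" if "w \<in> fibre A p" for w
    using L[OF that] by (simp add: L_def)
  ultimately show ?thesis using v by blast
qed

lemma is_hamiltonian_exists:
  assumes f: "f \<in> C_infinity M"
  shows "\<exists>a. is_hamiltonian f a"
proof -
  obtain a where a: "\<And>p. a p \<in> fibre A p" "\<And>p. \<eta> p (a p) = 0"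
    "\<And>p w. w \<in> fibre A p \<Longrightarrow> d\<eta>_at p (a p) w = \<rho> p w f"
  proof -
    have "\<forall>p. \<exists>v. v \<in> fibre A p \<and> \<eta> p v = 0 \<and> (\<forall>w\<in>fibre A p. d\<eta>_at p v w = \<rho> p w f)"
      by (rule allI) (rule hamiltonian_vector_exists[OF f])
    from choice[OF this] obtain a where
      "\<forall>p. a p \<in> fibre A p \<and> \<eta> p (a p) = 0 \<and> (\<forall>w\<in>fibre A p. d\<eta>_at p (a p) w = \<rho> p w f)" by (elim exE)
    then show thesis by (intro that[of a]) simp_all
  qed
  have "a \<in> sections M A"
  proof (rule section_of_smooth_system[OF a(1)])
    fix T assume T: "T \<in> sections M A"
    have "(\<lambda>p. L p (a p) (T p)) = act \<rho> T f"
      by (rule ext) (simp add: L_def act_def a(2) a(3)[OF sectionsD(1)[OF T]])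
    then show "(\<lambda>p. L p (a p) (T p)) \<in> C_infinity M" using act_smooth[OF T f] by simp
  qed
  moreover from this have "act \<rho> T f p = d\<eta> a T p" if T: "T \<in> sections M A" for T p
    using d\<eta>_at_eq[OF _ T, of a p] a(3)[OF sectionsD(1)[OF T], of p] by (simp add: act_def)
  ultimately show ?thesis using a(2) unfolding is_hamiltonian_def by blast
qed

lemma ham_is_hamiltonian:
  assumes f: "f \<in> C_infinity M"
  shows "is_hamiltonian f (ham f)"
proof -
  obtain a where a: "is_hamiltonian f a" using is_hamiltonian_exists[OF f] by blast
  have "b = a" if "is_hamiltonian f b" for b
  proof (rule sections_eqI)
    show "d\<eta> b X p = d\<eta> a X p" if X: "X \<in> sections M A" for X p
      using \<open>is_hamiltonian f b\<close> a X unfolding is_hamiltonian_def by metis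
  qed (use that a in \<open>auto simp: is_hamiltonian_def\<close>)
  with a have *: "is_hamiltonian f (THE a. is_hamiltonian f a)" by (rule theI)
  have z: "act \<rho> (reeb_section M A br \<rho> \<eta>) f p = 0" for p by (simp add: act_def reeb)
  have "ham f = (THE a. is_hamiltonian f a)"
    unfolding hamiltonian_section_def is_hamiltonian_def ext_d0_def z by simp
  then show ?thesis using * by simp
qed

context
  fixes f assumes f: "f \<in> C_infinity M"
begin

lemma ham_section: "ham f \<in> sections M A"
  and eta_ham: "\<eta> p (ham f p) = 0"
  and act_eq_d\<eta>: "T \<in> sections M A \<Longrightarrow> act \<rho> T f p = d\<eta> (ham f) T p"
  using ham_is_hamiltonian[OF f] unfolding is_hamiltonian_def by simp_all

end

section \<open>The Poisson bracket and its identities\<close>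

definition pb :: "('m \<Rightarrow> real) \<Rightarrow> ('m \<Rightarrow> real) \<Rightarrow> 'm \<Rightarrow> real" where
  "pb f g = d\<eta> (ham f) (ham g)"

lemma pb_smooth:
  assumes f: "f \<in> C_infinity M" and g: "g \<in> C_infinity M"
  shows "pb f g \<in> C_infinity M"
  unfolding pb_def by (rule d\<eta>_smooth[OF ham_section[OF f] ham_section[OF g]])

lemma pb_skew:
  assumes f: "f \<in> C_infinity M" and g: "g \<in> C_infinity M"
  shows "pb f g p = - pb g f p"
  unfolding pb_def by (rule d\<eta>_skew[OF ham_section[OF f] ham_section[OF g]])

text \<open>The Hamiltonian equation of \<open>f\<close> tested on the section of \<open>g\<close>.
  It exhibits the bracket as a vector field acting on its first argument, so linearity and the
  product rule follow without any study of how \<open>ham f\<close> depends on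
  \<open>f\<close>.\<close>

lemma act_ham:
  assumes f: "f \<in> C_infinity M" and g: "g \<in> C_infinity M"
  shows "act \<rho> (ham g) f = pb f g"
  unfolding pb_def by (rule ext) (rule act_eq_d\<eta>[OF f ham_section[OF g]])

lemma pb_linear_left:
  assumes f: "f \<in> C_infinity M" and g: "g \<in> C_infinity M" and h: "h \<in> C_infinity M"
  shows "pb (\<lambda>p. a * f p + b * g p) h p = a * pb f h p + b * pb g h p"
  unfolding act_ham[OF f h, symmetric] act_ham[OF g h, symmetric]
    act_ham[OF C_infinity_add[OF C_infinity_scale[OF f] C_infinity_scale[OF g]] h, symmetric]
  by (rule act_linear_fun[OF ham_section[OF h] f g])

lemma pb_linear_right:
  assumes f: "f \<in> C_infinity M" and g: "g \<in> C_infinity M" and h: "h \<in> C_infinity M"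
  shows "pb h (\<lambda>p. a * f p + b * g p) p = a * pb h f p + b * pb h g p"
  using pb_linear_left[OF f g h, of a b p] pb_skew[OF h f, of p] pb_skew[OF h g, of p]
    pb_skew[OF h C_infinity_add[OF C_infinity_scale[OF f] C_infinity_scale[OF g]], of a b p]
  by simp

lemma pb_Leibniz:
  assumes f: "f \<in> C_infinity M" and g: "g \<in> C_infinity M" and h: "h \<in> C_infinity M"
  shows "pb f (\<lambda>p. g p * h p) p = pb f g p * h p + g p * pb f h p"
proof -
  have "pb (\<lambda>p. g p * h p) f p = g p * pb h f p + pb g f p * h p"
    unfolding act_ham[OF C_infinity_mult[OF g h] f, symmetric] act_ham[OF h f, symmetric]
      act_ham[OF g f, symmetric] by (rule act_mult_fun[OF ham_section[OF f] g h])
  then show ?thesis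
    using pb_skew[OF f C_infinity_mult[OF g h], of p] pb_skew[OF f g, of p] pb_skew[OF f h, of p] by simp
qed

text \<open>In the formula for d\<eta> the two derivative terms differentiate \<eta>(a_g) and
  \<eta>(a_f), which are identically 0; only the bracket term survives.\<close>

lemma pb_eq_eta_br:
  assumes f: "f \<in> C_infinity M" and g: "g \<in> C_infinity M"
  shows "pb f g p = - \<eta> p (br (ham f) (ham g) p)"
proof -
  have z: "act \<rho> (ham k) (\<lambda>q. 0) p = 0" if "k \<in> C_infinity M" for k
    using act_linear_fun[OF ham_section[OF that] C_infinity_const[of 0] C_infinity_const[of 0], of 0 0 p] by simp
  show ?thesis unfolding pb_def ext_d1_def eta_ham[OF f] eta_ham[OF g] z[OF f] z[OF g] by simp
qed

text \<open>Evaluate \<open>d\<eta>([a\<^sub>f, a\<^sub>g], a\<^sub>h)\<close> once by the formula for the exterior derivative and once by the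
  Hamiltonian equation for \<open>h\<close>.\<close>

lemma pb_double:
  assumes f: "f \<in> C_infinity M" and g: "g \<in> C_infinity M" and h: "h \<in> C_infinity M"
  shows "pb f (pb g h) p + pb g (pb h f) p = pb h (pb f g) p - \<eta> p (br (ham h) (br (ham f) (ham g)) p)"
proof -
  let ?X = "ham f" and ?Y = "ham g" and ?Z = "ham h"
  note X = ham_section[OF f] and Y = ham_section[OF g] and Z = ham_section[OF h]
  note XY = br_section[OF X Y]
  have neg: "(\<lambda>q. \<eta> q (br ?X ?Y q)) = (\<lambda>q. - pb f g q)" by (rule ext) (simp add: pb_eq_eta_br[OF f g])
  have z: "act \<rho> (br ?X ?Y) (\<lambda>q. 0) p = 0"
    using act_linear_fun[OF XY C_infinity_const[of 0] C_infinity_const[of 0], of 0 0 p] by simp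
  have "d\<eta> ?Z (br ?X ?Y) p = act \<rho> ?Z (\<lambda>q. - pb f g q) p - \<eta> p (br ?Z (br ?X ?Y) p)"
    unfolding ext_d1_def neg eta_ham[OF h] z by simp
  also have "act \<rho> ?Z (\<lambda>q. - pb f g q) p = - act \<rho> ?Z (pb f g) p"
    by (rule act_uminus_fun[OF Z pb_smooth[OF f g]])
  also have "act \<rho> ?Z (pb f g) p = - pb h (pb f g) p"
    unfolding act_ham[OF pb_smooth[OF f g] h] by (rule pb_skew[OF pb_smooth[OF f g] h])
  finally have 1: "d\<eta> ?Z (br ?X ?Y) p = pb h (pb f g) p - \<eta> p (br ?Z (br ?X ?Y) p)" by simp
  have "d\<eta> ?Z (br ?X ?Y) p = act \<rho> (br ?X ?Y) h p"
    by (rule act_eq_d\<eta>[OF h XY, symmetric])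
  also have "\<dots> = act \<rho> ?X (act \<rho> ?Y h) p - act \<rho> ?Y (act \<rho> ?X h) p"
    by (rule act_br[OF X Y h])
  also have "\<dots> = pb (pb h g) f p - pb (pb h f) g p"
    by (simp only: act_ham[OF h g] act_ham[OF h f] act_ham[OF pb_smooth[OF h g] f] act_ham[OF pb_smooth[OF h f] g])
  also have "pb (pb h g) f p = pb f (pb g h) p"
  proof -
    \<comment> \<open>Skew symmetry inside the outer bracket, with a zero summand added to fit the
      shape of \<open>pb_linear_left\<close>; a second sign change from the outer bracket then
      cancels the first.\<close>
    have "pb h g = (\<lambda>q. - 1 * pb g h q + 0 * pb g h q)" by (rule ext) (simp add: pb_skew[OF h g])
    then have "pb (pb h g) f p = - pb (pb g h) f p"
      using pb_linear_left[OF pb_smooth[OF g h] pb_smooth[OF g h] f, of "-1" 0 p] by simp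
    then show ?thesis using pb_skew[OF pb_smooth[OF g h] f, of p] by simp
  qed
  also have "pb (pb h f) g p = - pb g (pb h f) p"
    by (rule pb_skew[OF pb_smooth[OF h f] g])
  finally show ?thesis using 1 by simp
qed

text \<open>In the cyclic sum of \<open>pb_double\<close> the left-hand sides give twice the
  Jacobiator. The right-hand sides give it once, minus \<eta> of the Jacobi sum of the Hamiltonian
  sections, which is 0.\<close>

lemma pb_Jacobi:
  assumes f: "f \<in> C_infinity M" and g: "g \<in> C_infinity M" and h: "h \<in> C_infinity M"
  shows "pb f (pb g h) p + pb g (pb h f) p + pb h (pb f g) p = 0"
proof -
  let ?X = "ham f" and ?Y = "ham g" and ?Z = "ham h"
  note X = ham_section[OF f] and Y = ham_section[OF g] and Z = ham_section[OF h]
  note XYZ = br_section[OF X br_section[OF Y Z]] and YZX = br_section[OF Y br_section[OF Z X]]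
    and ZXY = br_section[OF Z br_section[OF X Y]]
  have "\<eta> p (br ?X (br ?Y ?Z) p) + \<eta> p (br ?Y (br ?Z ?X) p) + \<eta> p (br ?Z (br ?X ?Y) p) =
      \<eta> p (br ?X (br ?Y ?Z) p + br ?Y (br ?Z ?X) p + br ?Z (br ?X ?Y) p)"
    by (simp add: eta_add[OF sections_add[OF XYZ YZX] ZXY] eta_add[OF XYZ YZX])
  also have "\<dots> = 0" unfolding br_Jacobi[OF X Y Z] by (rule fibrewise_linear_zero[OF eta_linear fibre_zero])
  finally show ?thesis
    using pb_double[OF f g h, of p] pb_double[OF g h f, of p] pb_double[OF h f g, of p] by linarith
qed

lemma poisson_structure_pb: "poisson_structure M pb"
  unfolding poisson_structure_def
proof (intro conjI ballI allI)
  fix f g h a b assume fgh: "f \<in> C_infinity M" "g \<in> C_infinity M" "h \<in> C_infinity M"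
  show "pb (\<lambda>p. a * f p + b * g p) h = (\<lambda>p. a * pb f h p + b * pb g h p)"
    by (rule ext) (rule pb_linear_left[OF fgh])
  show "pb h (\<lambda>p. a * f p + b * g p) = (\<lambda>p. a * pb h f p + b * pb h g p)"
    by (rule ext) (rule pb_linear_right[OF fgh])
  show "pb f (\<lambda>p. g p * h p) = (\<lambda>p. pb f g p * h p + g p * pb f h p)"
    by (rule ext) (rule pb_Leibniz[OF fgh])
qed (rule pb_smooth pb_skew pb_Jacobi; assumption)+

end

theorem theorem4p2:
  fixes M :: "('m::{t2_space,second_countable_topology}, 'e::real_inner) chart set"
    and A :: "('m, 'v::real_vector, 'f::euclidean_space) vbundle"
    and br :: "('m \<Rightarrow> 'v) \<Rightarrow> ('m \<Rightarrow> 'v) \<Rightarrow> 'm \<Rightarrow> 'v"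
    and \<rho> :: "'m \<Rightarrow> 'v \<Rightarrow> ('m \<Rightarrow> real) \<Rightarrow> real"
    and \<eta> :: "'m \<Rightarrow> 'v \<Rightarrow> real"
    and n :: nat
  assumes contact: "contact_lie_algebroid M A br \<rho> \<eta> n"
    and reeb: "\<And>p. \<rho> p (reeb_section M A br \<rho> \<eta> p) = 0"
  shows "poisson_structure M (\<lambda>f g.
           ext_d1 br \<rho> \<eta> (hamiltonian_section M A br \<rho> \<eta> f) (hamiltonian_section M A br \<rho> \<eta> g))"
proof -
  from contact have c: "lie_algebroid M A br \<rho>" "\<And>p. dim (fibre A p) = 2 * n + 1" "\<eta> \<in> dual_sections M A"
    "\<And>p. \<exists>S. (\<forall>i. S i \<in> sections M A) \<and> contact_volume br \<rho> \<eta> n S p \<noteq> 0"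
    unfolding contact_lie_algebroid_def by simp_all
  interpret lie_algd M A br \<rho> by (rule lie_algdI[OF c(1)])
  interpret reeb_trivial_contact_algd M A br \<rho> \<eta> n
    by unfold_locales (rule c reeb)+
  have "pb = (\<lambda>f g. ext_d1 br \<rho> \<eta> (hamiltonian_section M A br \<rho> \<eta> f) (hamiltonian_section M A br \<rho> \<eta> g))"
    by (intro ext) (simp add: pb_def)
  then show ?thesis using poisson_structure_pb by simp
qed

end
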